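(* Let $p,k,n\in\mathbb{N}$ be such that $1\leq p\leq k-1$ and $n=k+p$. Then (isomorphic digraphs being identified) $$\overrightarrow{\mathrm{EXT}}(k,n)=D^{\pm}(K_{k-p-1})\boxplus\overrightarrow{\mathcal{DG}}(p+1).$$ As a consequence, $\overrightarrow{\mathrm{ext}}(k,n)=2\binom{n}{2}-3$ if $p=1$, and $\overrightarrow{\mathrm{ext}}(k,n)=2\left(\binom{n}{2}-(p^2+1)\right)$ otherwise.
   Context: Digraphs are finite and simple: no loops and no parallel arcs in the same direction, but two opposite arcs between the same pair of vertices (a digon) are allowed. $A(D)$ is the arc set of $D$, and the order $|D|$ is the number of vertices. A digraph is acyclic if it contains no directed cycle as a subdigraph (a digon is a directed cycle of order 2). The dichromatic number $\vec{\chi}(D)$ is the least integer $k\geq 0$ such that there is a map $V(D)\to\{1,\dots,k\}$ each of whose color classes induces an acyclic subdigraph of $D$. A digraph $D$ is $k$-critical if $\vec{\chi}(D)=k$ and every proper subdigraph $D'$ of $D$ satisfies $\vec{\chi}(D')<k$. $\overrightarrow{\mathrm{CRI}}(k,n)$ is the class of $k$-critical digraphs of order $n$; $\overrightarrow{\mathrm{ext}}(k,n)=\min\{|A(D)| : D\in\overrightarrow{\mathrm{CRI}}(k,n)\}$; and $\overrightarrow{\mathrm{EXT}}(k,n)=\{D\in\overrightarrow{\mathrm{CRI}}(k,n) : |A(D)|=\overrightarrow{\mathrm{ext}}(k,n)\}$. For a graph $G$ (finite, undirected, simple), $D^{\pm}(G)$ is the digraph obtained from $G$ by replacing each edge by a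 digon between the same vertices; $K_m$ is the complete graph of order $m$ ($K_0$ is empty). $\vec{C}_m$ is the directed cycle of order $m$. The Dirac join $D_1\boxplus D_2$ of two disjoint digraphs is obtained from $D_1\cup D_2$ by adding all arcs $uv$ and $vu$ with $u\in V(D_1)$, $v\in V(D_2)$ (joining with the empty digraph changes nothing). For a digraph $K$ and a class $\mathcal{D}$ of digraphs, $K\boxplus\mathcal{D}=\{K\boxplus D : D\in\mathcal{D}\}$. For $k\geq 3$, $\mathcal{DG}(k)$ is the class of graphs $G$ whose vertex set consists of three non-empty pairwise disjoint sets $X,Y_1,Y_2$ with $|Y_1|+|Y_2|=|X|+1=k-1$ and two additional distinct vertices $v_1,v_2$, such that $G[X]$ and $G[Y_1\cup Y_2]$ are complete graphs not joined by any edge of $G$, and for $i\in\{1,2\}$ the neighborhood of $v_i$ in $G$ is exactly $X\cup Y_i$. Finally, $\overrightarrow{\mathcal{DG}}(2)=\{\vec{C}_3\}$ and $\overrightarrow{\mathcal{DG}}(k)=\{D^{\pm}(G) : G\in\mathcal{DG}(k)\}$ for $k\geq 3$. *)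

theory Defs
  imports "Graph_Theory.Graph_Theory"
begin

text \<open>
  Finite simple digraphs (no loops, no parallel arcs, digons allowed) are the
  \<^locale>\<open>pair_digraph\<close>s of the Graph Theory entry.
\<close>

subsection \<open>Dichromatic number and critical digraphs\<close>

text \<open>A digon \<open>u, v, u\<close> is a \<^const>\<open>pre_digraph.cycle\<close>.\<close>

definition acyclic_digraph :: "('a, 'b) pre_digraph \<Rightarrow> bool" where
  "acyclic_digraph D \<longleftrightarrow> \<not> (\<exists>c. pre_digraph.cycle D c)"

definition acyclic_coloring :: "('a, 'b) pre_digraph \<Rightarrow> nat \<Rightarrow> ('a \<Rightarrow> nat) \<Rightarrow> bool" where
  "acyclic_coloring D k f \<longleftrightarrow>
     f ` verts D \<subseteq> {1..k} \<and>
     (\<forall>i\<in>{1..k}. acyclic_digraph (D \<restriction> {v \<in> verts D. f v = i}))"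

definition dichromatic_number :: "('a, 'b) pre_digraph \<Rightarrow> nat" where
  "dichromatic_number D = (LEAST k. \<exists>f. acyclic_coloring D k f)"

definition critical :: "nat \<Rightarrow> ('a, 'b) pre_digraph \<Rightarrow> bool" where
  "critical k D \<longleftrightarrow>
     dichromatic_number D = k \<and>
     (\<forall>D'. subgraph D' D \<and> D' \<noteq> D \<longrightarrow> dichromatic_number D' < k)"

definition CRI :: "nat \<Rightarrow> nat \<Rightarrow> 'a pair_pre_digraph set" where
  "CRI k n = {D. pair_digraph D \<and> critical k (with_proj D) \<and> card (pverts D) = n}"

text \<open>
  The minimum is taken over digraphs with vertices in \<^typ>\<open>nat\<close>, which represent all
  finite digraphs up to isomorphism; \<open>CRI\<close> and \<open>EXT\<close> are available over every vertex type.
\<close>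

definition ext :: "nat \<Rightarrow> nat \<Rightarrow> nat" where
  "ext k n = (INF D\<in>(CRI k n :: nat pair_pre_digraph set). card (parcs D))"

definition EXT :: "nat \<Rightarrow> nat \<Rightarrow> 'a pair_pre_digraph set" where
  "EXT k n = {D \<in> CRI k n. card (parcs D) = ext k n}"

subsection \<open>Graphs, directed cycles and bidirected graphs\<close>

record 'a ugraph =
  uverts :: "'a set"
  uedges :: "'a set set"

definition simple_graph :: "'a ugraph \<Rightarrow> bool" where
  "simple_graph G \<longleftrightarrow>
     finite (uverts G) \<and> (\<forall>e\<in>uedges G. e \<subseteq> uverts G \<and> card e = 2)"

definition neighborhood :: "'a ugraph \<Rightarrow> 'a \<Rightarrow> 'a set" where
  "neighborhood G v = {u. {v, u} \<in> uedges G}"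

definition induces_complete :: "'a ugraph \<Rightarrow> 'a set \<Rightarrow> bool" where
  "induces_complete G S \<longleftrightarrow> (\<forall>u\<in>S. \<forall>v\<in>S. u \<noteq> v \<longrightarrow> {u, v} \<in> uedges G)"

definition complete_graph :: "nat \<Rightarrow> nat ugraph" where
  "complete_graph m = \<lparr> uverts = {..<m}, uedges = {e. e \<subseteq> {..<m} \<and> card e = 2} \<rparr>"

definition bidirected :: "'a ugraph \<Rightarrow> 'a pair_pre_digraph" where
  "bidirected G = \<lparr> pverts = uverts G, parcs = {(u, v). {u, v} \<in> uedges G} \<rparr>"

definition directed_cycle :: "nat \<Rightarrow> nat pair_pre_digraph" where
  "directed_cycle m = \<lparr> pverts = {..<m}, parcs = (\<lambda>i. (i, Suc i mod m)) ` {..<m} \<rparr>"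

subsection \<open>Dirac join\<close>

text \<open>Disjointness of the two digraphs is realised by the sum type.\<close>

definition dirac_join ::
    "'a pair_pre_digraph \<Rightarrow> 'b pair_pre_digraph \<Rightarrow> ('a + 'b) pair_pre_digraph"
    (infixl \<open>\<boxplus>\<close> 65) where
  "D\<^sub>1 \<boxplus> D\<^sub>2 =
     \<lparr> pverts = Inl ` pverts D\<^sub>1 \<union> Inr ` pverts D\<^sub>2,
       parcs = map_prod Inl Inl ` parcs D\<^sub>1 \<union> map_prod Inr Inr ` parcs D\<^sub>2
         \<union> Inl ` pverts D\<^sub>1 \<times> Inr ` pverts D\<^sub>2
         \<union> Inr ` pverts D\<^sub>2 \<times> Inl ` pverts D\<^sub>1 \<rparr>"

subsection \<open>The classes of graphs and digraphs\<close>

definition DG :: "nat \<Rightarrow> 'a ugraph set" where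
  "DG k = {G. k \<ge> 3 \<and> simple_graph G \<and>
     (\<exists>X Y\<^sub>1 Y\<^sub>2 v\<^sub>1 v\<^sub>2.
        uverts G = X \<union> Y\<^sub>1 \<union> Y\<^sub>2 \<union> {v\<^sub>1, v\<^sub>2} \<and>
        X \<noteq> {} \<and> Y\<^sub>1 \<noteq> {} \<and> Y\<^sub>2 \<noteq> {} \<and>
        X \<inter> Y\<^sub>1 = {} \<and> X \<inter> Y\<^sub>2 = {} \<and> Y\<^sub>1 \<inter> Y\<^sub>2 = {} \<and>
        v\<^sub>1 \<notin> X \<union> Y\<^sub>1 \<union> Y\<^sub>2 \<and> v\<^sub>2 \<notin> X \<union> Y\<^sub>1 \<union> Y\<^sub>2 \<and> v\<^sub>1 \<noteq> v\<^sub>2 \<and>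
        card Y\<^sub>1 + card Y\<^sub>2 = card X + 1 \<and> card X + 1 = k - 1 \<and>
        induces_complete G X \<and> induces_complete G (Y\<^sub>1 \<union> Y\<^sub>2) \<and>
        (\<forall>x\<in>X. \<forall>y\<in>Y\<^sub>1 \<union> Y\<^sub>2. {x, y} \<notin> uedges G) \<and>
        neighborhood G v\<^sub>1 = X \<union> Y\<^sub>1 \<and> neighborhood G v\<^sub>2 = X \<union> Y\<^sub>2)}"

text \<open>Only meaningful for \<open>k \<ge> 2\<close>; every isomorphism type is represented over \<^typ>\<open>nat\<close>.\<close>

definition digraph_DG :: "nat \<Rightarrow> nat pair_pre_digraph set" where
  "digraph_DG k = (if k = 2 then {directed_cycle 3} else bidirected ` DG k)"

definition iso_closure :: "'b pair_pre_digraph set \<Rightarrow> 'a pair_pre_digraph set" where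
  "iso_closure \<D> = {D. \<exists>D'\<in>\<D>. digraph_iso (with_proj D) (with_proj D')}"

end

theory Submission
  imports Defs
begin

text \<open>
  Only the sets of non-arcs matter. Let \<open>R\<close> be vertex-critical with \<open>chi = k\<close> on \<open>k + p\<close> vertices. By
  induction on the number of vertices, at most \<open>missing_bound p\<close> arcs are missing, with equality only
  if the missing arcs form the complement of a member of \<open>digraph_DG (p + 1)\<close>. Criticality gives every
  vertex at most \<open>p\<close> missing out-arcs and at most \<open>p\<close> missing in-arcs, which settles \<open>k \<le> p\<close>. If
  \<open>k \<ge> p + 2\<close>, a directed form of Gallai's theorem (proved by exchanging singleton colour classes
  between optimal colourings) splits the digraph into a Dirac join, and \<open>missing_bound\<close> is strictly
  superadditive. If \<open>k = p + 1\<close>, delete the two vertices of a pair that is not a digon: what remains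
  contains a \<open>p\<close>-vertex-critical set \<open>V\<close>, and the induction hypothesis for \<open>V\<close> together with the degree
  bound suffices, unless \<open>V\<close> is a complete digraph on \<open>p\<close> vertices. In that last case Hall's theorem
  shows that the pairs of the complement of \<open>V\<close> that are not digons form a star, and the structure
  follows by counting. Conversely, for a digraph attaining the bound, criticality under deletion of
  arcs is a consequence of the bound itself.
\<close>

subsection \<open>Acyclic colourings of a relation\<close>

abbreviation acyclic_on :: "'a rel \<Rightarrow> 'a set \<Rightarrow> bool" where
  "acyclic_on R A \<equiv> acyclic (Restr R A)"

definition colouring :: "'a rel \<Rightarrow> 'a set \<Rightarrow> ('a \<Rightarrow> 'b) \<Rightarrow> bool" where
  "colouring R S c \<longleftrightarrow> (\<forall>i. acyclic_on R {v \<in> S. c v = i})"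

definition chi :: "'a rel \<Rightarrow> 'a set \<Rightarrow> nat" where
  "chi R S = (LEAST k. \<exists>c :: 'a \<Rightarrow> nat. colouring R S c \<and> card (c ` S) = k)"

definition vertex_critical :: "'a rel \<Rightarrow> nat \<Rightarrow> 'a set \<Rightarrow> bool" where
  "vertex_critical R k S \<longleftrightarrow> finite S \<and> chi R S = k \<and> (\<forall>v\<in>S. chi R (S - {v}) < k)"

lemma acyclic_on_mono:
  assumes "acyclic_on R' B" "A \<subseteq> B" "R \<subseteq> R'"
  shows "acyclic_on R A"
  by (rule acyclic_subset[OF assms(1)]) (use assms(2,3) in auto)

lemma acyclic_on_converse: "acyclic_on (R\<inverse>) A \<longleftrightarrow> acyclic_on R A"
proof -
  have "Restr (R\<inverse>) A = (Restr R A)\<inverse>" by auto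
  then show ?thesis by (metis acyclic_converse)
qed

lemma acyclic_on_insert_sink:
  assumes "acyclic_on R A" "\<forall>u\<in>insert v A. (v, u) \<notin> R"
  shows "acyclic_on R (insert v A)"
proof -
  have *: "x \<noteq> v \<and> (y = v \<or> (x, y) \<in> (Restr R A)\<^sup>+)" if "(x, y) \<in> (Restr R (insert v A))\<^sup>+" for x y
    using that
  proof (induction rule: trancl_induct)
    case (base y)
    then show ?case using assms(2) by auto
  next
    case (step y z)
    then have "y \<noteq> v" "z \<noteq> v \<Longrightarrow> (y, z) \<in> Restr R A" using assms(2) by auto
    with step.IH show ?case by (auto intro: trancl_into_trancl)
  qed
  show ?thesis unfolding acyclic_def using * assms(1) by (metis acyclic_def)
qed

lemma acyclic_on_insert_source:
  assumes "acyclic_on R A" "\<forall>u\<in>insert v A. (u, v) \<notin> R"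
  shows "acyclic_on R (insert v A)"
proof -
  have "acyclic_on (R\<inverse>) (insert v A)"
    by (rule acyclic_on_insert_sink) (use assms acyclic_on_converse[of R A] in auto)
  then show ?thesis by (simp only: acyclic_on_converse)
qed

lemma acyclic_on_empty: "acyclic {}" "acyclic_on R {}"
  by (simp_all add: acyclic_def)

lemma digon_not_acyclic_on:
  assumes "u \<in> A" "v \<in> A" "(u, v) \<in> R" "(v, u) \<in> R"
  shows "\<not> acyclic_on R A"
proof -
  have "(u, v) \<in> Restr R A" "(v, u) \<in> Restr R A" using assms by auto
  then have "(u, u) \<in> (Restr R A)\<^sup>+" by (rule trancl.trancl_into_trancl[OF trancl.r_into_trancl])
  then show ?thesis by (auto simp: acyclic_def)
qed

lemma triangle_not_acyclic_on:
  assumes "a \<in> A" "b \<in> A" "c \<in> A" "(a, b) \<in> R" "(b, c) \<in> R" "(c, a) \<in> R"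
  shows "\<not> acyclic_on R A"
proof -
  have "(a, b) \<in> Restr R A" "(b, c) \<in> Restr R A" "(c, a) \<in> Restr R A" using assms by auto
  then have "(a, a) \<in> (Restr R A)\<^sup>+"
    by (meson trancl.trancl_into_trancl trancl.r_into_trancl)
  then show ?thesis by (auto simp: acyclic_def)
qed

lemma acyclic_on_singleton: "irrefl R \<Longrightarrow> acyclic_on R {v}"
  by (rule acyclic_on_insert_sink[OF acyclic_on_empty(2)]) (auto simp: irrefl_def)

lemma acyclic_on_pair:
  assumes "irrefl R" "(u, v) \<notin> R \<or> (v, u) \<notin> R"
  shows "acyclic_on R {u, v}"
  using assms acyclic_on_insert_sink[OF acyclic_on_singleton, of R u v]
    acyclic_on_insert_source[OF acyclic_on_singleton, of R u v]
  by (auto simp: insert_commute irrefl_def)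

lemma colouringD: "colouring R S c \<Longrightarrow> A \<subseteq> S \<Longrightarrow> \<forall>v\<in>A. c v = i \<Longrightarrow> acyclic_on R A"
  unfolding colouring_def by (rule acyclic_on_mono[of R "{v \<in> S. c v = i}"]) auto

lemma colouring_mono:
  assumes "colouring R' T c" "S \<subseteq> T" "R \<subseteq> R'"
  shows "colouring R S c"
  unfolding colouring_def
proof
  fix i show "acyclic_on R {v \<in> S. c v = i}"
    by (rule acyclic_on_mono[of R' "{v \<in> T. c v = i}"]) (use assms in \<open>auto simp: colouring_def\<close>)
qed

lemma chi_le:
  fixes c :: "'a \<Rightarrow> 'b"
  assumes "finite S" "colouring R S c"
  shows "chi R S \<le> card (c ` S)"
proof -
  obtain g :: "'b \<Rightarrow> nat" where g: "inj_on g (c ` S)"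
    using finite_imp_inj_to_nat_seg[of "c ` S"] assms(1) by auto
  have "colouring R S (g \<circ> c)" unfolding colouring_def
  proof
    fix i
    show "acyclic_on R {v \<in> S. (g \<circ> c) v = i}"
    proof (cases "\<exists>v\<in>S. g (c v) = i")
      case True
      then obtain w where "w \<in> S" "g (c w) = i" by auto
      then have "{v \<in> S. (g \<circ> c) v = i} = {v \<in> S. c v = c w}"
        using g by (auto simp: inj_on_def)
      then show ?thesis using assms(2) by (simp add: colouring_def)
    next
      case False
      then have "{v \<in> S. (g \<circ> c) v = i} = {}" by auto
      then show ?thesis by (simp add: acyclic_on_empty del: Collect_empty_eq)
    qed
  qed
  moreover have "card ((g \<circ> c) ` S) = card (c ` S)"
    using card_image[OF g] by (simp add: image_comp)
  ultimately show ?thesis unfolding chi_def by (metis (mono_tags, lifting) Least_le)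
qed

lemma colouring_inj:
  assumes "irrefl R" "inj_on c S"
  shows "colouring R S c"
  unfolding colouring_def
proof
  fix i
  show "acyclic_on R {v \<in> S. c v = i}"
  proof (cases "\<exists>v\<in>S. c v = i")
    case True
    then obtain w where "w \<in> S" "c w = i" by auto
    then have "{v \<in> S. c v = i} = {w}" using assms(2) by (auto simp: inj_on_def)
    then show ?thesis using acyclic_on_singleton[OF assms(1), of w] by simp
  next
    case False
    then have "{v \<in> S. c v = i} = {}" by auto
    then show ?thesis by (simp add: acyclic_on_empty del: Collect_empty_eq)
  qed
qed

lemma chi_attained:
  assumes "irrefl R" "finite S"
  obtains c :: "'a \<Rightarrow> nat" where "colouring R S c" "card (c ` S) = chi R S"
proof -
  obtain g :: "'a \<Rightarrow> nat" where g: "inj_on g S"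
    using finite_imp_inj_to_nat_seg[OF assms(2)] by auto
  have "\<exists>k. \<exists>c :: 'a \<Rightarrow> nat. colouring R S c \<and> card (c ` S) = k"
    using colouring_inj[OF assms(1) g] by auto
  from LeastI_ex[OF this] show ?thesis using that unfolding chi_def by auto
qed

lemma chi_mono:
  assumes "irrefl R'" "finite T" "S \<subseteq> T" "R \<subseteq> R'"
  shows "chi R S \<le> chi R' T"
proof -
  obtain c :: "'a \<Rightarrow> nat" where c: "colouring R' T c" "card (c ` T) = chi R' T"
    using chi_attained assms by metis
  have "chi R S \<le> card (c ` S)"
    using chi_le colouring_mono[OF c(1) assms(3,4)] assms finite_subset by metis
  also have "\<dots> \<le> card (c ` T)" using assms by (intro card_mono) auto
  finally show ?thesis using c by simp
qed

lemma chi_empty [simp]: "chi R {} = 0"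
  using chi_le[of "{}" R "\<lambda>_. ()"] by (simp add: colouring_def acyclic_def)

lemma chi_le_card: "irrefl R \<Longrightarrow> finite S \<Longrightarrow> chi R S \<le> card S"
  using chi_le[OF _ colouring_inj[of R id S]] by simp

lemma chi_le_1:
  assumes "finite S" "acyclic_on R S"
  shows "chi R S \<le> 1"
proof -
  have "colouring R S (\<lambda>_. ())" using assms(2) by (simp add: colouring_def)
  from chi_le[OF assms(1) this] have "chi R S \<le> card ((\<lambda>_. ()) ` S)" .
  also have "\<dots> \<le> card {()}" by (rule card_mono) auto
  finally show ?thesis by simp
qed

lemma chi_Un:
  assumes "irrefl R" "finite A" "finite B"
  shows "chi R (A \<union> B) \<le> chi R A + chi R B"
proof -
  obtain c :: "'a \<Rightarrow> nat" where c: "colouring R A c" "card (c ` A) = chi R A"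
    using chi_attained assms by metis
  obtain d :: "'a \<Rightarrow> nat" where d: "colouring R B d" "card (d ` B) = chi R B"
    using chi_attained assms by metis
  define e where "e v = (if v \<in> A then Inl (c v) else Inr (d v))" for v
  have "colouring R (A \<union> B) e" unfolding colouring_def
  proof
    fix i
    show "acyclic_on R {v \<in> A \<union> B. e v = i}"
    proof (cases i)
      case (Inl j)
      then have "{v \<in> A \<union> B. e v = i} = {v \<in> A. c v = j}" by (auto simp: e_def)
      then show ?thesis using c by (simp add: colouring_def)
    next
      case (Inr j)
      then have "{v \<in> A \<union> B. e v = i} \<subseteq> {v \<in> B. d v = j}" by (auto simp: e_def split: if_splits)
      then show ?thesis using d acyclic_on_mono[of R "{v \<in> B. d v = j}"] by (auto simp: colouring_def)
    qed
  qed
  then have "chi R (A \<union> B) \<le> card (e ` (A \<union> B))" using chi_le assms by blast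
  also have "\<dots> \<le> card (Inl ` c ` A \<union> Inr ` d ` B)"
    by (rule card_mono) (use assms in \<open>auto simp: e_def\<close>)
  also have "\<dots> \<le> card (Inl ` c ` A :: (nat + nat) set) + card (Inr ` d ` B :: (nat + nat) set)"
    by (rule card_Un_le)
  also have "\<dots> = chi R A + chi R B" using c d by (simp add: card_image)
  finally show ?thesis .
qed

lemma chi_join:
  assumes "irrefl R" "finite A" "finite B" "A \<inter> B = {}"
    and "\<And>a b. a \<in> A \<Longrightarrow> b \<in> B \<Longrightarrow> (a, b) \<in> R \<and> (b, a) \<in> R"
  shows "chi R (A \<union> B) = chi R A + chi R B"
proof (rule antisym[OF chi_Un[OF assms(1-3)]])
  obtain c :: "'a \<Rightarrow> nat" where c: "colouring R (A \<union> B) c" "card (c ` (A \<union> B)) = chi R (A \<union> B)"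
    using chi_attained assms by (metis finite_UnI)
  have "c ` A \<inter> c ` B = {}"
  proof (rule ccontr)
    assume "c ` A \<inter> c ` B \<noteq> {}"
    then obtain a b where ab: "a \<in> A" "b \<in> B" "c a = c b" by blast
    then have "acyclic_on R {a, b}" using colouringD[OF c(1), of "{a, b}" "c a"] by auto
    then show False using digon_not_acyclic_on[of a "{a, b}" b R] assms(5)[OF ab(1,2)] by auto
  qed
  then have "chi R (A \<union> B) = card (c ` A) + card (c ` B)"
    using c assms by (simp add: image_Un card_Un_disjoint)
  moreover have "chi R A \<le> card (c ` A)" "chi R B \<le> card (c ` B)"
    using chi_le colouring_mono[OF c(1)] assms by (metis Un_upper1 Un_upper2 order_refl)+
  ultimately show "chi R A + chi R B \<le> chi R (A \<union> B)" by simp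
qed

lemma chi_clique:
  assumes "irrefl R" "finite A" "\<And>a b. a \<in> A \<Longrightarrow> b \<in> A \<Longrightarrow> a \<noteq> b \<Longrightarrow> (a, b) \<in> R"
  shows "chi R A = card A"
proof (rule antisym[OF chi_le_card[OF assms(1,2)]])
  obtain c :: "'a \<Rightarrow> nat" where c: "colouring R A c" "card (c ` A) = chi R A"
    using chi_attained assms by metis
  have "inj_on c A"
  proof (rule inj_onI, rule ccontr)
    fix a b assume ab: "a \<in> A" "b \<in> A" "c a = c b" "a \<noteq> b"
    then have "acyclic_on R {a, b}" using colouringD[OF c(1), of "{a, b}" "c a"] by auto
    then show False using digon_not_acyclic_on[of a "{a, b}" b R] assms(3) ab by auto
  qed
  then show "card A \<le> chi R A" using c by (simp add: card_image)
qed

lemma chi_converse: "chi (R\<inverse>) S = chi R S"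
  unfolding chi_def colouring_def by (simp only: acyclic_on_converse)

lemma vertex_critical_converse: "vertex_critical (R\<inverse>) k S \<longleftrightarrow> vertex_critical R k S"
  unfolding vertex_critical_def by (simp add: chi_converse)

lemma chi_remove:
  assumes "irrefl R" "finite S" "finite T" "acyclic_on R T"
  shows "chi R S \<le> chi R (S - T) + 1"
proof -
  have "chi R S \<le> chi R ((S - T) \<union> T)" using assms by (intro chi_mono) auto
  also have "\<dots> \<le> chi R (S - T) + chi R T" using assms by (intro chi_Un) auto
  finally show ?thesis using chi_le_1[OF assms(3,4)] by simp
qed

lemma vertex_critical_remove:
  assumes "irrefl R" "vertex_critical R k S" "v \<in> S"
  shows "chi R (S - {v}) = k - 1"
  using assms chi_remove[OF assms(1) _ _ acyclic_on_singleton[OF assms(1)], of S v]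
  unfolding vertex_critical_def by fastforce

lemma ex_vertex_critical_subset:
  assumes "irrefl R" "finite S" "j \<le> chi R S"
  obtains T where "T \<subseteq> S" "vertex_critical R j T"
proof -
  define P where "P T \<longleftrightarrow> T \<subseteq> S \<and> j \<le> chi R T" for T
  have "P S" using assms by (simp add: P_def)
  then obtain T where T: "P T" "\<And>U. P U \<Longrightarrow> card T \<le> card U"
    by (metis arg_min_nat_lemma)
  have fin: "finite T" using T assms finite_subset by (auto simp: P_def)
  have small: "chi R (T - {v}) < j" if "v \<in> T" for v
  proof (rule ccontr)
    assume "\<not> chi R (T - {v}) < j"
    then have "P (T - {v})" using T by (auto simp: P_def)
    from T(2)[OF this] show False using card_Diff1_less[OF fin that] by simp
  qed
  have "chi R T = j"
  proof (cases "T = {}")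
    case True then show ?thesis using T by (simp add: P_def)
  next
    case False
    then obtain v where "v \<in> T" by auto
    then show ?thesis using small[of v] T chi_remove[OF assms(1) fin _ acyclic_on_singleton[OF assms(1)], of v]
      by (auto simp: P_def)
  qed
  then show ?thesis using that[of T] T fin small by (auto simp: P_def vertex_critical_def)
qed

lemma vertex_critical_no_clique:
  assumes "irrefl R" "vertex_critical R k S" "A \<subset> S" "card A = k"
  shows "\<exists>a\<in>A. \<exists>b\<in>A. a \<noteq> b \<and> (a, b) \<notin> R"
proof (rule ccontr)
  assume "\<not> ?thesis"
  then have "chi R A = k" using chi_clique[OF assms(1), of A] assms
    by (metis finite_subset psubset_imp_subset vertex_critical_def)
  moreover obtain v where v: "v \<in> S" "v \<notin> A" using assms by auto
  then have "chi R A \<le> chi R (S - {v})" using assms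
    by (intro chi_mono) (auto simp: vertex_critical_def)
  ultimately show False using assms v by (auto simp: vertex_critical_def)
qed

lemma vertex_critical_out_degree:
  assumes "irrefl R" "vertex_critical R k S" "v \<in> S"
  shows "k - 1 \<le> card {u \<in> S. (v, u) \<in> R}"
proof -
  have fin: "finite S" and chi: "chi R S = k" using assms by (auto simp: vertex_critical_def)
  obtain c :: "'a \<Rightarrow> nat" where c: "colouring R (S - {v}) c" "card (c ` (S - {v})) = chi R (S - {v})"
    using chi_attained[of R "S - {v}"] assms fin by blast
  have ck: "card (c ` (S - {v})) = k - 1" using c vertex_critical_remove[OF assms] by simp
  have "c ` (S - {v}) \<subseteq> c ` {u \<in> S. (v, u) \<in> R}"
  proof (rule ccontr)
    assume "\<not> ?thesis"
    then obtain w where w: "w \<in> S - {v}" "c w \<notin> c ` {u \<in> S. (v, u) \<in> R}" by auto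
    define d where "d = c(v := c w)"
    have "colouring R S d" unfolding colouring_def
    proof
      fix i
      show "acyclic_on R {u \<in> S. d u = i}"
      proof (cases "i = c w")
        case True
        have eq: "{u \<in> S. d u = i} = insert v {u \<in> S - {v}. c u = c w}"
          using True assms(3) by (auto simp: d_def)
        show ?thesis unfolding eq
          using c(1) w assms(1) by (intro acyclic_on_insert_sink) (force simp: colouring_def irrefl_def image_iff)+
      next
        case False
        then have "{u \<in> S. d u = i} = {u \<in> S - {v}. c u = i}" by (auto simp: d_def)
        then show ?thesis using c(1) by (simp add: colouring_def)
      qed
    qed
    then have "k \<le> card (d ` S)" using chi_le fin chi by metis
    also have "d ` S \<subseteq> c ` (S - {v})" using w by (auto simp: d_def)
    then have "card (d ` S) \<le> chi R (S - {v})" using c(2) fin by (metis card_mono finite_Diff finite_imageI)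
    also have "\<dots> < k" using assms by (auto simp: vertex_critical_def)
    finally show False by simp
  qed
  then have "k - 1 \<le> card (c ` {u \<in> S. (v, u) \<in> R})"
    unfolding ck[symmetric] using fin by (intro card_mono) auto
  also have "\<dots> \<le> card {u \<in> S. (v, u) \<in> R}" using fin by (intro card_image_le) auto
  finally show ?thesis .
qed

subsection \<open>Decomposition of vertex-critical relations of small order\<close>

definition optimal_colouring :: "'a rel \<Rightarrow> 'a set \<Rightarrow> ('a \<Rightarrow> nat) \<Rightarrow> bool" where
  "optimal_colouring R S c \<longleftrightarrow> colouring R S c \<and> card (c ` S) = chi R S"

definition singles :: "'a set \<Rightarrow> ('a \<Rightarrow> nat) \<Rightarrow> 'a set" where
  "singles S c = {v \<in> S. \<forall>u\<in>S. c u = c v \<longrightarrow> u = v}"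

lemma finite_singles: "finite S \<Longrightarrow> finite (singles S c)"
  by (simp add: singles_def)

lemma single_merge_not_acyclic:
  assumes "finite S" "optimal_colouring R S c" "x \<in> singles S c" "y \<in> S" "y \<noteq> x"
  shows "\<not> acyclic_on R (insert x {v \<in> S. c v = c y})"
proof
  assume ac: "acyclic_on R (insert x {v \<in> S. c v = c y})"
  have x: "x \<in> S" "\<And>u. u \<in> S \<Longrightarrow> c u = c x \<Longrightarrow> u = x" using assms(3) by (auto simp: singles_def)
  define d where "d = c(x := c y)"
  have "colouring R S d" unfolding colouring_def
  proof
    fix i
    show "acyclic_on R {v \<in> S. d v = i}"
    proof (cases "i = c y")
      case True
      show ?thesis by (rule acyclic_on_mono[OF ac]) (auto simp: d_def True)
    next
      case False
      show ?thesis
        by (rule colouringD[of R S c _ i])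
          (use False assms(2) in \<open>auto simp: optimal_colouring_def d_def split: if_splits\<close>)
    qed
  qed
  then have "chi R S \<le> card (d ` S)" using chi_le assms(1) by blast
  also have "d ` S \<subseteq> c ` S - {c x}" using x assms(4,5) by (auto simp: d_def)
  then have "card (d ` S) \<le> card (c ` S - {c x})" using assms(1) by (intro card_mono) auto
  also have "\<dots> < card (c ` S)" using x assms(1) by (intro card_Diff1_less) auto
  finally show False using assms(2) by (simp add: optimal_colouring_def)
qed

lemma singles_digon:
  assumes "irrefl R" "finite S" "optimal_colouring R S c" "x \<in> singles S c" "y \<in> singles S c" "y \<noteq> x"
  shows "(x, y) \<in> R"
proof (rule ccontr)
  assume "(x, y) \<notin> R"
  moreover have "{v \<in> S. c v = c y} = {y}" using assms(5) by (auto simp: singles_def)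
  ultimately have "acyclic_on R (insert x {v \<in> S. c v = c y})"
    using acyclic_on_pair[OF assms(1), of x y] by simp
  then show False using single_merge_not_acyclic[OF assms(2-4), of y] assms(5,6)
    by (auto simp: singles_def)
qed

text \<open>A class of \<open>M\<close> meeting a singleton \<open>x\<close> of \<open>N\<close> absorbs, in \<open>N\<close>, its intersection with some
  other class of \<open>N\<close>; the agreement of \<open>N\<close> with \<open>M\<close> increases, so this ends.\<close>

lemma singles_exchange:
  assumes "irrefl R" "finite S" "optimal_colouring R S M" "optimal_colouring R S N" "a \<in> singles S N"
  obtains N' where "optimal_colouring R S N'" "a \<in> singles S N'"
    "card (singles S N') \<le> card (singles S N)" "singles S N' \<subseteq> insert a (singles S M)"
proof -
  define P where "P c \<longleftrightarrow> optimal_colouring R S c \<and> a \<in> singles S c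
    \<and> card (singles S c) \<le> card (singles S N)" for c
  define agree where "agree c = {(u, v) \<in> S \<times> S. c u = c v \<and> M u = M v}" for c :: "'a \<Rightarrow> nat"
  have fin: "finite (agree c)" for c
    by (rule finite_subset[of _ "S \<times> S"]) (auto simp: agree_def assms(2))
  have bound: "card (agree c) \<le> card (S \<times> S)" for c
    by (rule card_mono) (auto simp: agree_def assms(2))
  have "P N" using assms by (simp add: P_def)
  then obtain c where c: "P c" "\<And>d. P d \<Longrightarrow> card (agree d) \<le> card (agree c)"
    using ex_has_greatest_nat[of P N "\<lambda>c. card (agree c)" "Suc (card (S \<times> S))"] bound
    by (metis less_Suc_eq_le)
  have opt: "optimal_colouring R S c" and ac: "a \<in> singles S c"
    and cards: "card (singles S c) \<le> card (singles S N)" using c by (auto simp: P_def)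
  have "singles S c \<subseteq> insert a (singles S M)"
  proof (rule ccontr)
    assume "\<not> ?thesis"
    then obtain x where x: "x \<in> singles S c" "x \<noteq> a" "x \<notin> singles S M" by auto
    then have xS: "x \<in> S" and xc: "\<And>u. u \<in> S \<Longrightarrow> c u = c x \<Longrightarrow> u = x" by (auto simp: singles_def)
    obtain y where y: "y \<in> S" "M y = M x" "y \<noteq> x" using x xS by (auto simp: singles_def)
    have "\<not> {v \<in> S. c v = c y} \<subseteq> {v \<in> S. M v = M x}"
    proof
      assume "{v \<in> S. c v = c y} \<subseteq> {v \<in> S. M v = M x}"
      then have "insert x {v \<in> S. c v = c y} \<subseteq> {v \<in> S. M v = M x}" using xS by auto
      then have "acyclic_on R (insert x {v \<in> S. c v = c y})"
        by (intro colouringD[of R S M _ "M x"]) (use assms(3) in \<open>auto simp: optimal_colouring_def\<close>)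
      then show False using single_merge_not_acyclic[OF assms(2) opt x(1) y(1,3)] by simp
    qed
    then obtain z where z: "z \<in> S" "c z = c y" "M z \<noteq> M x" by auto
    define B where "B = {v \<in> S. c v = c y \<and> M v = M x}"
    define d where "d v = (if v \<in> B then c x else c v)" for v
    have aB: "a \<notin> B" using ac z y by (auto simp: B_def singles_def)
    have xB: "x \<notin> B" using xc y by (auto simp: B_def)
    have dS: "d ` S = c ` S"
    proof
      show "d ` S \<subseteq> c ` S" using xS by (auto simp: d_def)
      show "c ` S \<subseteq> d ` S"
      proof
        fix i assume "i \<in> c ` S"
        then obtain v where v: "v \<in> S" "i = c v" by auto
        show "i \<in> d ` S"
        proof (cases "v \<in> B")
          case True
          then have "i = d z" using z v by (auto simp: B_def d_def)
          then show ?thesis using z by auto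
        qed (use v in \<open>auto simp: d_def image_iff intro!: bexI[of _ v]\<close>)
      qed
    qed
    have "colouring R S d" unfolding colouring_def
    proof
      fix i
      show "acyclic_on R {v \<in> S. d v = i}"
      proof (cases "i = c x")
        case True
        then have "{v \<in> S. d v = i} \<subseteq> {v \<in> S. M v = M x}" using xc by (auto simp: d_def B_def)
        then show ?thesis
          by (intro colouringD[of R S M _ "M x"]) (use assms(3) in \<open>auto simp: optimal_colouring_def\<close>)
      next
        case False
        then have "{v \<in> S. d v = i} \<subseteq> {v \<in> S. c v = i}" by (auto simp: d_def split: if_splits)
        then show ?thesis
          by (intro colouringD[of R S c _ i]) (use opt in \<open>auto simp: optimal_colouring_def\<close>)
      qed
    qed
    then have optd: "optimal_colouring R S d" using opt dS by (simp add: optimal_colouring_def)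
    have ad: "a \<in> singles S d"
    proof -
      have "u = a" if "u \<in> S" "d u = d a" for u
        using that ac aB xS x(2) by (auto simp: d_def singles_def split: if_splits)
      then show ?thesis using ac by (auto simp: singles_def)
    qed
    have sub: "singles S d \<subseteq> insert z (singles S c - {x})"
    proof
      fix v assume v: "v \<in> singles S d"
      then have vS: "v \<in> S" and vd: "\<And>u. u \<in> S \<Longrightarrow> d u = d v \<Longrightarrow> u = v" by (auto simp: singles_def)
      have yB: "y \<in> B" using y by (auto simp: B_def)
      have vx: "v \<noteq> x" using vd[OF y(1)] y(3) xB yB by (auto simp: d_def)
      have vB: "v \<notin> B" using vd[OF xS] vx xB by (auto simp: d_def)
      show "v \<in> insert z (singles S c - {x})"
      proof (cases "v \<in> singles S c")
        case False
        then obtain u where u: "u \<in> S" "c u = c v" "u \<noteq> v" using vS by (auto simp: singles_def)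
        then have "u \<in> B" using vd[OF u(1)] vB by (cases "u \<in> B") (auto simp: d_def)
        then have "c v = c z" using u z by (auto simp: B_def)
        moreover have "z \<notin> B" using z by (auto simp: B_def)
        ultimately have "z = v" using vd[OF z(1)] vB by (auto simp: d_def)
        then show ?thesis by simp
      qed (use vx in auto)
    qed
    have "card (singles S d) \<le> card (insert z (singles S c - {x}))"
      using sub finite_singles[OF assms(2)] by (intro card_mono) auto
    also have "\<dots> \<le> Suc (card (singles S c - {x}))" by (rule card_insert_le_m1) auto
    also have "\<dots> = card (singles S c)" using x(1) finite_singles[OF assms(2), of c]
      by (metis card_Suc_Diff1)
    finally have "P d" using optd ad cards by (simp add: P_def)
    moreover have "agree c \<subset> agree d"
    proof
      show "agree c \<subseteq> agree d"
        by (auto simp: agree_def d_def B_def)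
      have "(x, y) \<in> agree d" using xS y xB by (auto simp: agree_def d_def B_def)
      moreover have "(x, y) \<notin> agree c" using xc y by (auto simp: agree_def)
      ultimately show "agree c \<noteq> agree d" by auto
    qed
    then have "card (agree c) < card (agree d)" by (intro psubset_card_mono fin)
    ultimately show False using c(2)[of d] by simp
  qed
  then show ?thesis using that opt ac cards by blast
qed

lemma card_eq_sum_fibres: "finite S \<Longrightarrow> card S = (\<Sum>i\<in>c ` S. card {v \<in> S. c v = i})"
  using sum.image_gen[of S "\<lambda>_. 1::nat" c] by simp

lemma card_singles_ge:
  assumes "finite S" "optimal_colouring R S c"
  shows "2 * chi R S \<le> card S + card (singles S c)"
proof -
  have "2 * chi R S = (\<Sum>i\<in>c ` S. 2)" using assms by (simp add: optimal_colouring_def)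
  also have "\<dots> \<le> (\<Sum>i\<in>c ` S. card {v \<in> S. c v = i} + card {v \<in> singles S c. c v = i})"
  proof (rule sum_mono)
    fix i assume "i \<in> c ` S"
    then obtain v where v: "v \<in> S" "c v = i" by auto
    show "2 \<le> card {v \<in> S. c v = i} + card {v \<in> singles S c. c v = i}"
    proof (cases "v \<in> singles S c")
      case True
      then have "v \<in> {v \<in> S. c v = i}" "v \<in> {v \<in> singles S c. c v = i}" using v by auto
      then have "0 < card {v \<in> S. c v = i}" "0 < card {v \<in> singles S c. c v = i}"
        using assms(1) finite_singles[OF assms(1), of c] by (auto simp: card_gt_0_iff)
      then show ?thesis by simp
    next
      case False
      then obtain u where "u \<in> S" "c u = i" "u \<noteq> v" using v by (auto simp: singles_def)
      then have "card {u, v} \<le> card {v \<in> S. c v = i}" using v assms(1) by (intro card_mono) auto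
      then show ?thesis using \<open>u \<noteq> v\<close> by simp
    qed
  qed
  also have "\<dots> = card S + (\<Sum>i\<in>c ` S. card {v \<in> singles S c. c v = i})"
    using card_eq_sum_fibres[OF assms(1), of c] by (simp add: sum.distrib)
  also have "(\<Sum>i\<in>c ` S. card {v \<in> singles S c. c v = i})
      = (\<Sum>i\<in>c ` singles S c. card {v \<in> singles S c. c v = i})"
    using assms(1) by (intro sum.mono_neutral_right) (auto simp: singles_def)
  also have "\<dots> = card (singles S c)"
    using card_eq_sum_fibres[OF finite_singles[OF assms(1)], of c c] by simp
  finally show ?thesis .
qed

lemma ex_optimal_colouring_single:
  assumes "irrefl R" "vertex_critical R k S" "a \<in> S"
  obtains c where "optimal_colouring R S c" "a \<in> singles S c"
proof -
  have fin: "finite S" and chi: "chi R S = k" and lt: "chi R (S - {a}) < k"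
    using assms by (auto simp: vertex_critical_def)
  obtain c :: "'a \<Rightarrow> nat" where c: "colouring R (S - {a}) c" "card (c ` (S - {a})) = chi R (S - {a})"
    using chi_attained[of R "S - {a}"] assms fin by blast
  obtain m where m: "m \<notin> c ` S" using fin ex_new_if_finite[of "c ` S"] by auto
  define d where "d = c(a := m)"
  have "colouring R S d" unfolding colouring_def
  proof
    fix i
    show "acyclic_on R {v \<in> S. d v = i}"
    proof (cases "i = m")
      case True
      then have "{v \<in> S. d v = i} = {a}" using m assms(3) by (auto simp: d_def)
      then show ?thesis using acyclic_on_singleton[OF assms(1)] by simp
    next
      case False
      then have "{v \<in> S. d v = i} = {v \<in> S - {a}. c v = i}" by (auto simp: d_def)
      then show ?thesis using c(1) by (simp add: colouring_def)
    qed
  qed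
  moreover have "card (d ` S) \<le> Suc (card (c ` (S - {a})))"
  proof -
    have "d ` S \<subseteq> insert m (c ` (S - {a}))" by (auto simp: d_def)
    then have "card (d ` S) \<le> card (insert m (c ` (S - {a})))" using fin by (intro card_mono) auto
    also have "\<dots> \<le> Suc (card (c ` (S - {a})))" by (rule card_insert_le_m1) auto
    finally show ?thesis .
  qed
  ultimately have "optimal_colouring R S d"
    using chi_le[OF fin, of R d] chi lt c(2) by (simp add: optimal_colouring_def)
  moreover have "a \<in> singles S d" using m assms(3) by (auto simp: singles_def d_def)
  ultimately show ?thesis using that by blast
qed

theorem vertex_critical_decomposes:
  assumes "irrefl R" "vertex_critical R k S" "card S + 2 \<le> 2 * k"
  obtains Z where "Z \<subset> S" "Z \<noteq> {}" "\<And>z w. z \<in> Z \<Longrightarrow> w \<in> S - Z \<Longrightarrow> (z, w) \<in> R \<and> (w, z) \<in> R"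
proof -
  have fin: "finite S" and chi: "chi R S = k" using assms by (auto simp: vertex_critical_def)
  have ne: "S \<noteq> {}" using assms(3) chi by auto
  define Opt where "Opt = optimal_colouring R S"
  obtain c\<^sub>0 where "Opt c\<^sub>0" using ne ex_optimal_colouring_single[OF assms(1,2)] unfolding Opt_def by (metis all_not_in_conv)
  then obtain M\<^sub>0 where M0: "Opt M\<^sub>0" "\<And>c. Opt c \<Longrightarrow> card (singles S M\<^sub>0) \<le> card (singles S c)"
    using ex_has_least_nat[of Opt c\<^sub>0 "\<lambda>c. card (singles S c)"] by blast
  define s where "s = card (singles S M\<^sub>0)"
  define MM where "MM = {c. Opt c \<and> card (singles S c) = s}"
  have min: "s \<le> card (singles S c)" if "Opt c" for c using M0 that by (simp add: s_def)
  have M0M: "M\<^sub>0 \<in> MM" using M0 by (simp add: MM_def s_def)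
  have MMD: "optimal_colouring R S c" if "c \<in> MM" for c using that by (simp add: MM_def Opt_def)
  have s2: "2 \<le> s" using card_singles_ge[OF fin, of R M\<^sub>0] M0 chi assms(3) by (simp add: s_def Opt_def)
  define D where "D = (\<Union>c\<in>MM. singles S c)"
  have DS: "D \<subseteq> S" by (auto simp: D_def singles_def)
  define H where "H u v \<longleftrightarrow> u \<noteq> v \<and> ((u, v) \<notin> R \<or> (v, u) \<notin> R)" for u v
  have Hsing: False if "H u v" "Opt c" "u \<in> singles S c" "v \<in> singles S c" for u v c
    using singles_digon[OF assms(1) fin, of c u v] singles_digon[OF assms(1) fin, of c v u] that
    by (auto simp: H_def Opt_def)
  have closed: "a \<in> D" if d: "d \<in> D" and a: "a \<in> S" and H: "H d a" for d a
  proof (rule ccontr)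
    assume aD: "a \<notin> D"
    obtain M where M: "M \<in> MM" "d \<in> singles S M" using d by (auto simp: D_def)
    obtain N where "optimal_colouring R S N" "a \<in> singles S N"
      using ex_optimal_colouring_single[OF assms(1,2) a] by blast
    from singles_exchange[OF assms(1) fin MMD[OF M(1)] this]
    obtain N' where N': "optimal_colouring R S N'" "a \<in> singles S N'"
      "singles S N' \<subseteq> insert a (singles S M)" by metis
    have "N' \<notin> MM" using aD N' by (auto simp: D_def)
    then have "s < card (singles S N')" using N' min[of N'] by (auto simp: MM_def Opt_def)
    moreover have aM: "a \<notin> singles S M" using aD M by (auto simp: D_def)
    have "card (insert a (singles S M)) = Suc s"
      using aM M finite_singles[OF fin, of M] by (simp add: MM_def)
    ultimately have "singles S N' = insert a (singles S M)"
      using N'(3) finite_singles[OF fin, of M] by (intro card_seteq) auto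
    then show False using Hsing[OF H, of N'] N' M by (auto simp: Opt_def)
  qed
  define T where "T u v \<longleftrightarrow> (\<exists>M\<in>MM. u \<in> singles S M \<and> v \<in> singles S M)" for u v
  have trans: "T t u \<or> T t v"
    if uv: "M \<in> MM" "u \<in> singles S M" "v \<in> singles S M" "u \<noteq> v" and t: "t \<in> D" for M t u v
  proof (cases "t \<in> singles S M")
    case True
    then show ?thesis using uv by (auto simp: T_def)
  next
    case False
    obtain N where N: "N \<in> MM" "t \<in> singles S N" using t by (auto simp: D_def)
    from singles_exchange[OF assms(1) fin MMD[OF uv(1)] MMD[OF N(1)] N(2)]
    obtain N' where N': "optimal_colouring R S N'" "t \<in> singles S N'"
      "card (singles S N') \<le> card (singles S N)" "singles S N' \<subseteq> insert t (singles S M)" by metis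
    have N'M: "N' \<in> MM" using N' N min[of N'] by (auto simp: MM_def Opt_def)
    show ?thesis
    proof (rule ccontr)
      assume "\<not> ?thesis"
      then have "u \<notin> singles S N'" "v \<notin> singles S N'" using N'M N' by (auto simp: T_def)
      then have "singles S N' \<subseteq> insert t (singles S M - {u, v})" using N'(4) by auto
      then have "card (singles S N') \<le> card (insert t (singles S M - {u, v}))"
        using finite_singles[OF fin] by (intro card_mono) auto
      also have "\<dots> \<le> Suc (card (singles S M - {u, v}))" by (rule card_insert_le_m1) auto
      also have "card (singles S M - {u, v}) = s - 2"
        using uv finite_singles[OF fin, of M] by (subst card_Diff_subset) (auto simp: MM_def)
      finally show False using N'M s2 by (simp add: MM_def)
    qed
  qed
  obtain u v where uv: "u \<in> singles S M\<^sub>0" "v \<in> singles S M\<^sub>0" "u \<noteq> v"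
    using s2 unfolding s_def by (metis One_nat_def Suc_1 card_le_Suc0_iff_eq fin finite_singles not_less_eq_eq)
  define Z where "Z = {z \<in> D. z = u \<or> \<not> T u z}"
  have Tuv: "T u v" using uv M0M by (auto simp: T_def)
  have uD: "u \<in> D" "v \<in> D" using uv M0M by (auto simp: D_def)
  have "w \<in> Z" if z: "z \<in> Z" and w: "w \<in> S" and H: "H z w" for z w
  proof (rule ccontr)
    assume wZ: "w \<notin> Z"
    have wD: "w \<in> D" using closed[OF _ w H] z by (auto simp: Z_def)
    then have "T u w" "w \<noteq> u" using wZ by (auto simp: Z_def)
    then obtain M where M: "M \<in> MM" "u \<in> singles S M" "w \<in> singles S M" by (auto simp: T_def)
    show False
    proof (cases "z = u")
      case True
      then show ?thesis using Hsing[OF H, of M] M by (auto simp: MM_def)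
    next
      case False
      then have nT: "\<not> T u z" and "z \<in> D" using z by (auto simp: Z_def)
      then have "T z w" using trans[OF M _ \<open>z \<in> D\<close>] \<open>w \<noteq> u\<close> nT by (auto simp: T_def)
      then show ?thesis using Hsing[OF H] by (auto simp: T_def MM_def)
    qed
  qed
  then have "(z, w) \<in> R \<and> (w, z) \<in> R" if "z \<in> Z" "w \<in> S - Z" for z w
    using that unfolding H_def by (metis Diff_iff)
  moreover have "u \<in> Z" "v \<notin> Z" "v \<in> S" using uD Tuv uv DS by (auto simp: Z_def)
  moreover have "Z \<subseteq> S" using DS by (auto simp: Z_def)
  ultimately show ?thesis using that[of Z] by blast
qed

subsection \<open>Hall's theorem\<close>

lemma hall:
  fixes A :: "'i \<Rightarrow> 'a set"
  assumes "finite I" "\<forall>i\<in>I. finite (A i)" "\<forall>J\<subseteq>I. card J \<le> card (\<Union>(A ` J))"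
  shows "\<exists>g. inj_on g I \<and> (\<forall>i\<in>I. g i \<in> A i)"
  using assms
proof (induction "card I" arbitrary: I A rule: less_induct)
  case less
  show ?case
  proof (cases "\<exists>J. J \<noteq> {} \<and> J \<subset> I \<and> card (\<Union>(A ` J)) \<le> card J")
    case True
    then obtain J where J: "J \<noteq> {}" "J \<subset> I" "card (\<Union>(A ` J)) \<le> card J" by blast
    have fJ: "finite J" using J less.prems finite_subset by blast
    define U where "U = \<Union>(A ` J)"
    have "\<exists>g. inj_on g J \<and> (\<forall>i\<in>J. g i \<in> A i)"
    proof (rule less.hyps)
      show "card J < card I" using J less.prems(1) by (intro psubset_card_mono) auto
      show "\<forall>i\<in>J. finite (A i)" using less.prems(2) J by blast
      show "\<forall>L\<subseteq>J. card L \<le> card (\<Union>(A ` L))" using less.prems(3) J by blast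
    qed (rule fJ)
    then obtain g where g: "inj_on g J" "\<forall>i\<in>J. g i \<in> A i" by blast
    have "\<exists>h. inj_on h (I - J) \<and> (\<forall>i\<in>I - J. h i \<in> A i - U)"
    proof (rule less.hyps)
      show "card (I - J) < card I"
        using J less.prems(1) by (intro psubset_card_mono) auto
      show "\<forall>L\<subseteq>I - J. card L \<le> card (\<Union>i\<in>L. A i - U)"
      proof (intro allI impI)
        fix L assume L: "L \<subseteq> I - J"
        have fL: "finite L" using L less.prems finite_subset by blast
        have eq: "\<Union>(A ` (L \<union> J)) = (\<Union>i\<in>L. A i - U) \<union> U" by (auto simp: U_def)
        have "L \<union> J \<subseteq> I" using L J by blast
        then have "card (L \<union> J) \<le> card (\<Union>(A ` (L \<union> J)))" using less.prems(3) by blast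
        also have "\<dots> \<le> card (\<Union>i\<in>L. A i - U) + card U" unfolding eq by (rule card_Un_le)
        finally have "card (L \<union> J) \<le> card (\<Union>i\<in>L. A i - U) + card U" .
        moreover have "card (L \<union> J) = card L + card J" using L fL fJ by (intro card_Un_disjoint) auto
        ultimately show "card L \<le> card (\<Union>i\<in>L. A i - U)" using J by (simp add: U_def)
      qed
      show "finite (I - J)" using less.prems(1) by blast
      show "\<forall>i\<in>I - J. finite (A i - U)" using less.prems(2) by blast
    qed
    then obtain h where h: "inj_on h (I - J)" "\<forall>i\<in>I - J. h i \<in> A i - U" by blast
    define k where "k i = (if i \<in> J then g i else h i)" for i
    have "inj_on k I"
    proof (rule inj_onI)
      fix x y assume xy: "x \<in> I" "y \<in> I" "k x = k y"
      have gU: "g i \<in> U" if "i \<in> J" for i using g that by (auto simp: U_def)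
      have hU: "h i \<notin> U" if "i \<in> I" "i \<notin> J" for i using h that by auto
      show "x = y" using xy inj_onD[OF g(1), of x y] inj_onD[OF h(1), of x y] gU[of x] gU[of y] hU[of x] hU[of y]
        by (cases "x \<in> J"; cases "y \<in> J") (auto simp: k_def)
    qed
    moreover have "\<forall>i\<in>I. k i \<in> A i" using g h by (auto simp: k_def)
    ultimately show ?thesis by blast
  next
    case False
    show ?thesis
    proof (cases "I = {}")
      case False
      then obtain i where i: "i \<in> I" by auto
      have "card {i} \<le> card (\<Union>(A ` {i}))" using less.prems(3) i by blast
      then have "A i \<noteq> {}" by auto
      then obtain a where a: "a \<in> A i" by blast
      have "\<exists>h. inj_on h (I - {i}) \<and> (\<forall>j\<in>I - {i}. h j \<in> A j - {a})"
      proof (rule less.hyps)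
        show "card (I - {i}) < card I" using i less.prems(1) by (intro card_Diff1_less)
        show "\<forall>L\<subseteq>I - {i}. card L \<le> card (\<Union>j\<in>L. A j - {a})"
        proof (intro allI impI)
          fix L assume L: "L \<subseteq> I - {i}"
          show "card L \<le> card (\<Union>j\<in>L. A j - {a})"
          proof (cases "L = {}")
            case False
            then have "card L < card (\<Union>(A ` L))"
              using L i \<open>\<nexists>J. J \<noteq> {} \<and> J \<subset> I \<and> card (\<Union>(A ` J)) \<le> card J\<close>
              by (metis Diff_iff insertI1 not_le psubsetI subset_Diff_insert subset_eq)
            moreover have "(\<Union>j\<in>L. A j - {a}) = \<Union>(A ` L) - {a}" by auto
            ultimately show ?thesis by (auto simp: card_Diff_singleton_if)
          qed simp
        qed
        show "finite (I - {i})" using less.prems(1) by blast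
        show "\<forall>j\<in>I - {i}. finite (A j - {a})" using less.prems(2) by blast
      qed
      then obtain h where h: "inj_on h (I - {i})" "\<forall>j\<in>I - {i}. h j \<in> A j - {a}" by blast
      have "inj_on (h(i := a)) I" using h unfolding inj_on_def by auto
      moreover have "\<forall>j\<in>I. (h(i := a)) j \<in> A j" using h a by auto
      ultimately show ?thesis by blast
    qed auto
  qed
qed

subsection \<open>Missing arcs\<close>

definition missing :: "'a rel \<Rightarrow> 'a set \<Rightarrow> 'a rel" where
  "missing R S = {(u, v). u \<in> S \<and> v \<in> S \<and> u \<noteq> v \<and> (u, v) \<notin> R}"

definition out_missing :: "'a rel \<Rightarrow> 'a set \<Rightarrow> 'a \<Rightarrow> nat" where
  "out_missing R S v = card {u \<in> S. u \<noteq> v \<and> (v, u) \<notin> R}"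

abbreviation in_missing :: "'a rel \<Rightarrow> 'a set \<Rightarrow> 'a \<Rightarrow> nat" where
  "in_missing R \<equiv> out_missing (R\<inverse>)"

lemma finite_missing: "finite S \<Longrightarrow> finite (missing R S)"
  by (rule finite_subset[of _ "S \<times> S"]) (auto simp: missing_def)

lemma card_missing_add:
  assumes "finite S" "Q \<subseteq> S"
  shows "card (missing R S) + card (missing R Q)
    = card (missing R (S - Q)) + (\<Sum>v\<in>Q. out_missing R S v) + (\<Sum>v\<in>Q. in_missing R S v)"
proof -
  have fQ: "finite Q" using assms finite_subset by blast
  have sig: "(\<Sum>v\<in>Q. out_missing R' S v) = card {(a, b) \<in> missing R' S. a \<in> Q}" for R'
  proof -
    have "{(a, b) \<in> missing R' S. a \<in> Q} = (SIGMA v:Q. {u \<in> S. u \<noteq> v \<and> (v, u) \<notin> R'})"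
      using assms by (auto simp: missing_def)
    then show ?thesis using fQ assms by (simp add: out_missing_def)
  qed
  define A where "A = {(a, b) \<in> missing R S. a \<in> Q}"
  define B where "B = {(a, b) \<in> missing R S. b \<in> Q}"
  have fin: "finite A" "finite B" using finite_missing[OF assms(1), of R]
    by (auto simp: A_def B_def intro: rev_finite_subset)
  have "{(a, b) \<in> missing (R\<inverse>) S. a \<in> Q} = B\<inverse>" by (auto simp: missing_def B_def)
  then have sB: "(\<Sum>v\<in>Q. in_missing R S v) = card B" by (simp add: sig)
  have "missing R S = missing R (S - Q) \<union> (A \<union> B)" "missing R (S - Q) \<inter> (A \<union> B) = {}"
    using assms by (auto simp: missing_def A_def B_def)
  then have "card (missing R S) = card (missing R (S - Q)) + card (A \<union> B)"
    using fin assms(1) by (simp add: card_Un_disjoint finite_missing)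
  moreover have "A \<inter> B = missing R Q" using assms by (auto simp: missing_def A_def B_def)
  then have "card (A \<union> B) + card (missing R Q) = card A + card B"
    using card_Un_Int[OF fin] by simp
  ultimately show ?thesis using sB sig[of R] by (simp add: A_def)
qed

lemma card_missing_eq_sum:
  assumes "finite S"
  shows "card (missing R S) = (\<Sum>v\<in>S. out_missing R S v)"
proof -
  have "missing R S = (SIGMA v:S. {u \<in> S. u \<noteq> v \<and> (v, u) \<notin> R})"
    by (auto simp: missing_def)
  then show ?thesis using assms by (simp add: out_missing_def)
qed

lemma vertex_critical_out_missing:
  assumes "irrefl R" "vertex_critical R k S" "card S = k + p" "v \<in> S"
  shows "out_missing R S v \<le> p"
proof -
  have fin: "finite S" and k: "0 < k" using assms(2,4) by (auto simp: vertex_critical_def)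
  have "S = insert v ({u \<in> S. (v, u) \<in> R} \<union> {u \<in> S. u \<noteq> v \<and> (v, u) \<notin> R})" using assms(4) by auto
  moreover have "v \<notin> {u \<in> S. (v, u) \<in> R} \<union> {u \<in> S. u \<noteq> v \<and> (v, u) \<notin> R}"
    using assms(1) by (auto simp: irrefl_def)
  ultimately have "card S = Suc (card ({u \<in> S. (v, u) \<in> R} \<union> {u \<in> S. u \<noteq> v \<and> (v, u) \<notin> R}))"
    using fin by (metis (no_types, lifting) card_insert_disjoint finite_insert)
  also have "\<dots> = Suc (card {u \<in> S. (v, u) \<in> R} + out_missing R S v)"
    unfolding out_missing_def using fin by (subst card_Un_disjoint) auto
  finally show ?thesis using vertex_critical_out_degree[OF assms(1,2,4)] assms(3) k by simp
qed

lemma vertex_critical_in_missing: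
  assumes "irrefl R" "vertex_critical R k S" "card S = k + p" "v \<in> S"
  shows "in_missing R S v \<le> p"
  using vertex_critical_out_missing[of "R\<inverse>" k S p v] assms
  by (simp add: vertex_critical_converse irrefl_def)

text \<open>The blow-up of the five-cycle \<open>v\<^sub>1, v\<^sub>2, Y\<^sub>1, X, Y\<^sub>2\<close>, as a symmetric relation: the complement
  of a graph in the class \<open>DG\<close>.\<close>

definition blowup :: "'a set \<Rightarrow> 'a set \<Rightarrow> 'a set \<Rightarrow> 'a \<Rightarrow> 'a \<Rightarrow> 'a rel" where
  "blowup X Y\<^sub>1 Y\<^sub>2 v\<^sub>1 v\<^sub>2 = (let B = X \<times> (Y\<^sub>1 \<union> Y\<^sub>2) \<union> {v\<^sub>1} \<times> Y\<^sub>2 \<union> {v\<^sub>2} \<times> Y\<^sub>1 \<union> {(v\<^sub>1, v\<^sub>2)} in B \<union> B\<inverse>)"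

definition blowup_sets :: "nat \<Rightarrow> 'a set \<Rightarrow> 'a set \<Rightarrow> 'a set \<Rightarrow> 'a \<Rightarrow> 'a \<Rightarrow> bool" where
  "blowup_sets p X Y\<^sub>1 Y\<^sub>2 v\<^sub>1 v\<^sub>2 \<longleftrightarrow> finite X \<and> finite Y\<^sub>1 \<and> finite Y\<^sub>2 \<and>
     X \<noteq> {} \<and> Y\<^sub>1 \<noteq> {} \<and> Y\<^sub>2 \<noteq> {} \<and> X \<inter> Y\<^sub>1 = {} \<and> X \<inter> Y\<^sub>2 = {} \<and> Y\<^sub>1 \<inter> Y\<^sub>2 = {} \<and>
     v\<^sub>1 \<notin> X \<union> Y\<^sub>1 \<union> Y\<^sub>2 \<and> v\<^sub>2 \<notin> X \<union> Y\<^sub>1 \<union> Y\<^sub>2 \<and> v\<^sub>1 \<noteq> v\<^sub>2 \<and>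
     card X + 1 = p \<and> card Y\<^sub>1 + card Y\<^sub>2 = p"

text \<open>Vertices outside the blow-up (or outside the triangle \<open>a \<rightarrow> b \<rightarrow> c \<rightarrow> a\<close>) are joined to everything by
  digons; they are the complete factor of the Dirac join.\<close>

definition extremal :: "nat \<Rightarrow> 'a rel \<Rightarrow> 'a set \<Rightarrow> bool" where
  "extremal p R S \<longleftrightarrow> (if p = 1
     then \<exists>a b c. {a, b, c} \<subseteq> S \<and> a \<noteq> b \<and> b \<noteq> c \<and> c \<noteq> a \<and> missing R S = {(b, a), (c, b), (a, c)}
     else \<exists>X Y\<^sub>1 Y\<^sub>2 v\<^sub>1 v\<^sub>2. blowup_sets p X Y\<^sub>1 Y\<^sub>2 v\<^sub>1 v\<^sub>2 \<and> X \<union> Y\<^sub>1 \<union> Y\<^sub>2 \<union> {v\<^sub>1, v\<^sub>2} \<subseteq> S \<and>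
            missing R S = blowup X Y\<^sub>1 Y\<^sub>2 v\<^sub>1 v\<^sub>2)"

lemma extremal_blowup:
  assumes "extremal p R S" "p \<noteq> 1"
  obtains X Y\<^sub>1 Y\<^sub>2 v\<^sub>1 v\<^sub>2 where "blowup_sets p X Y\<^sub>1 Y\<^sub>2 v\<^sub>1 v\<^sub>2"
    "X \<union> Y\<^sub>1 \<union> Y\<^sub>2 \<union> {v\<^sub>1, v\<^sub>2} \<subseteq> S" "missing R S = blowup X Y\<^sub>1 Y\<^sub>2 v\<^sub>1 v\<^sub>2"
  using assms unfolding extremal_def by auto

lemma extremal_blowupI:
  assumes "blowup_sets p X Y\<^sub>1 Y\<^sub>2 v\<^sub>1 v\<^sub>2" "p \<noteq> 1"
    "X \<union> Y\<^sub>1 \<union> Y\<^sub>2 \<union> {v\<^sub>1, v\<^sub>2} \<subseteq> S" "missing R S = blowup X Y\<^sub>1 Y\<^sub>2 v\<^sub>1 v\<^sub>2"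
  shows "extremal p R S"
  unfolding extremal_def if_not_P[OF assms(2)] using assms(1,3,4) by blast

definition missing_bound :: "nat \<Rightarrow> nat" where
  "missing_bound p = (if p = 0 then 0 else if p = 1 then 3 else 2 * p\<^sup>2 + 2)"

lemma card_blowup:
  assumes "blowup_sets p X Y\<^sub>1 Y\<^sub>2 v\<^sub>1 v\<^sub>2"
  shows "card (blowup X Y\<^sub>1 Y\<^sub>2 v\<^sub>1 v\<^sub>2) = 2 * p\<^sup>2 + 2"
proof -
  define B where "B = X \<times> (Y\<^sub>1 \<union> Y\<^sub>2) \<union> {v\<^sub>1} \<times> Y\<^sub>2 \<union> {v\<^sub>2} \<times> Y\<^sub>1 \<union> {(v\<^sub>1, v\<^sub>2)}"
  have fin: "finite X" "finite Y\<^sub>1" "finite Y\<^sub>2" and disj: "Y\<^sub>1 \<inter> Y\<^sub>2 = {}"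
    and p: "card X + 1 = p" "card Y\<^sub>1 + card Y\<^sub>2 = p"
    using assms by (auto simp: blowup_sets_def)
  have finB: "finite B" using fin by (simp add: B_def)
  have "B \<inter> B\<inverse> = {}" using assms unfolding B_def blowup_sets_def by blast
  then have 1: "card (blowup X Y\<^sub>1 Y\<^sub>2 v\<^sub>1 v\<^sub>2) = 2 * card B"
    using finB by (simp only: blowup_def Let_def B_def[symmetric] card_Un_disjoint finite_converse)
      (simp add: card_Un_disjoint)
  have "card B = card (X \<times> (Y\<^sub>1 \<union> Y\<^sub>2) \<union> {v\<^sub>1} \<times> Y\<^sub>2 \<union> {v\<^sub>2} \<times> Y\<^sub>1) + card {(v\<^sub>1, v\<^sub>2)}"
    unfolding B_def by (rule card_Un_disjoint) (use fin assms in \<open>auto simp: blowup_sets_def\<close>)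
  also have "card (X \<times> (Y\<^sub>1 \<union> Y\<^sub>2) \<union> {v\<^sub>1} \<times> Y\<^sub>2 \<union> {v\<^sub>2} \<times> Y\<^sub>1)
      = card (X \<times> (Y\<^sub>1 \<union> Y\<^sub>2) \<union> {v\<^sub>1} \<times> Y\<^sub>2) + card ({v\<^sub>2} \<times> Y\<^sub>1)"
    by (rule card_Un_disjoint) (use fin assms in \<open>auto simp: blowup_sets_def\<close>)
  also have "card (X \<times> (Y\<^sub>1 \<union> Y\<^sub>2) \<union> {v\<^sub>1} \<times> Y\<^sub>2) = card (X \<times> (Y\<^sub>1 \<union> Y\<^sub>2)) + card ({v\<^sub>1} \<times> Y\<^sub>2)"
    by (rule card_Un_disjoint) (use fin assms in \<open>auto simp: blowup_sets_def\<close>)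
  finally have "card B = card X * p + p + 1"
    using fin disj p(2) by (simp add: card_cartesian_product card_Un_disjoint)
  also have "\<dots> = p * p + 1" using p(1) by (metis add_mult_distrib mult_1)
  finally show ?thesis using 1 by (simp add: power2_eq_square)
qed

lemma extremal_card_missing:
  assumes "extremal p R S" "1 \<le> p"
  shows "card (missing R S) = missing_bound p"
proof (cases "p = 1")
  case True
  then obtain a b c where "a \<noteq> b" "b \<noteq> c" "c \<noteq> a" "missing R S = {(b, a), (c, b), (a, c)}"
    using assms(1) by (auto simp: extremal_def)
  then show ?thesis using True by (simp add: missing_bound_def)
next
  case False
  then obtain X Y\<^sub>1 Y\<^sub>2 v\<^sub>1 v\<^sub>2
    where "blowup_sets p X Y\<^sub>1 Y\<^sub>2 v\<^sub>1 v\<^sub>2" "missing R S = blowup X Y\<^sub>1 Y\<^sub>2 v\<^sub>1 v\<^sub>2"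
    using assms(1) by (auto simp: extremal_def)
  then show ?thesis using False assms(2) by (simp add: missing_bound_def card_blowup)
qed

lemma missing_bound_superadditive:
  assumes "1 \<le> p" "1 \<le> q"
  shows "missing_bound p + missing_bound q < missing_bound (p + q)"
proof -
  have le: "missing_bound p \<le> 2 * p\<^sup>2 + 2" for p by (auto simp: missing_bound_def)
  have 1: "missing_bound (p + q) = 2 * (p + q)\<^sup>2 + 2" using assms by (auto simp: missing_bound_def)
  have "1 \<le> p * q" using mult_le_mono[OF assms] by simp
  moreover have "(p + q)\<^sup>2 = p\<^sup>2 + q\<^sup>2 + 2 * (p * q)" by (simp add: power2_eq_square algebra_simps)
  ultimately show ?thesis using 1 le[of p] le[of q] by linarith
qed

subsection \<open>Digraphs with a large complete subdigraph\<close>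

lemma not_acyclic_on_insertD:
  assumes "irrefl R" "acyclic_on R A" "\<not> acyclic_on R (insert x A)"
  obtains u w where "u \<in> A" "(x, u) \<in> R" "w \<in> A" "(w, x) \<in> R"
proof -
  have "(x, x) \<notin> R" using assms(1) by (simp add: irrefl_def)
  then show ?thesis
    using acyclic_on_insert_sink[of R A x] acyclic_on_insert_source[of R A x] assms(2,3) that by blast
qed

lemma sum_ge_two_parts:
  fixes h :: "'a \<Rightarrow> nat"
  assumes "finite K" "L \<subseteq> K" "\<And>x. x \<in> L \<Longrightarrow> m \<le> h x" "\<And>x. x \<in> K \<Longrightarrow> 2 \<le> h x"
  shows "card L * m + 2 * card (K - L) \<le> sum h K"
proof -
  have "sum h K = sum h L + sum h (K - L)"
    using sum.subset_diff[OF assms(2,1), of h] by simp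
  moreover have "card L * m \<le> sum h L" using sum_bounded_below[of L m h] assms(3) by simp
  moreover have "card (K - L) * 2 \<le> sum h (K - L)"
    using sum_bounded_below[of "K - L" 2 h] assms(4) by simp
  ultimately show ?thesis by simp
qed

locale clique_split =
  fixes R :: "'a rel" and S K :: "'a set" and p :: nat
  assumes irr: "irrefl R"
    and crit: "vertex_critical R (p + 1) S"
    and card_S: "card S = 2 * p + 1"
    and p2: "2 \<le> p"
    and K_sub: "K \<subseteq> S"
    and card_K: "card K = p"
    and clique: "\<And>a b. a \<in> K \<Longrightarrow> b \<in> K \<Longrightarrow> a \<noteq> b \<Longrightarrow> (a, b) \<in> R"
    and many_missing: "2 * p\<^sup>2 + 2 \<le> card (missing R S)"
begin

definition "Q = S - K"
definition "out_deg x = card {z \<in> Q. (x, z) \<in> R}"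
definition "in_deg x = card {z \<in> Q. (z, x) \<in> R}"

lemma fin: "finite S" "finite K" "finite Q"
  using crit K_sub finite_subset by (auto simp: vertex_critical_def Q_def)

lemma card_Q: "card Q = p + 1"
  using card_S card_K K_sub fin by (simp add: Q_def card_Diff_subset)

lemma split: "S = K \<union> Q" "K \<inter> Q = {}"
  using K_sub by (auto simp: Q_def)

lemma out_missing_le: "v \<in> S \<Longrightarrow> out_missing R S v \<le> p"
  using vertex_critical_out_missing[OF irr crit, of p v] card_S by simp

lemma in_missing_le: "v \<in> S \<Longrightarrow> in_missing R S v \<le> p"
  using vertex_critical_in_missing[OF irr crit, of p v] card_S by simp

lemma out_deg_eq:
  assumes "x \<in> K"
  shows "out_missing R S x + out_deg x = p + 1"
proof -
  have 1: "{u \<in> S. u \<noteq> x \<and> (x, u) \<notin> R} = {u \<in> Q. (x, u) \<notin> R}"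
    using assms clique[OF assms] split by auto
  have "{u \<in> Q. (x, u) \<notin> R} \<union> {u \<in> Q. (x, u) \<in> R} = Q"
    "{u \<in> Q. (x, u) \<notin> R} \<inter> {u \<in> Q. (x, u) \<in> R} = {}" by auto
  then show ?thesis unfolding out_missing_def out_deg_def 1 card_Q[symmetric]
    using fin by (metis (no_types, lifting) card_Un_disjoint finite_Un)
qed

lemma in_deg_eq:
  assumes "x \<in> K"
  shows "in_missing R S x + in_deg x = p + 1"
proof -
  have 1: "{u \<in> S. u \<noteq> x \<and> (x, u) \<notin> R\<inverse>} = {u \<in> Q. (u, x) \<notin> R}"
    using assms clique[OF _ assms] split by auto
  have "{u \<in> Q. (u, x) \<notin> R} \<union> {u \<in> Q. (u, x) \<in> R} = Q"
    "{u \<in> Q. (u, x) \<notin> R} \<inter> {u \<in> Q. (u, x) \<in> R} = {}" by auto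
  then show ?thesis unfolding out_missing_def in_deg_def 1 card_Q[symmetric]
    using fin by (metis (no_types, lifting) card_Un_disjoint finite_Un)
qed

lemma deg_ge: "x \<in> K \<Longrightarrow> 1 \<le> out_deg x" "x \<in> K \<Longrightarrow> 1 \<le> in_deg x"
  using out_deg_eq[of x] in_deg_eq[of x] out_missing_le[of x] in_missing_le[of x] K_sub by auto

lemma missing_K: "missing R K = {}"
  using clique by (auto simp: missing_def)

lemma sum_deg: "(\<Sum>x\<in>K. out_deg x + in_deg x) + card (missing R S) = 2 * p * (p + 1) + card (missing R Q)"
proof -
  have "card (missing R S) = card (missing R Q) + (\<Sum>v\<in>K. out_missing R S v) + (\<Sum>v\<in>K. in_missing R S v)"
    using card_missing_add[OF fin(1) K_sub, of R] missing_K by (simp add: Q_def)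
  moreover have "(\<Sum>v\<in>K. out_missing R S v) + (\<Sum>v\<in>K. out_deg v) = (\<Sum>v\<in>K. p + 1)"
    unfolding sum.distrib[symmetric] by (rule sum.cong) (use out_deg_eq in auto)
  moreover have "(\<Sum>v\<in>K. in_missing R S v) + (\<Sum>v\<in>K. in_deg v) = (\<Sum>v\<in>K. p + 1)"
    unfolding sum.distrib[symmetric] by (rule sum.cong) (use in_deg_eq in auto)
  ultimately show ?thesis using card_K by (simp add: sum.distrib)
qed

lemma missing_Q_le: "card (missing R Q) + 2 \<le> 2 * p"
proof -
  have eq: "S - Q = K" "Q \<subseteq> S" using K_sub by (auto simp: Q_def)
  have "(\<Sum>v\<in>Q. out_missing R S v) \<le> card Q * p" "(\<Sum>v\<in>Q. in_missing R S v) \<le> card Q * p"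
    using sum_bounded_above[of Q "out_missing R S" p] sum_bounded_above[of Q "in_missing R S" p]
      out_missing_le in_missing_le eq by auto
  then have "card (missing R S) + card (missing R Q) \<le> 2 * (p + 1) * p"
    using card_missing_add[OF fin(1) eq(2), of R] missing_K by (simp add: eq card_Q)
  then show ?thesis using many_missing by (simp add: power2_eq_square algebra_simps)
qed

lemma sum_deg_le: "(\<Sum>x\<in>K. out_deg x + in_deg x) + 2 \<le> 2 * p + card (missing R Q)"
  using sum_deg many_missing by (simp add: power2_eq_square algebra_simps)

lemma deg_ge_2: "x \<in> K \<Longrightarrow> 2 \<le> out_deg x + in_deg x"
  using deg_ge[of x] by simp

lemma no_bigger_clique:
  assumes "z \<in> Q" "\<And>x. x \<in> K \<Longrightarrow> (x, z) \<in> R \<and> (z, x) \<in> R"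
  shows False
proof -
  have "card (insert z K) = p + 1" using assms(1) fin card_K by (simp add: Q_def)
  moreover have "insert z K \<subset> S"
  proof -
    have "insert z K \<subseteq> S" using assms(1) K_sub by (auto simp: Q_def)
    moreover have "insert z K \<noteq> S" using \<open>card (insert z K) = p + 1\<close> card_S p2 by auto
    ultimately show ?thesis by blast
  qed
  ultimately show False
    using vertex_critical_no_clique[OF irr crit, of "insert z K"] clique assms(2) by blast
qed

text \<open>Otherwise Hall's theorem matches the classes \<open>{b, c}\<close> and \<open>{z}\<close>, \<open>z \<in> Q - {b, c}\<close>, with the
  colours of \<open>K\<close>: a violating set of \<open>j\<close> classes would need too many arcs between \<open>K\<close> and \<open>Q\<close>.\<close>

lemma incompatible:
  assumes bc: "b \<in> Q" "c \<in> Q" "b \<noteq> c" "(b, c) \<notin> R" and x0: "x\<^sub>0 \<in> K"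
  shows "\<not> acyclic_on R {x\<^sub>0, b, c}"
proof
  assume ac: "acyclic_on R {x\<^sub>0, b, c}"
  define cls where "cls z = (if z = b then {b, c} else {z})" for z
  define A where "A z = {x \<in> K. acyclic_on R (insert x (cls z))}" for z
  define P where "P = Q - {c}"
  have cardP: "card P = p" using bc card_Q fin by (simp add: P_def)
  have cls_ac: "acyclic_on R (cls z)" for z
    using acyclic_on_pair[OF irr, of b c] acyclic_on_singleton[OF irr, of z] bc by (simp add: cls_def)
  have cls_Q: "cls z \<subseteq> Q" if "z \<in> P" for z using that bc by (auto simp: cls_def P_def)
  have cls_disj: "z = z'" if "z \<in> P" "z' \<in> P" "w \<in> cls z" "w \<in> cls z'" for z z' w
    using that by (auto simp: cls_def P_def split: if_splits)
  have hall_cond: "card J \<le> card (\<Union>(A ` J))" if J: "J \<subseteq> P" for J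
  proof (rule ccontr)
    assume less: "\<not> ?thesis"
    define L where "L = K - \<Union>(A ` J)"
    have sub: "\<Union>(A ` J) \<subseteq> K" by (auto simp: A_def)
    have fJ: "finite J" using J fin(3) finite_subset by (auto simp: P_def)
    have "card L = p - card (\<Union>(A ` J))"
      unfolding L_def using sub fin(2) card_K by (metis card_Diff_subset finite_subset)
    moreover have "card (\<Union>(A ` J)) \<le> p" using card_mono[OF fin(2) sub] card_K by simp
    ultimately have cardL: "p + 1 \<le> card L + card J" using less by simp
    have Jp: "card J \<le> p" using card_mono[of P J] J cardP fin by (simp add: P_def)
    have bad: "\<not> acyclic_on R (insert x (cls z))" if "x \<in> L" "z \<in> J" for x z
      using that by (auto simp: L_def A_def)
    have deg: "card J \<le> out_deg x" "card J \<le> in_deg x" if x: "x \<in> L" for x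
    proof -
      have "\<exists>u w. u \<in> cls z \<and> (x, u) \<in> R \<and> w \<in> cls z \<and> (w, x) \<in> R" if "z \<in> J" for z
        using not_acyclic_on_insertD[OF irr cls_ac bad[OF x that]] by metis
      then obtain g h where gh: "\<And>z. z \<in> J \<Longrightarrow> g z \<in> cls z \<and> (x, g z) \<in> R \<and> h z \<in> cls z \<and> (h z, x) \<in> R"
        by metis
      have "inj_on g J"
      proof (rule inj_onI)
        fix z z' assume "z \<in> J" "z' \<in> J" "g z = g z'"
        then show "z = z'" using cls_disj[of z z' "g z"] gh[of z] gh[of z'] J by auto
      qed
      moreover have "inj_on h J"
      proof (rule inj_onI)
        fix z z' assume "z \<in> J" "z' \<in> J" "h z = h z'"
        then show "z = z'" using cls_disj[of z z' "h z"] gh[of z] gh[of z'] J by auto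
      qed
      moreover have "g ` J \<subseteq> {z \<in> Q. (x, z) \<in> R}" "h ` J \<subseteq> {z \<in> Q. (z, x) \<in> R}"
        using gh J cls_Q by blast+
      ultimately show "card J \<le> out_deg x" "card J \<le> in_deg x"
        unfolding out_deg_def in_deg_def using fin(3) by (auto intro: card_inj_on_le)
    qed
    show False
    proof (cases "card J \<le> 1")
      case True
      then have "card J = 1" "L = K"
      proof -
        have "card L \<le> p" using card_mono[OF fin(2), of L] card_K by (auto simp: L_def)
        then show "card J = 1" using cardL True by simp
        then have "card K \<le> card L" using cardL card_K by simp
        then show "L = K" using card_seteq[OF fin(2), of L] by (auto simp: L_def)
      qed
      then obtain z where z: "J = {z}" by (auto simp: card_1_singleton_iff)
      show False
      proof (cases "z = b")
        case True
        then show False using bad[of x\<^sub>0 z] z \<open>L = K\<close> x0 ac by (simp add: cls_def)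
      next
        case False
        have "(x, z) \<in> R \<and> (z, x) \<in> R" if "x \<in> K" for x
          using not_acyclic_on_insertD[OF irr cls_ac bad[of x z]] that z \<open>L = K\<close> False
          by (metis cls_def singletonD singletonI)
        then show False using no_bigger_clique[of z] z J by (auto simp: P_def)
      qed
    next
      case False
      have "card L * (2 * card J) + 2 * card (K - L) \<le> (\<Sum>x\<in>K. out_deg x + in_deg x)"
      proof (rule sum_ge_two_parts[OF fin(2)])
        show "L \<subseteq> K" by (auto simp: L_def)
        show "2 * card J \<le> out_deg x + in_deg x" if "x \<in> L" for x using deg[OF that] by simp
      qed (rule deg_ge_2)
      moreover have "card (K - L) = p - card L" "card L \<le> p"
        using fin card_K card_mono[OF fin(2), of L] by (auto simp: L_def card_Diff_subset)
      moreover define s t where "s = card J - 1" and "t = p + 1 - card J"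
      have st: "card J = s + 1" "s + t = p" "1 \<le> s" "1 \<le> t" "t \<le> card L"
        using False Jp cardL by (auto simp: s_def t_def)
      ultimately have "card L * (2 * (s + 1)) + 2 * (p - card L) + 4 \<le> 4 * p"
        using sum_deg_le missing_Q_le by simp
      then have "2 * (card L * s) + 4 \<le> 2 * p" using \<open>card L \<le> p\<close> by (simp add: algebra_simps)
      moreover have "t * s \<le> card L * s" using st by simp
      moreover have "s + t \<le> t * s + 1"
      proof -
        obtain s' t' where "s = Suc s'" "t = Suc t'" using st by (metis Suc_le_D One_nat_def)
        then show ?thesis by simp
      qed
      ultimately show False using st by simp
    qed
  qed
  have "\<exists>g. inj_on g P \<and> (\<forall>z\<in>P. g z \<in> A z)"
    by (rule hall) (use hall_cond fin in \<open>auto simp: P_def A_def\<close>)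
  then obtain g where g: "inj_on g P" "\<And>z. z \<in> P \<Longrightarrow> g z \<in> A z" by blast
  have gK: "g z \<in> K" if "z \<in> P" for z using g(2)[OF that] by (simp add: A_def)
  have bP: "b \<in> P" using bc by (simp add: P_def)
  define f where "f v = (if v \<in> K then v else if v = c then g b else g v)" for v
  have "colouring R S f" unfolding colouring_def
  proof
    fix i
    show "acyclic_on R {v \<in> S. f v = i}"
    proof (cases "\<exists>z\<in>P. g z = i")
      case True
      then obtain z where z: "z \<in> P" "g z = i" by auto
      have "v \<in> insert i (cls z)" if "v \<in> S" "f v = i" for v
      proof (cases "v \<in> K")
        case False
        show ?thesis
        proof (cases "v = c")
          case True
          then have "g b = g z" using False that z by (simp add: f_def)
          then have "z = b" using inj_onD[OF g(1)] bP z(1) by metis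
          then show ?thesis using True by (simp add: cls_def)
        next
          case False
          then have "v \<in> P" "g v = g z" using \<open>v \<notin> K\<close> that z by (auto simp: f_def P_def Q_def)
          then have "v = z" using inj_onD[OF g(1)] z(1) by metis
          then show ?thesis by (simp add: cls_def)
        qed
      qed (use that in \<open>simp add: f_def\<close>)
      then have sub: "{v \<in> S. f v = i} \<subseteq> insert i (cls z)" by blast
      have "acyclic_on R (insert i (cls z))" using g(2)[OF z(1)] z(2) unfolding A_def by blast
      then show ?thesis by (rule acyclic_on_mono[OF _ sub order_refl])
    next
      case False
      then have sub: "{v \<in> S. f v = i} \<subseteq> {i}"
        using bP by (auto simp: f_def P_def Q_def split: if_splits)
      show ?thesis by (rule acyclic_on_mono[OF acyclic_on_singleton[OF irr] sub order_refl])
    qed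
  qed
  then have "chi R S \<le> card (f ` S)" using chi_le fin by blast
  also have "\<dots> \<le> card K"
  proof (rule card_mono[OF fin(2)])
    show "f ` S \<subseteq> K" using gK bP by (auto simp: f_def P_def Q_def)
  qed
  finally show False using crit card_K by (simp add: vertex_critical_def)
qed

lemma star: "\<exists>b\<in>Q. \<forall>c\<in>Q. \<forall>d\<in>Q. c \<noteq> d \<longrightarrow> (c, d) \<notin> R \<longrightarrow> b = c \<or> b = d"
proof -
  have "\<exists>x\<in>K. out_deg x + in_deg x \<le> 3"
  proof (rule ccontr)
    assume "\<not> ?thesis"
    then have "card K * 4 \<le> (\<Sum>x\<in>K. out_deg x + in_deg x)"
      using sum_bounded_below[of K 4 "\<lambda>x. out_deg x + in_deg x"] by fastforce
    then show False using sum_deg_le missing_Q_le card_K by simp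
  qed
  then obtain x where x: "x \<in> K" "out_deg x + in_deg x \<le> 3" by blast
  have cover: "(\<exists>u\<in>{c, d}. (x, u) \<in> R) \<and> (\<exists>u\<in>{c, d}. (u, x) \<in> R)"
    if "c \<in> Q" "d \<in> Q" "c \<noteq> d" "(c, d) \<notin> R" for c d
    using not_acyclic_on_insertD[OF irr acyclic_on_pair[OF irr] incompatible[OF that x(1)]] that(4) by metis
  from x deg_ge[OF x(1)] have "out_deg x = 1 \<or> in_deg x = 1" by linarith
  then show ?thesis
  proof
    assume "out_deg x = 1"
    then obtain b where b: "{z \<in> Q. (x, z) \<in> R} = {b}" by (auto simp: out_deg_def card_1_singleton_iff)
    have "b = c \<or> b = d" if cd: "c \<in> Q" "d \<in> Q" "c \<noteq> d" "(c, d) \<notin> R" for c d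
    proof -
      obtain u where "u \<in> {c, d}" "u \<in> {z \<in> Q. (x, z) \<in> R}" using cover[OF cd] cd(1,2) by blast
      then show ?thesis unfolding b by auto
    qed
    moreover have "b \<in> Q" using b by blast
    ultimately show ?thesis by blast
  next
    assume "in_deg x = 1"
    then obtain b where b: "{z \<in> Q. (z, x) \<in> R} = {b}" by (auto simp: in_deg_def card_1_singleton_iff)
    have "b = c \<or> b = d" if cd: "c \<in> Q" "d \<in> Q" "c \<noteq> d" "(c, d) \<notin> R" for c d
    proof -
      obtain u where "u \<in> {c, d}" "u \<in> {z \<in> Q. (z, x) \<in> R}" using cover[OF cd] cd(1,2) by blast
      then show ?thesis unfolding b by auto
    qed
    moreover have "b \<in> Q" using b by blast
    ultimately show ?thesis by blast
  qed
qed

lemma clique_extremal_aux: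
  assumes "blowup_sets p X Y\<^sub>1 Y\<^sub>2 v\<^sub>1 v\<^sub>2" "X \<union> Y\<^sub>1 \<union> Y\<^sub>2 \<union> {v\<^sub>1, v\<^sub>2} \<subseteq> S"
    "missing R S \<subseteq> blowup X Y\<^sub>1 Y\<^sub>2 v\<^sub>1 v\<^sub>2"
  shows "extremal p R S"
proof -
  have "finite (blowup X Y\<^sub>1 Y\<^sub>2 v\<^sub>1 v\<^sub>2)"
    by (rule card_ge_0_finite) (simp add: card_blowup[OF assms(1)])
  then have "missing R S = blowup X Y\<^sub>1 Y\<^sub>2 v\<^sub>1 v\<^sub>2"
    using assms(3) many_missing card_blowup[OF assms(1)] by (intro card_seteq) auto
  then show ?thesis using extremal_blowupI[OF assms(1) _ assms(2)] p2 by simp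
qed

theorem clique_extremal: "extremal p R S"
proof -
  obtain b where b: "b \<in> Q"
    and star: "\<And>c d. c \<in> Q \<Longrightarrow> d \<in> Q \<Longrightarrow> c \<noteq> d \<Longrightarrow> (c, d) \<notin> R \<Longrightarrow> b = c \<or> b = d"
    using star by blast
  define C\<^sub>o where "C\<^sub>o = {c \<in> Q. c \<noteq> b \<and> (b, c) \<notin> R}"
  define C\<^sub>i where "C\<^sub>i = {c \<in> Q. c \<noteq> b \<and> (c, b) \<notin> R}"
  define C where "C = C\<^sub>o \<union> C\<^sub>i"
  have CQ: "C \<subseteq> Q - {b}" by (auto simp: C_def C\<^sub>o_def C\<^sub>i_def)
  have finC: "finite C\<^sub>o" "finite C\<^sub>i" "finite C" using fin by (auto simp: C\<^sub>o_def C\<^sub>i_def C_def)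
  have "missing R Q = {b} \<times> C\<^sub>o \<union> C\<^sub>i \<times> {b}"
    using b star by (auto simp: missing_def C\<^sub>o_def C\<^sub>i_def)
  moreover have "card ({b} \<times> C\<^sub>o \<union> C\<^sub>i \<times> {b}) = card C\<^sub>o + card C\<^sub>i"
    using finC by (subst card_Un_disjoint) (auto simp: card_cartesian_product C\<^sub>o_def C\<^sub>i_def)
  ultimately have I: "card (missing R Q) = card C\<^sub>o + card C\<^sub>i" by simp
  have le_C: "card C\<^sub>o \<le> card C" "card C\<^sub>i \<le> card C" using finC by (auto simp: C_def intro: card_mono)
  have bad: "\<not> acyclic_on R {x, b, c}" if "x \<in> K" "c \<in> C" for x c
    using incompatible[of b c x] incompatible[of c b x] that b
    by (auto simp: C_def C\<^sub>o_def C\<^sub>i_def insert_commute)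
  have bad': "((x, b) \<in> R \<or> (x, c) \<in> R) \<and> ((b, x) \<in> R \<or> (c, x) \<in> R)"
    if x: "x \<in> K" and c: "c \<in> C" for x c
  proof -
    have "acyclic_on R {b, c}" using c by (intro acyclic_on_pair[OF irr]) (auto simp: C_def C\<^sub>o_def C\<^sub>i_def)
    from not_acyclic_on_insertD[OF irr this bad[OF x c]] show ?thesis by (metis insertE singletonD)
  qed
  have bad'': "((x, c) \<in> R \<or> (b, c) \<in> R) \<and> ((c, x) \<in> R \<or> (c, b) \<in> R)"
    if x: "x \<in> K" and c: "c \<in> C" and nd: "(x, b) \<notin> R \<or> (b, x) \<notin> R" for x c
  proof -
    have "\<not> acyclic_on R (insert c {x, b})" using bad[OF x c] by (simp add: insert_commute)
    from not_acyclic_on_insertD[OF irr acyclic_on_pair[OF irr nd] this]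
    show ?thesis by (metis insertE singletonD)
  qed
  have sym: "(x, b) \<in> R \<longleftrightarrow> (b, x) \<in> R" if x: "x \<in> K" for x
  proof (rule ccontr)
    assume neq: "\<not> ?thesis"
    have "1 + card (missing R Q) \<le> out_deg x + in_deg x"
    proof (cases "(x, b) \<in> R")
      case True
      then have "(b, x) \<notin> R" using neq by simp
      then have "insert b C\<^sub>o \<subseteq> {z \<in> Q. (x, z) \<in> R}" "C \<subseteq> {z \<in> Q. (z, x) \<in> R}"
        using True b bad'[OF x] bad''[OF x] CQ by (auto simp: C_def C\<^sub>o_def)
      then have "card (insert b C\<^sub>o) \<le> out_deg x" "card C \<le> in_deg x"
        using fin by (auto simp: out_deg_def in_deg_def intro!: card_mono)
      moreover have "card (insert b C\<^sub>o) = card C\<^sub>o + 1" using finC by (simp add: C\<^sub>o_def)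
      ultimately show ?thesis using I le_C by simp
    next
      case False
      then have "(b, x) \<in> R" using neq by simp
      then have "insert b C\<^sub>i \<subseteq> {z \<in> Q. (z, x) \<in> R}" "C \<subseteq> {z \<in> Q. (x, z) \<in> R}"
        using False b bad'[OF x] bad''[OF x] CQ by (auto simp: C_def C\<^sub>i_def)
      then have "card (insert b C\<^sub>i) \<le> in_deg x" "card C \<le> out_deg x"
        using fin by (auto simp: out_deg_def in_deg_def intro!: card_mono)
      moreover have "card (insert b C\<^sub>i) = card C\<^sub>i + 1" using finC by (simp add: C\<^sub>i_def)
      ultimately show ?thesis using I le_C by simp
    qed
    then have "card {x} * (1 + card (missing R Q)) + 2 * card (K - {x}) \<le> (\<Sum>x\<in>K. out_deg x + in_deg x)"
      by (intro sum_ge_two_parts[OF fin(2)]) (use x deg_ge_2 in auto)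
    then show False using sum_deg_le x fin card_K p2 by (simp add: card_Diff_singleton)
  qed
  define K\<^sub>0 where "K\<^sub>0 = {x \<in> K. (x, b) \<notin> R}"
  have K0: "(x, c) \<in> R" "(c, x) \<in> R" if "x \<in> K\<^sub>0" "c \<in> C" for x c
    using that bad'[of x c] sym[of x] by (auto simp: K\<^sub>0_def)
  have K1: "(x, b) \<in> R" "(b, x) \<in> R" if "x \<in> K - K\<^sub>0" for x
    using that sym[of x] by (auto simp: K\<^sub>0_def)
  have K0_ne: "K\<^sub>0 \<noteq> {}" using no_bigger_clique[OF b] K1 by blast
  have K0_sub: "K\<^sub>0 \<subseteq> K" and finK0: "finite K\<^sub>0" using fin by (auto simp: K\<^sub>0_def)
  have cK0: "1 \<le> card K\<^sub>0" using K0_ne finK0 by (simp add: Suc_le_eq card_gt_0_iff)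
  have cK: "card (K - K\<^sub>0) + card K\<^sub>0 = p"
    using card_Diff_subset[OF finK0 K0_sub] card_mono[OF fin(2) K0_sub] card_K by simp
  have "card K\<^sub>0 * (2 * card C) + 2 * card (K - K\<^sub>0) \<le> (\<Sum>x\<in>K. out_deg x + in_deg x)"
  proof (rule sum_ge_two_parts[OF fin(2) K0_sub])
    fix x assume x: "x \<in> K\<^sub>0"
    have "C \<subseteq> {z \<in> Q. (z, x) \<in> R}" "C \<subseteq> {z \<in> Q. (x, z) \<in> R}" using K0[OF x] CQ by auto
    then have "card C \<le> in_deg x" "card C \<le> out_deg x"
      using fin by (auto simp: out_deg_def in_deg_def intro!: card_mono)
    then show "2 * card C \<le> out_deg x + in_deg x" by simp
  qed (rule deg_ge_2)
  then have count: "card K\<^sub>0 * (2 * card C) + 2 * card (K - K\<^sub>0) + 2 \<le> 2 * p + card (missing R Q)"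
    using sum_deg_le by linarith
  have C_ne: "1 \<le> card C"
  proof (rule ccontr)
    assume "\<not> ?thesis"
    then have "card (missing R Q) = 0" using I le_C by simp
    moreover have "card K * 2 \<le> (\<Sum>x\<in>K. out_deg x + in_deg x)"
      using sum_bounded_below[of K 2 "\<lambda>x. out_deg x + in_deg x"] deg_ge_2 by simp
    ultimately show False using sum_deg_le card_K by simp
  qed
  have miss: "(u \<in> Q \<and> v \<in> Q \<and> (u = b \<and> v \<in> C \<or> v = b \<and> u \<in> C)) \<or>
      (u \<in> K \<and> v \<in> Q) \<or> (v \<in> K \<and> u \<in> Q)" if uv: "(u, v) \<in> missing R S" for u v
    using uv clique[of u v] star[of u v] split by (auto simp: missing_def C_def C\<^sub>o_def C\<^sub>i_def)
  have arc: "(u, v) \<notin> R" if "(u, v) \<in> missing R S" for u v using that by (auto simp: missing_def)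
  show ?thesis
  proof (cases "card C = 1")
    case True
    then obtain c where c: "C = {c}" by (auto simp: card_1_singleton_iff)
    have cQ: "c \<in> Q" "c \<noteq> b" using c CQ by auto
    define X where "X = Q - {b, c}"
    have cX: "card X + 1 = p" using b cQ fin card_Q p2 by (simp add: X_def card_Diff_subset)
    have X_ne: "X \<noteq> {}" using cX p2 by auto
    have K1_ne: "K - K\<^sub>0 \<noteq> {}" using no_bigger_clique[OF cQ(1)] K0 c by blast
    have "blowup_sets p X (K - K\<^sub>0) K\<^sub>0 b c"
      unfolding blowup_sets_def using b cQ fin finK0 K0_ne K1_ne cX cK X_ne K0_sub
      by (intro conjI) (auto simp: X_def Q_def)
    moreover have "X \<union> (K - K\<^sub>0) \<union> K\<^sub>0 \<union> {b, c} \<subseteq> S" using b cQ split K0_sub by (auto simp: X_def)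
    moreover have "missing R S \<subseteq> blowup X (K - K\<^sub>0) K\<^sub>0 b c"
    proof (rule subrelI)
      fix u v assume uv: "(u, v) \<in> missing R S"
      have cross: "{(x, z), (z, x)} \<subseteq> blowup X (K - K\<^sub>0) K\<^sub>0 b c"
        if "x \<in> K" "z \<in> Q" "(x, z) \<notin> R \<or> (z, x) \<notin> R" for x z
        using that K0[of x z] K1[of x] c
        by (cases "z = b"; cases "z = c"; cases "x \<in> K\<^sub>0") (simp_all add: blowup_def X_def)
      have "{(b, c), (c, b)} \<subseteq> blowup X (K - K\<^sub>0) K\<^sub>0 b c" by (simp add: blowup_def)
      then show "(u, v) \<in> blowup X (K - K\<^sub>0) K\<^sub>0 b c"
        using miss[OF uv] arc[OF uv] cross[of u v] cross[of v u] c by auto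
    qed
    ultimately show ?thesis by (rule clique_extremal_aux)
  next
    case False
    define r where "r = card C - 1"
    have r: "card C = r + 1" "1 \<le> r" using False C_ne by (auto simp: r_def)
    have "2 * (card K\<^sub>0 * r) + 2 \<le> card (missing R Q)" using count cK r by (simp add: algebra_simps)
    moreover have "card (missing R Q) \<le> 2 * r + 2" using I le_C r by simp
    ultimately have "card K\<^sub>0 * r \<le> 1 * r" by linarith
    then have "card K\<^sub>0 = 1" using cK0 r(2) by simp
    then obtain x where x: "K\<^sub>0 = {x}" by (auto simp: card_1_singleton_iff)
    have xK: "x \<in> K" using x K0_sub by auto
    have "2 * r + 2 \<le> card (missing R Q)" using \<open>2 * (card K\<^sub>0 * r) + 2 \<le> card (missing R Q)\<close> \<open>card K\<^sub>0 = 1\<close> by simp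
    then have rp: "card C + 1 \<le> p" using missing_Q_le r by simp
    have cardX: "card (K - {x}) + 1 = p" using cK x by simp
    have Xne: "K - {x} \<noteq> {}" using cardX p2 by (metis One_nat_def Suc_1 add_0 card.empty not_less_eq_eq order_refl)
    define Y where "Y = Q - {b} - C"
    have "card Y = card (Q - {b}) - card C" unfolding Y_def by (rule card_Diff_subset[OF finC(3) CQ])
    then have cY: "card C + card Y = p" using b fin card_Q rp by simp
    have Y_ne: "Y \<noteq> {}" using cY rp by auto
    have "C \<noteq> {}" using C_ne by auto
    have "blowup_sets p (K - {x}) C Y x b"
      unfolding blowup_sets_def using b CQ fin finC cY cardX Y_ne \<open>C \<noteq> {}\<close> Xne xK
      by (auto simp: Y_def Q_def)
    moreover have "(K - {x}) \<union> C \<union> Y \<union> {x, b} \<subseteq> S" using b CQ split xK by (auto simp: Y_def)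
    moreover have "missing R S \<subseteq> blowup (K - {x}) C Y x b"
    proof (rule subrelI)
      fix u v assume uv: "(u, v) \<in> missing R S"
      have cross: "{(y, z), (z, y)} \<subseteq> blowup (K - {x}) C Y x b"
        if "y \<in> K" "z \<in> Q" "(y, z) \<notin> R \<or> (z, y) \<notin> R" for y z
        using that K0[of y z] K1[of y] x
        by (cases "z = b"; cases "z \<in> C"; cases "y = x") (simp_all add: blowup_def Y_def)
      have "{(b, z), (z, b)} \<subseteq> blowup (K - {x}) C Y x b" if "z \<in> C" for z
        using that by (simp add: blowup_def)
      then show "(u, v) \<in> blowup (K - {x}) C Y x b"
        using miss[OF uv] arc[OF uv] cross[of u v] cross[of v u] by blast
    qed
    ultimately show ?thesis by (rule clique_extremal_aux)
  qed
qed

end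

subsection \<open>The maximal number of missing arcs\<close>

lemma card_missing_le:
  assumes "irrefl R" "vertex_critical R k S" "card S = k + p"
  shows "card (missing R S) \<le> (k + p) * p"
proof -
  have "(\<Sum>v\<in>S. out_missing R S v) \<le> card S * p"
    using sum_bounded_above[of S "out_missing R S" p] vertex_critical_out_missing[OF assms] by simp
  then show ?thesis
    using card_missing_eq_sum[of S R] assms by (simp add: vertex_critical_def)
qed

lemma three_vertices_extremal:
  assumes "irrefl R" "vertex_critical R 2 S" "card S = 3" "3 \<le> card (missing R S)"
  shows "extremal 1 R S"
proof -
  have fin: "finite S" using assms(3) by (metis card.infinite zero_neq_numeral)
  have out1: "out_missing R S v \<le> 1" and in1: "in_missing R S v \<le> 1" if "v \<in> S" for v
    using vertex_critical_out_missing[OF assms(1,2), of 1 v]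
      vertex_critical_in_missing[OF assms(1,2), of 1 v] assms(3) that by auto
  have out_eq: "out_missing R S v = 1" if v: "v \<in> S" for v
  proof (rule ccontr)
    assume "out_missing R S v \<noteq> 1"
    then have "out_missing R S v = 0" using out1[OF v] by simp
    then have "(\<Sum>u\<in>S. out_missing R S u) = (\<Sum>u\<in>S - {v}. out_missing R S u)"
      using sum.remove[OF fin v, of "out_missing R S"] by simp
    also have "\<dots> \<le> card (S - {v}) * 1"
      using sum_bounded_above[of "S - {v}" "out_missing R S" 1] out1 by simp
    finally show False using assms(3,4) v fin card_missing_eq_sum[OF fin, of R] by simp
  qed
  define A where "A v = {u \<in> S. u \<noteq> v \<and> (v, u) \<notin> R}" for v
  have "\<exists>w. A v = {w}" if v: "v \<in> S" for v
    using out_eq[OF v] unfolding out_missing_def A_def[symmetric] by (simp add: card_1_singleton_iff)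
  then obtain m where m: "\<And>v. v \<in> S \<Longrightarrow> A v = {m v}" by metis
  have mS: "m v \<in> S" "m v \<noteq> v" "(v, m v) \<notin> R" if "v \<in> S" for v
  proof -
    have "m v \<in> A v" unfolding m[OF that] by simp
    then show "m v \<in> S" "m v \<noteq> v" "(v, m v) \<notin> R" by (simp_all add: A_def)
  qed
  have minj: "v = w" if "v \<in> S" "w \<in> S" "m v = m w" for v w
  proof -
    have "{v, w} \<subseteq> {u \<in> S. u \<noteq> m v \<and> (m v, u) \<notin> R\<inverse>}" using that mS[of v] mS[of w] by auto
    moreover have "card {u \<in> S. u \<noteq> m v \<and> (m v, u) \<notin> R\<inverse>} \<le> 1"
      using in1[of "m v"] mS[OF that(1)] by (simp add: out_missing_def)
    ultimately show ?thesis using fin card_le_Suc0_iff_eq[of "{u \<in> S. u \<noteq> m v \<and> (m v, u) \<notin> R\<inverse>}"]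
      by auto
  qed
  have miss: "missing R S = (\<lambda>v. (v, m v)) ` S"
  proof
    show "missing R S \<subseteq> (\<lambda>v. (v, m v)) ` S"
    proof (rule subrelI)
      fix u v assume "(u, v) \<in> missing R S"
      then have "u \<in> S" "v \<in> A u" by (auto simp: missing_def A_def)
      then show "(u, v) \<in> (\<lambda>v. (v, m v)) ` S" using m[of u] by auto
    qed
    show "(\<lambda>v. (v, m v)) ` S \<subseteq> missing R S" using mS unfolding missing_def by fastforce
  qed
  obtain a b c where S: "S = {a, b, c}" "a \<noteq> b" "b \<noteq> c" "a \<noteq> c"
    using assms(3) by (metis card_3_iff)
  consider "m a = c" "m b = a" "m c = b" | "m a = b" "m b = c" "m c = a"
    using mS[of a] mS[of b] mS[of c] minj[of a b] minj[of b c] minj[of a c] S by auto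
  then show ?thesis
  proof cases
    case 1
    then have "missing R S = {(b, a), (c, b), (a, c)}" using miss S by auto
    then show ?thesis using S unfolding extremal_def by auto
  next
    case 2
    then have "missing R S = {(c, a), (b, c), (a, b)}" using miss S by auto
    then show ?thesis using S unfolding extremal_def by auto
  qed
qed

lemma sum_le_mult: "2 \<le> s \<Longrightarrow> 2 \<le> t \<Longrightarrow> s + t \<le> s * (t::nat)"
  using mult_le_mono[of 1 "s - 1" 1 "t - 1"] by (cases s; cases t) auto

text \<open>If no two vertices are without arcs between them (\<open>semi\<close> below), then an acyclic triple can be
  deleted instead of a pair; if there is none either, then a non-digon pair has few common
  non-digon neighbours, which saves enough missing arcs.\<close>

lemma vertex_critical_odd_order_extremal:
  assumes irr: "irrefl R" and crit: "vertex_critical R (p + 1) S" and cS: "card S = 2 * p + 1"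
    and p2: "2 \<le> p" and many: "2 * p\<^sup>2 + 2 \<le> card (missing R S)"
    and IH: "\<And>V q. V \<subset> S \<Longrightarrow> vertex_critical R p V \<Longrightarrow> card V = p + q \<Longrightarrow>
      card (missing R V) \<le> missing_bound q \<and>
      (card (missing R V) = missing_bound q \<longrightarrow> 1 \<le> q \<longrightarrow> extremal q R V)"
  shows "extremal p R S"
proof (rule ccontr)
  assume not_ext: "\<not> extremal p R S"
  have fin: "finite S" and chiS: "chi R S = p + 1" using crit by (auto simp: vertex_critical_def)
  define M where "M = card (missing R S)"
  define deg where "deg v = out_missing R S v + in_missing R S v" for v
  have outp: "out_missing R S v \<le> p" and inp: "in_missing R S v \<le> p" if "v \<in> S" for v
    using vertex_critical_out_missing[OF irr crit, of p v] vertex_critical_in_missing[OF irr crit, of p v]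
      cS that by auto
  have deg_le: "deg v \<le> 2 * p" if "v \<in> S" for v using outp[OF that] inp[OF that] by (simp add: deg_def)
  have no_clique: "card V \<noteq> p" if V: "V \<subseteq> S" "vertex_critical R p V" for V
  proof
    assume cV: "card V = p"
    then have "missing R V = {}"
      using card_missing_le[OF irr V(2), of 0] V(2) finite_missing[of V R]
      by (simp add: vertex_critical_def)
    then have "clique_split R S V p"
      using irr crit cS p2 V(1) cV many by unfold_locales (auto simp: missing_def)
    then show False using clique_split.clique_extremal not_ext by blast
  qed
  have delete: "\<exists>V q. V \<subseteq> S - T \<and> vertex_critical R p V \<and> card V = p + q \<and> 1 \<le> q \<and>
      q + card T \<le> p + 1 \<and> card (S - V) + q = p + 1 \<and> card (missing R V) \<le> missing_bound q \<and>
      (card (missing R V) = missing_bound q \<longrightarrow> extremal q R V) \<and>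
      M + card (missing R (S - V)) = card (missing R V) + (\<Sum>v\<in>S - V. deg v)"
    if T: "T \<subseteq> S" "T \<noteq> {}" "acyclic_on R T" for T
  proof -
    have fT: "finite T" using T fin finite_subset by blast
    have "p \<le> chi R (S - T)" using chi_remove[OF irr fin fT T(3)] chiS by simp
    then obtain V where V: "V \<subseteq> S - T" "vertex_critical R p V"
      using ex_vertex_critical_subset[OF irr, of "S - T" p] fin by blast
    have fV: "finite V" using V by (simp add: vertex_critical_def)
    have "p \<le> card V" using V(2) chi_le_card[OF irr fV] by (simp add: vertex_critical_def)
    then obtain q where q: "card V = p + q" using le_Suc_ex by blast
    have q1: "1 \<le> q" using no_clique[of V] V q by (cases q) auto
    have VS: "V \<subset> S" using V T by blast
    have "card V \<le> card S - card T"
      using card_mono[OF _ V(1)] fin fT T(1) by (simp add: card_Diff_subset)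
    moreover have "card T \<le> card S" using card_mono[OF fin T(1)] .
    ultimately have qT: "q + card T \<le> p + 1" using q cS by simp
    have "card (S - V) = card S - card V" using VS fV by (simp add: card_Diff_subset)
    then have cQ: "card (S - V) + q = p + 1" using q cS qT by simp
    have "S - (S - V) = V" using VS by auto
    then have "M + card (missing R (S - V)) = card (missing R V) + (\<Sum>v\<in>S - V. deg v)"
      using card_missing_add[OF fin, of "S - V" R] by (simp add: M_def deg_def sum.distrib)
    then show ?thesis using V q q1 qT cQ IH[OF VS V(2) q] by blast
  qed
  have no_triple: "\<not> acyclic_on R {a, b, c}"
    if abc: "{a, b, c} \<subseteq> S" "a \<noteq> b" "b \<noteq> c" "a \<noteq> c" for a b c
  proof
    assume ac: "acyclic_on R {a, b, c}"
    obtain V q where V: "V \<subseteq> S - {a, b, c}" "1 \<le> q" "q + card {a, b, c} \<le> p + 1"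
      "card (S - V) + q = p + 1" "card (missing R V) \<le> missing_bound q"
      "M + card (missing R (S - V)) = card (missing R V) + (\<Sum>v\<in>S - V. deg v)"
      using delete[OF abc(1) _ ac] by (metis insert_not_empty)
    have ex: "\<exists>e. e \<in> {(u, v), (v, u)} \<and> e \<in> missing R (S - V)"
      if "u \<in> {a, b, c}" "v \<in> {a, b, c}" "u \<noteq> v" for u v
    proof -
      have "u \<in> S - V" "v \<in> S - V" using that V(1) abc(1) by blast+
      moreover have "(u, v) \<notin> R \<or> (v, u) \<notin> R" using digon_not_acyclic_on[of u "{a, b, c}" v R] that ac by blast
      ultimately show ?thesis using that(3) unfolding missing_def by blast
    qed
    obtain e\<^sub>1 where e1: "e\<^sub>1 \<in> {(a, b), (b, a)}" "e\<^sub>1 \<in> missing R (S - V)" using ex[of a b] abc by blast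
    obtain e\<^sub>2 where e2: "e\<^sub>2 \<in> {(b, c), (c, b)}" "e\<^sub>2 \<in> missing R (S - V)" using ex[of b c] abc by blast
    obtain e\<^sub>3 where e3: "e\<^sub>3 \<in> {(a, c), (c, a)}" "e\<^sub>3 \<in> missing R (S - V)" using ex[of a c] abc by blast
    have "card {e\<^sub>1, e\<^sub>2, e\<^sub>3} \<le> card (missing R (S - V))"
      using e1 e2 e3 finite_missing[of "S - V" R] fin by (intro card_mono) auto
    moreover have "card {e\<^sub>1, e\<^sub>2, e\<^sub>3} = 3" using e1 e2 e3 abc by auto
    ultimately have m3: "3 \<le> card (missing R (S - V))" by simp
    have sle: "(\<Sum>v\<in>S - V. deg v) \<le> card (S - V) * (2 * p)"
      using sum_bounded_above[of "S - V" deg "2 * p"] deg_le by simp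
    obtain t where t: "p = q + t" "2 \<le> t" using V(3) abc le_Suc_ex[of q p] by auto
    have cSV: "card (S - V) = t + 1" using V(4) t by simp
    have "M + 3 \<le> missing_bound q + (t + 1) * (2 * p)" using V(5,6) m3 sle cSV by simp
    then have le: "2 * p\<^sup>2 + 5 \<le> missing_bound q + (t + 1) * (2 * p)" using many by (simp add: M_def)
    show False
    proof (cases "q = 1")
      case True
      then show False using le t by (simp add: missing_bound_def power2_eq_square algebra_simps)
    next
      case False
      then have "2 \<le> q" using V(2) by simp
      then have "q + t \<le> q * t" using sum_le_mult t(2) by blast
      then show False using le t \<open>2 \<le> q\<close> by (simp add: missing_bound_def power2_eq_square algebra_simps)
    qed
  qed
  have no_arcs: "3 \<le> p \<and> out_missing R S u = p \<and> extremal (p - 1) R (S - {u, w}) \<and> M \<le> 2 * p\<^sup>2 + 2"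
    if uw: "u \<in> S" "w \<in> S" "u \<noteq> w" "(u, w) \<notin> R" "(w, u) \<notin> R"
    and V: "V \<subseteq> S - {u, w}" "1 \<le> q" "q + card {u, w} \<le> p + 1"
      "card (S - V) + q = p + 1" "card (missing R V) \<le> missing_bound q"
      "card (missing R V) = missing_bound q \<longrightarrow> extremal q R V"
      "M + card (missing R (S - V)) = card (missing R V) + (\<Sum>v\<in>S - V. deg v)"
    for u w V q
  proof -
    have "{(u, w), (w, u)} \<subseteq> missing R (S - V)" using V(1) uw by (auto simp: missing_def)
    then have "card {(u, w), (w, u)} \<le> card (missing R (S - V))"
      using finite_missing[of "S - V" R] fin by (intro card_mono) auto
    then have m2: "2 \<le> card (missing R (S - V))" using uw by simp
    have sle: "(\<Sum>v\<in>S - V. deg v) \<le> card (S - V) * (2 * p)"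
      using sum_bounded_above[of "S - V" deg "2 * p"] deg_le by simp
    obtain t where t: "p = q + t" "1 \<le> t" using V(3) uw le_Suc_ex[of q p] by auto
    have cSV: "card (S - V) = t + 1" using V(4) t by simp
    have "M + 2 \<le> missing_bound q + (t + 1) * (2 * p)" using V(5,7) m2 sle cSV by simp
    then have le: "2 * p\<^sup>2 + 4 \<le> missing_bound q + (t + 1) * (2 * p)" using many by (simp add: M_def)
    have q2: "2 \<le> q"
    proof (rule ccontr)
      assume "\<not> 2 \<le> q"
      then have "q = 1" using V(2) by simp
      then show False using le t by (simp add: missing_bound_def power2_eq_square algebra_simps)
    qed
    have t1: "t = 1"
    proof (rule ccontr)
      assume "t \<noteq> 1"
      then have "q + t \<le> q * t" using sum_le_mult[of q t] t(2) q2 by simp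
      then show False using le t q2 by (simp add: missing_bound_def power2_eq_square algebra_simps)
    qed
    have "{u, w} \<subseteq> S - V" using uw V(1) by auto
    moreover have "card (S - V) \<le> card {u, w}" using cSV t1 uw by simp
    ultimately have SV: "S - V = {u, w}" using card_seteq[of "S - V" "{u, w}"] fin by simp
    have Veq: "V = S - {u, w}" using SV V(1) by blast
    have dsum: "(\<Sum>v\<in>S - V. deg v) = deg u + deg w" using SV uw by simp
    have bq: "missing_bound q + 4 * p = 2 * p\<^sup>2 + 4"
      using t t1 q2 by (simp add: missing_bound_def power2_eq_square algebra_simps)
    have "2 * p\<^sup>2 + 4 \<le> card (missing R V) + deg u + deg w" using V(7) m2 many dsum by (simp add: M_def)
    then have cV: "card (missing R V) = missing_bound q" and du: "deg u = 2 * p"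
      using bq V(5) deg_le[OF uw(1)] deg_le[OF uw(2)] by linarith+
    have "extremal q R (S - {u, w})" using V(6) cV Veq by simp
    then have "extremal (p - 1) R (S - {u, w})" using t t1 by simp
    moreover have "out_missing R S u = p"
      using du outp[OF uw(1)] inp[OF uw(1)] by (simp add: deg_def)
    moreover have "M + 2 \<le> 2 * p\<^sup>2 + 4"
      using V(5,7) m2 dsum bq deg_le[OF uw(1)] deg_le[OF uw(2)] by linarith
    ultimately show ?thesis using t t1 q2 by simp
  qed
  have no_arcs': "3 \<le> p \<and> out_missing R S u = p \<and> extremal (p - 1) R (S - {u, w}) \<and> M \<le> 2 * p\<^sup>2 + 2"
    if uw: "u \<in> S" "w \<in> S" "u \<noteq> w" "(u, w) \<notin> R" "(w, u) \<notin> R" for u w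
  proof -
    have "{u, w} \<subseteq> S" "{u, w} \<noteq> {}" "acyclic_on R {u, w}" using uw acyclic_on_pair[OF irr] by auto
    from delete[OF this] obtain V q where V: "V \<subseteq> S - {u, w}" "1 \<le> q" "q + card {u, w} \<le> p + 1"
      "card (S - V) + q = p + 1" "card (missing R V) \<le> missing_bound q"
      "card (missing R V) = missing_bound q \<longrightarrow> extremal q R V"
      "M + card (missing R (S - V)) = card (missing R V) + (\<Sum>v\<in>S - V. deg v)"
      by metis
    show ?thesis by (rule no_arcs[OF uw V])
  qed
  show False
  proof (cases "\<exists>u\<in>S. \<exists>w\<in>S. u \<noteq> w \<and> (u, w) \<notin> R \<and> (w, u) \<notin> R")
    case True
    then obtain u w where uw: "u \<in> S" "w \<in> S" "u \<noteq> w" "(u, w) \<notin> R" "(w, u) \<notin> R" by blast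
    have p3: "3 \<le> p" and ext: "extremal (p - 1) R (S - {u, w})" and M_le: "M \<le> 2 * p\<^sup>2 + 2"
      using no_arcs'[OF uw] by auto
    have "p - 1 \<noteq> 1" using p3 by simp
    then obtain X Y\<^sub>1 Y\<^sub>2 v\<^sub>1 v\<^sub>2 where bs: "blowup_sets (p - 1) X Y\<^sub>1 Y\<^sub>2 v\<^sub>1 v\<^sub>2"
      and sub: "X \<union> Y\<^sub>1 \<union> Y\<^sub>2 \<union> {v\<^sub>1, v\<^sub>2} \<subseteq> S - {u, w}"
      and miss: "missing R (S - {u, w}) = blowup X Y\<^sub>1 Y\<^sub>2 v\<^sub>1 v\<^sub>2"
      using extremal_blowup[OF ext] by metis
    have "card (X \<union> Y\<^sub>1 \<union> Y\<^sub>2 \<union> {v\<^sub>1, v\<^sub>2}) = card X + card Y\<^sub>1 + card Y\<^sub>2 + 2"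
      using bs by (simp add: blowup_sets_def card_Un_disjoint Int_Un_distrib2)
    also have "\<dots> = card (S - {u, w})"
      using bs uw fin cS p3 by (auto simp: blowup_sets_def card_Diff_subset)
    finally have eq: "X \<union> Y\<^sub>1 \<union> Y\<^sub>2 \<union> {v\<^sub>1, v\<^sub>2} = S - {u, w}" using sub fin by (intro card_subset_eq) auto
    have partner: "\<exists>z'\<in>S. z \<noteq> z' \<and> (z, z') \<notin> R \<and> (z', z) \<notin> R" if z: "z \<in> S" for z
    proof (cases "z \<in> {u, w}")
      case True
      then show ?thesis using uw by auto
    next
      case False
      obtain x y\<^sub>1 where xy: "x \<in> X" "y\<^sub>1 \<in> Y\<^sub>1" using bs by (auto simp: blowup_sets_def)
      have "z \<in> X \<or> z \<in> Y\<^sub>1 \<or> z \<in> Y\<^sub>2 \<or> z = v\<^sub>1 \<or> z = v\<^sub>2" using False z eq by blast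
      then have "\<exists>z'. (z, z') \<in> blowup X Y\<^sub>1 Y\<^sub>2 v\<^sub>1 v\<^sub>2 \<and> (z', z) \<in> blowup X Y\<^sub>1 Y\<^sub>2 v\<^sub>1 v\<^sub>2"
        using xy unfolding blowup_def Let_def by blast
      then show ?thesis unfolding miss[symmetric] missing_def by blast
    qed
    have "out_missing R S z = p" if "z \<in> S" for z using partner[OF that] no_arcs'[OF that] by blast
    then have "M = card S * p" using card_missing_eq_sum[OF fin, of R] by (simp add: M_def)
    then show False using M_le cS p3 by (simp add: power2_eq_square algebra_simps)
  next
    case semi: False
    have "missing R S \<noteq> {}" using many by auto
    then obtain u w where uw: "u \<in> S" "w \<in> S" "u \<noteq> w" "(u, w) \<notin> R" by (auto simp: missing_def)
    have "{u, w} \<subseteq> S" "{u, w} \<noteq> {}" "acyclic_on R {u, w}" using uw acyclic_on_pair[OF irr] by auto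
    from delete[OF this] obtain V q where V: "V \<subseteq> S - {u, w}" "1 \<le> q" "q + card {u, w} \<le> p + 1"
      "card (S - V) + q = p + 1" "card (missing R V) \<le> missing_bound q"
      "M + card (missing R (S - V)) = card (missing R V) + (\<Sum>v\<in>S - V. deg v)"
      by metis
    have "(u, w) \<in> missing R (S - V)" using V(1) uw by (auto simp: missing_def)
    then have m1: "1 \<le> card (missing R (S - V))"
      using finite_missing[of "S - V" R] fin by (metis One_nat_def Suc_leI card_gt_0_iff empty_iff finite_Diff)
    define N where "N x = {y \<in> S. y \<noteq> x \<and> ((x, y) \<notin> R \<or> (y, x) \<notin> R)}" for x
    have degN: "deg x = card (N x)" if x: "x \<in> S" for x
    proof -
      have "N x = {y \<in> S. y \<noteq> x \<and> (x, y) \<notin> R} \<union> {y \<in> S. y \<noteq> x \<and> (x, y) \<notin> R\<inverse>}"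
        by (auto simp: N_def)
      moreover have "{y \<in> S. y \<noteq> x \<and> (x, y) \<notin> R} \<inter> {y \<in> S. y \<noteq> x \<and> (x, y) \<notin> R\<inverse>} = {}"
        using semi x by auto
      ultimately show ?thesis using fin by (simp add: deg_def out_missing_def card_Un_disjoint)
    qed
    have "N u \<inter> N w \<subseteq> {y \<in> S. y \<noteq> u \<and> (u, y) \<notin> R\<inverse>}"
    proof
      fix z assume z: "z \<in> N u \<inter> N w"
      then have zz: "z \<in> S" "z \<noteq> u" "z \<noteq> w" "(w, z) \<notin> R \<or> (z, w) \<notin> R" by (auto simp: N_def)
      have "\<not> acyclic_on R (insert u {w, z})" using no_triple[of u w z] uw zz by auto
      from not_acyclic_on_insertD[OF irr acyclic_on_pair[OF irr zz(4)] this]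
      have "(u, z) \<in> R" using uw(4) by (metis insertE singletonD)
      then show "z \<in> {y \<in> S. y \<noteq> u \<and> (u, y) \<notin> R\<inverse>}" using z by (auto simp: N_def)
    qed
    then have "card (N u \<inter> N w) \<le> in_missing R S u"
      unfolding out_missing_def using fin by (intro card_mono) auto
    then have "card (N u \<inter> N w) \<le> p" using inp[OF uw(1)] by simp
    moreover have "N u \<union> N w \<subseteq> S" by (auto simp: N_def)
    then have "card (N u \<union> N w) \<le> 2 * p + 1" using card_mono[OF fin] cS by metis
    moreover have "card (N u) + card (N w) = card (N u \<union> N w) + card (N u \<inter> N w)"
      using fin by (intro card_Un_Int) (auto simp: N_def)
    ultimately have duw: "deg u + deg w \<le> 3 * p + 1" using degN uw by simp
    obtain t where t: "p = q + t" "1 \<le> t" using V(3) uw le_Suc_ex[of q p] by auto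
    have cSV: "card (S - V) = t + 1" using V(4) t by simp
    have uwV: "{u, w} \<subseteq> S - V" using V(1) uw by auto
    then have "(\<Sum>v\<in>S - V. deg v) = (\<Sum>v\<in>S - V - {u, w}. deg v) + (\<Sum>v\<in>{u, w}. deg v)"
      using fin by (intro sum.subset_diff) auto
    moreover have "(\<Sum>v\<in>S - V - {u, w}. deg v) \<le> card (S - V - {u, w}) * (2 * p)"
      using sum_bounded_above[of "S - V - {u, w}" deg "2 * p"] deg_le by simp
    moreover have "card (S - V - {u, w}) = t - 1" using cSV uwV uw fin by (simp add: card_Diff_subset)
    ultimately have "M + 1 \<le> missing_bound q + (t - 1) * (2 * p) + (3 * p + 1)"
      using V(5,6) m1 duw uw(3) by simp
    then have le: "2 * p\<^sup>2 + 3 \<le> missing_bound q + (t - 1) * (2 * p) + (3 * p + 1)"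
      using many by (simp add: M_def)
    obtain t' where t': "t = Suc t'" using t(2) by (cases t) auto
    show False
    proof (cases "q = 1")
      case True
      then show False using le t t' by (simp add: missing_bound_def power2_eq_square algebra_simps)
    next
      case False
      then have q2: "2 \<le> q" using V(2) by simp
      then have "q + 2 * (q * t') \<le> Suc t'"
        using le t t' by (simp add: missing_bound_def power2_eq_square algebra_simps)
      moreover have "1 * t' \<le> q * t'" using q2 by (intro mult_le_mono1) simp
      ultimately show False using q2 by linarith
    qed
  qed
qed

theorem card_missing_le_bound:
  assumes "irrefl R" "vertex_critical R k S" "card S = k + p"
  shows "card (missing R S) \<le> missing_bound p \<and>
    (card (missing R S) = missing_bound p \<longrightarrow> 1 \<le> p \<longrightarrow> extremal p R S)"
  using assms(2,3)
proof (induction "card S" arbitrary: S k p rule: less_induct)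
  case less
  note irr = assms(1) and crit = less.prems(1) and cS = less.prems(2)
  have fin: "finite S" and chi: "chi R S = k" using crit by (auto simp: vertex_critical_def)
  have le: "card (missing R S) \<le> (k + p) * p" by (rule card_missing_le[OF irr crit cS])
  consider "p = 0" | "1 \<le> p" "k \<le> p" | "p = 1" "k = 2" | "2 \<le> p" "k = p + 1" | "1 \<le> p" "p + 2 \<le> k"
    by linarith
  then show ?case
  proof cases
    case 1
    then show ?thesis using le by (simp add: missing_bound_def)
  next
    case 2
    have "(k + p) * p \<le> (p + p) * p" using 2 by (intro mult_le_mono1) simp
    moreover have "(p + p) * p < missing_bound p"
      using 2 by (auto simp: missing_bound_def power2_eq_square algebra_simps)
    ultimately show ?thesis using le by linarith
  next
    case 3
    then show ?thesis using le three_vertices_extremal[OF irr, of S] crit cS by (auto simp: missing_bound_def)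
  next
    case 4
    have ext: "extremal p R S" if "2 * p\<^sup>2 + 2 \<le> card (missing R S)"
    proof (rule vertex_critical_odd_order_extremal[OF irr _ _ 4(1) that])
      show "vertex_critical R (p + 1) S" "card S = 2 * p + 1" using crit cS 4 by auto
      fix V q assume "V \<subset> S" "vertex_critical R p V" "card V = p + q"
      then show "card (missing R V) \<le> missing_bound q \<and>
          (card (missing R V) = missing_bound q \<longrightarrow> 1 \<le> q \<longrightarrow> extremal q R V)"
        using less.hyps[of V p q] psubset_card_mono[OF fin] by blast
    qed
    have b: "missing_bound p = 2 * p\<^sup>2 + 2" using 4 by (simp add: missing_bound_def)
    show ?thesis
    proof (cases "2 * p\<^sup>2 + 2 \<le> card (missing R S)")
      case True
      then show ?thesis using ext extremal_card_missing[of p R S] 4 by simp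
    next
      case False
      then show ?thesis using b by simp
    qed
  next
    case 5
    then have "card S + 2 \<le> 2 * k" using cS by simp
    from vertex_critical_decomposes[OF irr crit this]
    obtain Z where Z: "Z \<subset> S" "Z \<noteq> {}"
      and join: "\<And>z w. z \<in> Z \<Longrightarrow> w \<in> S - Z \<Longrightarrow> (z, w) \<in> R \<and> (w, z) \<in> R" by metis
    define W where "W = S - Z"
    have S: "S = Z \<union> W" "Z \<inter> W = {}" "W \<noteq> {}" and W: "W \<subset> S" using Z by (auto simp: W_def)
    have finZW: "finite Z" "finite W" using fin S by auto
    have chi_split: "chi R (A \<union> B) = chi R A + chi R B" if "A \<subseteq> Z" "B \<subseteq> W" for A B
    proof (rule chi_join[OF irr])
      show "finite A" "finite B" using that finZW by (auto intro: finite_subset)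
      show "A \<inter> B = {}" using that S(2) by blast
      show "(a, b) \<in> R \<and> (b, a) \<in> R" if "a \<in> A" "b \<in> B" for a b
        using that \<open>A \<subseteq> Z\<close> \<open>B \<subseteq> W\<close> join[of a b] by (auto simp: W_def)
    qed
    have k: "chi R Z + chi R W = k" using chi_split[of Z W] S chi by simp
    have critZ: "vertex_critical R (chi R Z) Z" unfolding vertex_critical_def
    proof (intro conjI ballI)
      fix v assume v: "v \<in> Z"
      then have eq: "S - {v} = (Z - {v}) \<union> W" using S by auto
      have "v \<in> S" using v S(1) by blast
      then have "chi R (S - {v}) < k" using crit unfolding vertex_critical_def by blast
      moreover have "chi R (S - {v}) = chi R (Z - {v}) + chi R W" unfolding eq by (rule chi_split) auto
      ultimately have "chi R (Z - {v}) + chi R W < k" by simp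
      then show "chi R (Z - {v}) < chi R Z" using k by simp
    qed (use finZW in auto)
    have critW: "vertex_critical R (chi R W) W" unfolding vertex_critical_def
    proof (intro conjI ballI)
      fix v assume v: "v \<in> W"
      then have eq: "S - {v} = Z \<union> (W - {v})" using S by auto
      have "v \<in> S" using v S(1) by blast
      then have "chi R (S - {v}) < k" using crit unfolding vertex_critical_def by blast
      moreover have "chi R (S - {v}) = chi R Z + chi R (W - {v})" unfolding eq by (rule chi_split) auto
      ultimately have "chi R Z + chi R (W - {v}) < k" by simp
      then show "chi R (W - {v}) < chi R W" using k by simp
    qed (use finZW in auto)
    obtain r where r: "card Z = chi R Z + r" using chi_le_card[OF irr finZW(1)] le_Suc_ex by blast
    obtain s where s: "card W = chi R W + s" using chi_le_card[OF irr finZW(2)] le_Suc_ex by blast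
    have "card S = card Z + card W" using S finZW by (simp add: card_Un_disjoint)
    then have p: "p = r + s" using r s k cS by simp
    have miss: "missing R S = missing R Z \<union> missing R W" "missing R Z \<inter> missing R W = {}"
      using S join by (auto simp: missing_def W_def)
    then have cm: "card (missing R S) = card (missing R Z) + card (missing R W)"
      using finZW by (simp add: card_Un_disjoint finite_missing)
    have IHZ: "card (missing R Z) \<le> missing_bound r \<and>
        (card (missing R Z) = missing_bound r \<longrightarrow> 1 \<le> r \<longrightarrow> extremal r R Z)"
      using less.hyps[OF psubset_card_mono[OF fin Z(1)] critZ r] .
    have IHW: "card (missing R W) \<le> missing_bound s \<and>
        (card (missing R W) = missing_bound s \<longrightarrow> 1 \<le> s \<longrightarrow> extremal s R W)"
      using less.hyps[OF psubset_card_mono[OF fin W] critW s] .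
    have mono: "extremal p R S" if A: "extremal p R A" "A \<subseteq> S" "missing R S = missing R A" for A
    proof (cases "p = 1")
      case True
      then show ?thesis using A unfolding extremal_def by auto
    next
      case False
      obtain X Y\<^sub>1 Y\<^sub>2 v\<^sub>1 v\<^sub>2 where "blowup_sets p X Y\<^sub>1 Y\<^sub>2 v\<^sub>1 v\<^sub>2"
        "X \<union> Y\<^sub>1 \<union> Y\<^sub>2 \<union> {v\<^sub>1, v\<^sub>2} \<subseteq> A" "missing R A = blowup X Y\<^sub>1 Y\<^sub>2 v\<^sub>1 v\<^sub>2"
        using extremal_blowup[OF A(1) False] by metis
      then show ?thesis using extremal_blowupI[OF _ False] A(2,3) by (metis order_trans)
    qed
    have b0: "missing_bound 0 = 0" by (simp add: missing_bound_def)
    show ?thesis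
    proof (cases "r = 0 \<or> s = 0")
      case True
      then show ?thesis
      proof
        assume r0: "r = 0"
        then have "missing R Z = {}" using IHZ b0 finite_missing[OF finZW(1), of R] by simp
        then show ?thesis using mono[of W] IHW miss cm p r0 W by auto
      next
        assume s0: "s = 0"
        then have "missing R W = {}" using IHW b0 finite_missing[OF finZW(2), of R] by simp
        then show ?thesis using mono[of Z] IHZ miss cm p s0 Z by auto
      qed
    next
      case False
      then have "missing_bound r + missing_bound s < missing_bound p"
        using missing_bound_superadditive[of r s] p by simp
      then show ?thesis using cm IHZ IHW by linarith
    qed
  qed
qed

subsection \<open>Criticality of the extremal configurations\<close>

lemma chi_matched:
  assumes "irrefl R" "finite X" "finite Y" "card X = card Y" "X \<inter> Y = {}"
    "\<And>x y. x \<in> X \<Longrightarrow> y \<in> Y \<Longrightarrow> (x, y) \<notin> R"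
  shows "chi R (X \<union> Y) \<le> card Y"
proof -
  obtain f where f: "bij_betw f X Y" using assms finite_same_card_bij by blast
  define c where "c v = (if v \<in> X then f v else v)" for v
  have fY: "f x \<in> Y" if "x \<in> X" for x using f that by (auto simp: bij_betw_def)
  have "colouring R (X \<union> Y) c" unfolding colouring_def
  proof
    fix i
    have "\<exists>x. (x, i) \<notin> R \<and> {v \<in> X \<union> Y. c v = i} \<subseteq> {x, i}"
    proof (cases "\<exists>x\<in>X. f x = i")
      case True
      then obtain x where x: "x \<in> X" "f x = i" by blast
      then have "{v \<in> X \<union> Y. c v = i} \<subseteq> {x, i}"
        using f by (auto simp: c_def bij_betw_def dest: inj_onD split: if_splits)
      then show ?thesis using x fY[of x] assms(6)[of x i] by blast
    next
      case False
      then have "{v \<in> X \<union> Y. c v = i} \<subseteq> {i, i}" by (auto simp: c_def split: if_splits)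
      then show ?thesis using assms(1) by (auto simp: irrefl_def)
    qed
    then obtain x where x: "(x, i) \<notin> R" and sub: "{v \<in> X \<union> Y. c v = i} \<subseteq> {x, i}" by blast
    have "acyclic_on R {x, i}" using acyclic_on_pair[OF assms(1)] x by simp
    then show "acyclic_on R {v \<in> X \<union> Y. c v = i}" by (rule acyclic_on_mono[OF _ sub order_refl])
  qed
  then have "chi R (X \<union> Y) \<le> card (c ` (X \<union> Y))" using chi_le assms by (metis finite_Un)
  also have "\<dots> \<le> card Y" using fY assms(3) by (intro card_mono) (auto simp: c_def)
  finally show ?thesis .
qed

lemma card_le_twice_chi:
  assumes "irrefl R" "finite C" "\<And>A. A \<subseteq> C \<Longrightarrow> acyclic_on R A \<Longrightarrow> card A \<le> 2"
  shows "card C \<le> 2 * chi R C"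
proof -
  obtain c :: "'a \<Rightarrow> nat" where c: "colouring R C c" "card (c ` C) = chi R C"
    using chi_attained assms(1,2) by metis
  have "card C = (\<Sum>i\<in>c ` C. card {v \<in> C. c v = i})" by (rule card_eq_sum_fibres[OF assms(2)])
  also have "\<dots> \<le> card (c ` C) * 2"
  proof (rule order_trans[OF sum_bounded_above[of _ _ 2]])
    fix i show "card {v \<in> C. c v = i} \<le> 2"
      by (rule assms(3)) (use c(1) in \<open>auto simp: colouring_def\<close>)
  qed simp
  finally show ?thesis using c(2) by simp
qed

lemma vertex_critical_core:
  assumes irr: "irrefl R" and fin: "finite S" and cS: "card S = k + p" and pk: "p + 1 \<le> k"
    and C: "C \<subseteq> S" "card C = 2 * p + 1" "missing R S \<subseteq> C \<times> C"
    and lower: "\<And>A. A \<subseteq> C \<Longrightarrow> acyclic_on R A \<Longrightarrow> card A \<le> 2"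
    and upper: "\<And>v. v \<in> C \<Longrightarrow> chi R (C - {v}) \<le> p"
  shows "vertex_critical R k S"
proof -
  have finC: "finite C" using C fin finite_subset by blast
  define W where "W = S - C"
  have S: "S = W \<union> C" "W \<inter> C = {}" using C by (auto simp: W_def)
  have finW: "finite W" using fin by (simp add: W_def)
  have W: "(a, b) \<in> R \<and> (b, a) \<in> R" if "a \<in> W" "b \<in> S" "a \<noteq> b" for a b
    using that C(3) by (auto simp: W_def missing_def)
  have cW: "card W + p + 1 = k"
    using cS C(1,2) finC pk by (simp add: W_def card_Diff_subset)
  have split: "chi R (A \<union> B) = card A + chi R B" if "A \<subseteq> W" "B \<subseteq> C" for A B
  proof -
    have finA: "finite A" and finB: "finite B" using that finW finC by (auto intro: finite_subset)
    have arcs: "(a, b) \<in> R \<and> (b, a) \<in> R" if "a \<in> A" "b \<in> B" for a b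
      using W[of a b] that \<open>A \<subseteq> W\<close> \<open>B \<subseteq> C\<close> S by blast
    have "chi R A = card A"
      by (rule chi_clique[OF irr finA]) (use W that(1) S in blast)
    moreover have "A \<inter> B = {}" using that S by blast
    ultimately show ?thesis using chi_join[OF irr finA finB _ arcs] by simp
  qed
  obtain v\<^sub>0 where v0: "v\<^sub>0 \<in> C" using C(2) by (metis all_not_in_conv card.empty add_is_0 one_neq_zero)
  have "chi R C \<le> p + 1"
    using chi_remove[OF irr finC _ acyclic_on_singleton[OF irr], of v\<^sub>0] upper[OF v0] by simp
  moreover have "p + 1 \<le> chi R C" using card_le_twice_chi[OF irr finC lower] C(2) by simp
  ultimately have chiC: "chi R C = p + 1" by simp
  have chiS: "chi R S = k" using split[of W C] chiC cW S by simp
  have "chi R (S - {v}) < k" if v: "v \<in> S" for v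
  proof (cases "v \<in> C")
    case True
    then have "S - {v} = W \<union> (C - {v})" using S by blast
    moreover have "chi R (W \<union> (C - {v})) = card W + chi R (C - {v})" by (rule split) auto
    ultimately show ?thesis using upper[OF True] cW by simp
  next
    case False
    then have vW: "v \<in> W" using v by (simp add: W_def)
    then have "S - {v} = (W - {v}) \<union> C" using S by blast
    moreover have "chi R ((W - {v}) \<union> C) = card (W - {v}) + chi R C" by (rule split) auto
    moreover have "card (W - {v}) < card W" using vW finW by (rule card_Diff1_less[rotated])
    ultimately show ?thesis using chiC cW by simp
  qed
  then show ?thesis using fin chiS by (simp add: vertex_critical_def)
qed

lemma blowup_triangle_free:
  assumes bs: "blowup_sets p X Y\<^sub>1 Y\<^sub>2 v\<^sub>1 v\<^sub>2"
    and "(a, b) \<in> blowup X Y\<^sub>1 Y\<^sub>2 v\<^sub>1 v\<^sub>2" "(b, c) \<in> blowup X Y\<^sub>1 Y\<^sub>2 v\<^sub>1 v\<^sub>2" "(a, c) \<in> blowup X Y\<^sub>1 Y\<^sub>2 v\<^sub>1 v\<^sub>2"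
  shows False
proof -
  define l :: "'a \<Rightarrow> nat" where
    "l v = (if v = v\<^sub>1 then 0 else if v = v\<^sub>2 then 1 else if v \<in> Y\<^sub>1 then 2 else if v \<in> X then 3 else 4)" for v
  have "l v = (if l u = 4 then 0 else l u + 1) \<or> l u = (if l v = 4 then 0 else l v + 1)"
    if "(u, v) \<in> blowup X Y\<^sub>1 Y\<^sub>2 v\<^sub>1 v\<^sub>2" for u v
  proof -
    have l: "l v\<^sub>1 = 0" "l v\<^sub>2 = 1" "\<And>y. y \<in> Y\<^sub>1 \<Longrightarrow> l y = 2" "\<And>x. x \<in> X \<Longrightarrow> l x = 3"
      "\<And>y. y \<in> Y\<^sub>2 \<Longrightarrow> l y = 4"
      using bs unfolding blowup_sets_def l_def by auto
    from that consider "u \<in> X" "v \<in> Y\<^sub>1" | "u \<in> X" "v \<in> Y\<^sub>2" | "u = v\<^sub>1" "v \<in> Y\<^sub>2" | "u = v\<^sub>2" "v \<in> Y\<^sub>1"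
      | "u = v\<^sub>1" "v = v\<^sub>2" | "v \<in> X" "u \<in> Y\<^sub>1" | "v \<in> X" "u \<in> Y\<^sub>2" | "v = v\<^sub>1" "u \<in> Y\<^sub>2"
      | "v = v\<^sub>2" "u \<in> Y\<^sub>1" | "v = v\<^sub>1" "u = v\<^sub>2"
      by (auto simp: blowup_def)
    then show ?thesis by cases (simp_all add: l)
  qed
  from this[OF assms(2)] this[OF assms(3)] this[OF assms(4)] show False by (simp split: if_splits) (elim disjE; linarith)+
qed

lemma blowup_sym: "(u, v) \<in> blowup X Y\<^sub>1 Y\<^sub>2 v\<^sub>1 v\<^sub>2 \<Longrightarrow> (v, u) \<in> blowup X Y\<^sub>1 Y\<^sub>2 v\<^sub>1 v\<^sub>2"
  by (auto simp: blowup_def Let_def)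

theorem extremal_vertex_critical:
  assumes irr: "irrefl R" and fin: "finite S" and cS: "card S = k + p" and p: "1 \<le> p" "p + 1 \<le> k"
    and ext: "extremal p R S"
  shows "vertex_critical R k S"
proof (cases "p = 1")
  case True
  then obtain a b c where abc: "{a, b, c} \<subseteq> S" "a \<noteq> b" "b \<noteq> c" "c \<noteq> a"
    and miss: "missing R S = {(b, a), (c, b), (a, c)}"
    using ext by (auto simp: extremal_def)
  have R: "(a, b) \<in> R" "(b, c) \<in> R" "(c, a) \<in> R" "(b, a) \<notin> R" "(c, b) \<notin> R" "(a, c) \<notin> R"
  proof -
    have "(a, b) \<notin> missing R S" "(b, c) \<notin> missing R S" "(c, a) \<notin> missing R S"
      "(b, a) \<in> missing R S" "(c, b) \<in> missing R S" "(a, c) \<in> missing R S"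
      using abc by (simp_all add: miss)
    then show "(a, b) \<in> R" "(b, c) \<in> R" "(c, a) \<in> R" "(b, a) \<notin> R" "(c, b) \<notin> R" "(a, c) \<notin> R"
      using abc by (simp_all add: missing_def)
  qed
  show ?thesis
  proof (rule vertex_critical_core[OF irr fin cS p(2) abc(1)])
    show "card {a, b, c} = 2 * p + 1" using abc True by auto
    show "missing R S \<subseteq> {a, b, c} \<times> {a, b, c}" by (simp add: miss)
    fix A assume A: "A \<subseteq> {a, b, c}" "acyclic_on R A"
    have "\<not> {a, b, c} \<subseteq> A"
      using triangle_not_acyclic_on[of a A b c R] R(1-3) A(2) by (meson insert_subset)
    then have "card A < card {a, b, c}" using A(1) by (intro psubset_card_mono) auto
    then show "card A \<le> 2" using abc by simp
  next
    fix v assume "v \<in> {a, b, c}"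
    then have "{a, b, c} - {v} \<in> {{b, c}, {a, c}, {a, b}}" using abc by auto
    moreover have "acyclic_on R {b, c}" "acyclic_on R {a, c}" "acyclic_on R {a, b}"
      using acyclic_on_pair[OF irr] R by blast+
    ultimately have "acyclic_on R ({a, b, c} - {v})" by (elim insertE emptyE; simp only:)
    then show "chi R ({a, b, c} - {v}) \<le> p" using chi_le_1[of "{a, b, c} - {v}" R] True by simp
  qed
next
  case False
  obtain X Y\<^sub>1 Y\<^sub>2 v\<^sub>1 v\<^sub>2 where bs: "blowup_sets p X Y\<^sub>1 Y\<^sub>2 v\<^sub>1 v\<^sub>2"
    and sub: "X \<union> Y\<^sub>1 \<union> Y\<^sub>2 \<union> {v\<^sub>1, v\<^sub>2} \<subseteq> S" and miss: "missing R S = blowup X Y\<^sub>1 Y\<^sub>2 v\<^sub>1 v\<^sub>2"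
    using extremal_blowup[OF ext False] by metis
  define Y where "Y = Y\<^sub>1 \<union> Y\<^sub>2"
  have finXY: "finite X" "finite Y" and cX: "card X + 1 = p" and cY: "card Y = p" and XY: "X \<inter> Y = {}"
    and v: "v\<^sub>1 \<notin> X \<union> Y" "v\<^sub>2 \<notin> X \<union> Y" "v\<^sub>1 \<noteq> v\<^sub>2"
    using bs by (auto simp: blowup_sets_def Y_def card_Un_disjoint)
  obtain y\<^sub>1 y\<^sub>2 where y12: "y\<^sub>1 \<in> Y\<^sub>1" "y\<^sub>2 \<in> Y\<^sub>2"
    using bs by (auto simp: blowup_sets_def)
  then have y: "y\<^sub>1 \<in> Y\<^sub>1" "y\<^sub>2 \<in> Y\<^sub>2" "y\<^sub>1 \<noteq> y\<^sub>2" "y\<^sub>1 \<in> Y" "y\<^sub>2 \<in> Y"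
    using bs by (auto simp: blowup_sets_def Y_def)
  define C where "C = X \<union> Y \<union> {v\<^sub>1, v\<^sub>2}"
  have notR: "(a, b) \<notin> R \<and> (b, a) \<notin> R" if "(a, b) \<in> blowup X Y\<^sub>1 Y\<^sub>2 v\<^sub>1 v\<^sub>2" for a b
    using that blowup_sym[OF that] unfolding miss[symmetric] by (simp add: missing_def)
  have chiXY: "chi R (A \<union> B) \<le> card B" if "A \<subseteq> X" "B \<subseteq> Y" "card A = card B" for A B
  proof (rule chi_matched[OF irr _ _ that(3)])
    show "finite A" "finite B" using that finXY by (auto intro: finite_subset)
    show "A \<inter> B = {}" using that XY by blast
    fix x y' assume "x \<in> A" "y' \<in> B"
    then have "(x, y') \<in> blowup X Y\<^sub>1 Y\<^sub>2 v\<^sub>1 v\<^sub>2" using that by (auto simp: blowup_def Y_def)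
    then show "(x, y') \<notin> R" using notR by blast
  qed
  have pair: "chi R {a, b} \<le> 1" if "(a, b) \<in> blowup X Y\<^sub>1 Y\<^sub>2 v\<^sub>1 v\<^sub>2" for a b
    using chi_le_1[of "{a, b}" R] acyclic_on_pair[OF irr, of a b] notR[OF that] by simp
  have e: "(y\<^sub>1, v\<^sub>2) \<in> blowup X Y\<^sub>1 Y\<^sub>2 v\<^sub>1 v\<^sub>2" "(y\<^sub>2, v\<^sub>1) \<in> blowup X Y\<^sub>1 Y\<^sub>2 v\<^sub>1 v\<^sub>2" "(v\<^sub>1, v\<^sub>2) \<in> blowup X Y\<^sub>1 Y\<^sub>2 v\<^sub>1 v\<^sub>2"
    using y by (auto simp: blowup_def)
  have Un: "chi R (A \<union> B) \<le> chi R A + chi R B" if "A \<subseteq> C" "B \<subseteq> C" for A B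
    using chi_Un[OF irr, of A B] that finXY finite_subset[of _ C] by (auto simp: C_def)
  show ?thesis
  proof (rule vertex_critical_core[OF irr fin cS p(2)])
    show "C \<subseteq> S" using sub by (auto simp: C_def Y_def)
    have "card C = card (X \<union> Y) + card {v\<^sub>1, v\<^sub>2}"
      unfolding C_def using finXY v by (intro card_Un_disjoint) auto
    then show "card C = 2 * p + 1" using finXY v XY cX cY by (simp add: card_Un_disjoint)
    show "missing R S \<subseteq> C \<times> C" unfolding miss by (auto simp: blowup_def C_def Y_def)
    fix A assume A: "A \<subseteq> C" "acyclic_on R A"
    show "card A \<le> 2"
    proof (rule ccontr)
      assume "\<not> card A \<le> 2"
      then obtain T where "T \<subseteq> A" "card T = 3" using obtain_subset_with_card_n[of 3 A] by auto
      then obtain a b c where abc: "a \<in> A" "b \<in> A" "c \<in> A" "a \<noteq> b" "b \<noteq> c" "a \<noteq> c"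
        by (auto simp: card_3_iff)
      have "(x, z) \<in> blowup X Y\<^sub>1 Y\<^sub>2 v\<^sub>1 v\<^sub>2" if xz: "x \<in> A" "z \<in> A" "x \<noteq> z" for x z
      proof -
        have "(x, z) \<notin> R \<or> (z, x) \<notin> R" using digon_not_acyclic_on[OF xz(1,2)] A(2) by blast
        then have "(x, z) \<in> missing R S \<or> (z, x) \<in> missing R S"
          using xz A(1) \<open>C \<subseteq> S\<close> by (auto simp: missing_def)
        then show ?thesis using blowup_sym unfolding miss by metis
      qed
      then show False using blowup_triangle_free[OF bs] abc by metis
    qed
  next
    fix v assume "v \<in> C"
    then consider "v \<in> X" | "v \<in> Y" | "v = v\<^sub>1" | "v = v\<^sub>2" by (auto simp: C_def)
    then show "chi R (C - {v}) \<le> p"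
    proof cases
      case 1
      have eq: "C - {v} = ((X - {v}) \<union> (Y - {y\<^sub>1, y\<^sub>2})) \<union> ({y\<^sub>1, v\<^sub>2} \<union> {y\<^sub>2, v\<^sub>1})"
        using 1 v XY y by (auto simp: C_def)
      moreover have "chi R (\<dots>) \<le> chi R ((X - {v}) \<union> (Y - {y\<^sub>1, y\<^sub>2})) + chi R ({y\<^sub>1, v\<^sub>2} \<union> {y\<^sub>2, v\<^sub>1})"
        by (rule Un) (use y in \<open>auto simp: C_def\<close>)
      moreover have "chi R ({y\<^sub>1, v\<^sub>2} \<union> {y\<^sub>2, v\<^sub>1}) \<le> chi R {y\<^sub>1, v\<^sub>2} + chi R {y\<^sub>2, v\<^sub>1}"
        by (rule Un) (use y in \<open>auto simp: C_def\<close>)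
      moreover have c2: "card (Y - {y\<^sub>1, y\<^sub>2}) + 2 = p"
      proof -
        have "card {y\<^sub>1, y\<^sub>2} \<le> card Y" using y finXY by (intro card_mono) auto
        then show ?thesis using y finXY cY by (simp add: card_Diff_subset)
      qed
      moreover have "chi R ((X - {v}) \<union> (Y - {y\<^sub>1, y\<^sub>2})) \<le> card (Y - {y\<^sub>1, y\<^sub>2})"
        by (rule chiXY) (use 1 finXY cX c2 in auto)
      ultimately show ?thesis unfolding eq using pair[OF e(1)] pair[OF e(2)] by linarith
    next
      case 2
      have eq: "C - {v} = (X \<union> (Y - {v})) \<union> {v\<^sub>1, v\<^sub>2}" using 2 v XY by (auto simp: C_def)
      moreover have "chi R (\<dots>) \<le> chi R (X \<union> (Y - {v})) + chi R {v\<^sub>1, v\<^sub>2}"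
        by (rule Un) (auto simp: C_def)
      moreover have "card (Y - {v}) + 1 = p" using 2 finXY cY p by simp
      moreover have "chi R (X \<union> (Y - {v})) \<le> card (Y - {v})"
        by (rule chiXY) (use 2 finXY cX cY in auto)
      ultimately show ?thesis unfolding eq using pair[OF e(3)] by linarith
    next
      case 3
      have eq: "C - {v} = (X \<union> (Y - {y\<^sub>1})) \<union> {y\<^sub>1, v\<^sub>2}" using 3 v y by (auto simp: C_def)
      moreover have "chi R (\<dots>) \<le> chi R (X \<union> (Y - {y\<^sub>1})) + chi R {y\<^sub>1, v\<^sub>2}"
        by (rule Un) (use y in \<open>auto simp: C_def\<close>)
      moreover have "card (Y - {y\<^sub>1}) + 1 = p" using y finXY cY p by simp
      moreover have "chi R (X \<union> (Y - {y\<^sub>1})) \<le> card (Y - {y\<^sub>1})"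
        by (rule chiXY) (use y finXY cX cY in auto)
      ultimately show ?thesis unfolding eq using pair[OF e(1)] by linarith
    next
      case 4
      have eq: "C - {v} = (X \<union> (Y - {y\<^sub>2})) \<union> {y\<^sub>2, v\<^sub>1}" using 4 v y by (auto simp: C_def)
      moreover have "chi R (\<dots>) \<le> chi R (X \<union> (Y - {y\<^sub>2})) + chi R {y\<^sub>2, v\<^sub>1}"
        by (rule Un) (use y in \<open>auto simp: C_def\<close>)
      moreover have "card (Y - {y\<^sub>2}) + 1 = p" using y finXY cY p by simp
      moreover have "chi R (X \<union> (Y - {y\<^sub>2})) \<le> card (Y - {y\<^sub>2})"
        by (rule chiXY) (use y finXY cX cY in auto)
      ultimately show ?thesis unfolding eq using pair[OF e(2)] by linarith
    qed
  qed
qed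

subsection \<open>Critical digraphs\<close>

lemma acyclic_digraph_iff:
  assumes "wf_digraph G"
  shows "acyclic_digraph G \<longleftrightarrow> acyclic (arcs_ends G)"
proof -
  interpret wf_digraph G by (rule assms)
  have "(\<exists>c. cycle c) \<longleftrightarrow> (\<exists>u. u \<rightarrow>\<^sup>+\<^bsub>G\<^esub> u)"
  proof
    assume "\<exists>c. cycle c"
    then show "\<exists>u. u \<rightarrow>\<^sup>+\<^bsub>G\<^esub> u" unfolding cycle_def reachable1_awalk by blast
  next
    assume "\<exists>u. u \<rightarrow>\<^sup>+\<^bsub>G\<^esub> u"
    then have "\<exists>p. closed_w p" unfolding reachable1_awalk closed_w_def by blast
    then show "\<exists>c. cycle c" using closed_w_imp_cycle by blast
  qed
  then show ?thesis unfolding acyclic_digraph_def acyclic_def by simp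
qed

lemma acyclic_digraph_induced_iff:
  fixes G :: "('a, 'a \<times> 'a) pre_digraph"
  assumes "tail G = fst" "head G = snd"
  shows "acyclic_digraph (G \<restriction> A) \<longleftrightarrow> acyclic_on (arcs G) A"
proof -
  have "wf_digraph (G \<restriction> A)" by unfold_locales (auto simp: induce_subgraph_def)
  moreover have "arcs_ends (G \<restriction> A) = Restr (arcs G) A"
    unfolding arcs_ends_conv by (auto simp: induce_subgraph_def assms image_iff)
  ultimately show ?thesis by (simp add: acyclic_digraph_iff)
qed

lemma dichromatic_number_eq_chi:
  fixes G :: "('a, 'a \<times> 'a) pre_digraph"
  assumes "tail G = fst" "head G = snd" "finite (verts G)" "irrefl (arcs G)"
  shows "dichromatic_number G = chi (arcs G) (verts G)"
proof -
  have "(\<exists>f. acyclic_coloring G k f) \<longleftrightarrow> chi (arcs G) (verts G) \<le> k" for k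
  proof
    assume "\<exists>f. acyclic_coloring G k f"
    then obtain f where f: "f ` verts G \<subseteq> {1..k}"
      "\<And>i. i \<in> {1..k} \<Longrightarrow> acyclic_on (arcs G) {v \<in> verts G. f v = i}"
      by (auto simp: acyclic_coloring_def acyclic_digraph_induced_iff[OF assms(1,2)])
    have "colouring (arcs G) (verts G) f" unfolding colouring_def
    proof
      fix i
      show "acyclic_on (arcs G) {v \<in> verts G. f v = i}"
      proof (cases "i \<in> {1..k}")
        case False
        then have "{v \<in> verts G. f v = i} = {}" using f(1) by auto
        then show ?thesis using acyclic_on_empty(2) by metis
      qed (rule f(2))
    qed
    then have "chi (arcs G) (verts G) \<le> card (f ` verts G)" using chi_le assms(3) by blast
    also have "\<dots> \<le> card {1..k}" using f(1) by (intro card_mono) auto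
    finally show "chi (arcs G) (verts G) \<le> k" by simp
  next
    assume le: "chi (arcs G) (verts G) \<le> k"
    obtain c :: "'a \<Rightarrow> nat" where c: "colouring (arcs G) (verts G) c"
      "card (c ` verts G) = chi (arcs G) (verts G)"
      using chi_attained assms(3,4) by metis
    obtain h where h: "bij_betw h (c ` verts G) {1..card (c ` verts G)}"
      using assms(3) ex_bij_betw_nat_finite_1[of "c ` verts G"] bij_betw_inv by blast
    have "acyclic_coloring G k (h \<circ> c)"
      unfolding acyclic_coloring_def acyclic_digraph_induced_iff[OF assms(1,2)]
    proof (intro conjI ballI)
      show "(h \<circ> c) ` verts G \<subseteq> {1..k}"
        unfolding image_comp[symmetric] bij_betw_imp_surj_on[OF h] using le c(2) by auto
      fix i
      show "acyclic_on (arcs G) {v \<in> verts G. (h \<circ> c) v = i}"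
      proof (cases "\<exists>w\<in>verts G. h (c w) = i")
        case True
        then obtain w where w: "w \<in> verts G" "h (c w) = i" by blast
        have "\<forall>v\<in>{v \<in> verts G. (h \<circ> c) v = i}. c v = c w"
          using w inj_onD[OF bij_betw_imp_inj_on[OF h]] by auto
        then show ?thesis by (intro colouringD[OF c(1)]) auto
      next
        case False
        then have "{v \<in> verts G. (h \<circ> c) v = i} = {}" by auto
        then show ?thesis using acyclic_on_empty(2) by metis
      qed
    qed
    then show "\<exists>f. acyclic_coloring G k f" by blast
  qed
  then show ?thesis unfolding dichromatic_number_def by (simp add: Least_equality)
qed

lemma chi_cong:
  assumes "\<And>u v. u \<in> S \<Longrightarrow> v \<in> S \<Longrightarrow> (u, v) \<in> R \<longleftrightarrow> (u, v) \<in> R'"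
  shows "chi R S = chi R' S"
proof -
  have "Restr R {v \<in> S. c v = i} = Restr R' {v \<in> S. c v = i}" for c :: "'a \<Rightarrow> nat" and i
    using assms by auto
  then show ?thesis unfolding chi_def colouring_def by simp
qed

lemma pair_digraph_facts:
  assumes "pair_digraph D"
  shows "finite (pverts D)" "irrefl (parcs D)" "parcs D \<subseteq> pverts D \<times> pverts D"
    "wf_digraph (with_proj D)"
proof -
  interpret pair_digraph D by (rule assms)
  show "finite (pverts D)" by (rule pair_finite_verts)
  show "irrefl (parcs D)" using pair_no_loops by (fastforce simp: irrefl_def)
  show "parcs D \<subseteq> pverts D \<times> pverts D" using in_arcsD1 in_arcsD2 by auto
  show "wf_digraph (with_proj D)" by unfold_locales
qed

lemma pair_digraphI:
  assumes "finite (pverts D)" "irrefl (parcs D)" "parcs D \<subseteq> pverts D \<times> pverts D"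
  shows "pair_digraph D"
proof
  show "finite (parcs D)" using assms by (meson finite_SigmaI finite_subset)
qed (use assms in \<open>auto simp: irrefl_def\<close>)

lemma critical_imp_vertex_critical:
  assumes D: "pair_digraph D" and crit: "critical k (with_proj D)"
  shows "vertex_critical (parcs D) k (pverts D)"
  unfolding vertex_critical_def
proof (intro conjI ballI)
  note D = pair_digraph_facts[OF D]
  show "finite (pverts D)" by (rule D)
  show "chi (parcs D) (pverts D) = k"
    using crit dichromatic_number_eq_chi[of "with_proj D"] D by (simp add: critical_def)
  fix v assume v: "v \<in> pverts D"
  define D' where "D' = with_proj D \<restriction> (pverts D - {v})"
  have D': "verts D' = pverts D - {v}" "arcs D' = Restr (parcs D) (pverts D - {v})"
    "tail D' = fst" "head D' = snd"
    by (auto simp: D'_def induce_subgraph_def)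
  have "wf_digraph D'" unfolding D'_def by unfold_locales (auto simp: induce_subgraph_def)
  then have "subgraph D' (with_proj D)"
    unfolding subgraph_def compatible_def using D(4) by (simp add: D' Int_lower1 Diff_subset)
  moreover have "D' \<noteq> with_proj D"
  proof
    assume "D' = with_proj D"
    then have "pverts D - {v} = pverts D" using D'(1) by simp
    then show False using v by blast
  qed
  ultimately have "dichromatic_number D' < k" using crit unfolding critical_def by blast
  moreover have "irrefl (arcs D')" using D(2) unfolding D' irrefl_def by simp
  then have "dichromatic_number D' = chi (arcs D') (verts D')"
    using dichromatic_number_eq_chi[of D'] D' D(1) by simp
  moreover have "chi (arcs D') (verts D') = chi (parcs D) (pverts D - {v})"
    unfolding D' by (rule chi_cong) auto
  ultimately show "chi (parcs D) (pverts D - {v}) < k" by simp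
qed

text \<open>Deleting an arc would exceed the maximal number of missing arcs, so only the deletion of
  vertices has to be considered.\<close>

lemma vertex_critical_imp_critical:
  assumes D: "pair_digraph D" and crit: "vertex_critical (parcs D) k (pverts D)"
    and card: "card (pverts D) = k + p" and max: "card (missing (parcs D) (pverts D)) = missing_bound p"
  shows "critical k (with_proj D)"
  unfolding critical_def
proof (intro conjI allI impI)
  note D = pair_digraph_facts[OF D]
  have fin: "finite (pverts D)" and chi: "chi (parcs D) (pverts D) = k"
    and less: "\<And>v. v \<in> pverts D \<Longrightarrow> chi (parcs D) (pverts D - {v}) < k"
    using crit by (auto simp: vertex_critical_def)
  show "dichromatic_number (with_proj D) = k"
    using dichromatic_number_eq_chi[of "with_proj D"] D chi by simp
  fix D' assume "subgraph D' (with_proj D) \<and> D' \<noteq> with_proj D"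
  then have sub: "verts D' \<subseteq> pverts D" "arcs D' \<subseteq> parcs D" "tail D' = fst" "head D' = snd"
    and neq: "D' \<noteq> with_proj D"
    by (auto simp: subgraph_def compatible_def)
  have irr: "irrefl (arcs D')" using sub(2) D(2) by (auto simp: irrefl_def)
  have finD': "finite (verts D')" using sub(1) fin finite_subset by blast
  have eq: "dichromatic_number D' = chi (arcs D') (verts D')"
    using dichromatic_number_eq_chi[OF sub(3,4) finD' irr] .
  show "dichromatic_number D' < k"
  proof (cases "verts D' = pverts D")
    case False
    then obtain v where v: "v \<in> pverts D" "v \<notin> verts D'" using sub(1) by blast
    have "chi (arcs D') (verts D') \<le> chi (parcs D) (pverts D - {v})"
      using v sub(1,2) fin D(2) by (intro chi_mono) auto
    then show ?thesis using less[OF v(1)] eq by simp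
  next
    case True
    have "arcs D' \<noteq> parcs D"
    proof
      assume "arcs D' = parcs D"
      then have "D' = with_proj D" using True sub(3,4) by (intro pre_digraph.equality) auto
      then show False using neq by simp
    qed
    then obtain a b where ab: "(a, b) \<in> parcs D" "(a, b) \<notin> arcs D'" using sub(2) by auto
    show ?thesis
    proof (rule ccontr)
      assume "\<not> ?thesis"
      then have ge: "k \<le> chi (arcs D') (pverts D)" using eq True by simp
      have "chi (arcs D') (pverts D) \<le> k"
        unfolding chi[symmetric] using fin D(2) sub(2) by (intro chi_mono) auto
      moreover have "chi (arcs D') (pverts D - {v}) < k" if "v \<in> pverts D" for v
      proof -
        have "chi (arcs D') (pverts D - {v}) \<le> chi (parcs D) (pverts D - {v})"
          using fin D(2) sub(2) by (intro chi_mono) auto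
        then show ?thesis using less[OF that] by simp
      qed
      ultimately have "vertex_critical (arcs D') k (pverts D)"
        using ge fin by (simp add: vertex_critical_def)
      from card_missing_le_bound[OF irr this card]
      have "card (missing (arcs D') (pverts D)) \<le> missing_bound p" by blast
      moreover have "missing (parcs D) (pverts D) \<subset> missing (arcs D') (pverts D)"
      proof
        show "missing (parcs D) (pverts D) \<subseteq> missing (arcs D') (pverts D)"
          using sub(2) by (auto simp: missing_def)
        have "a \<in> pverts D" "b \<in> pverts D" "a \<noteq> b" using ab(1) D(2,3) by (auto simp: irrefl_def)
        then have "(a, b) \<in> missing (arcs D') (pverts D)" "(a, b) \<notin> missing (parcs D) (pverts D)"
          using ab by (simp_all add: missing_def)
        then show "missing (parcs D) (pverts D) \<noteq> missing (arcs D') (pverts D)" by blast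
      qed
      then have "card (missing (parcs D) (pverts D)) < card (missing (arcs D') (pverts D))"
        by (rule psubset_card_mono[OF finite_missing[OF fin]])
      ultimately show False using max by simp
    qed
  qed
qed

lemma card_arcs_add_missing:
  assumes "pair_digraph D"
  shows "card (parcs D) + card (missing (parcs D) (pverts D)) = 2 * (card (pverts D) choose 2)"
proof -
  note D = pair_digraph_facts[OF assms]
  let ?n = "card (pverts D)"
  have fin: "finite (parcs D)" using D(1,3) by (meson finite_SigmaI finite_subset)
  have "parcs D \<union> missing (parcs D) (pverts D) = (SIGMA v:pverts D. pverts D - {v})"
    using D(2,3) by (auto simp: missing_def irrefl_def)
  moreover have "card (SIGMA v:pverts D. pverts D - {v}) = ?n * (?n - 1)"
    using D(1) by simp
  moreover have "parcs D \<inter> missing (parcs D) (pverts D) = {}" by (auto simp: missing_def)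
  ultimately have "card (parcs D) + card (missing (parcs D) (pverts D)) = ?n * (?n - 1)"
    using fin finite_missing[OF D(1)] by (metis card_Un_disjoint)
  moreover have "even (?n * (?n - 1))" by (cases ?n) auto
  ultimately show ?thesis by (simp add: choose_two)
qed

lemma CRI_extremal_iff:
  fixes D :: "'a pair_pre_digraph"
  assumes "1 \<le> p" "p + 1 \<le> k"
  shows "D \<in> CRI k (k + p) \<and> card (missing (parcs D) (pverts D)) = missing_bound p \<longleftrightarrow>
    pair_digraph D \<and> card (pverts D) = k + p \<and> extremal p (parcs D) (pverts D)"
    (is "?L \<longleftrightarrow> ?R")
proof
  assume ?L
  then have D: "pair_digraph D" "critical k (with_proj D)" "card (pverts D) = k + p"
    and max: "card (missing (parcs D) (pverts D)) = missing_bound p" by (auto simp: CRI_def)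
  then show ?R
    using card_missing_le_bound[OF pair_digraph_facts(2)[OF D(1)] critical_imp_vertex_critical[OF D(1,2)] D(3)]
      assms(1) by blast
next
  assume R: ?R
  then have D: "pair_digraph D" "card (pverts D) = k + p" "extremal p (parcs D) (pverts D)" by auto
  have max: "card (missing (parcs D) (pverts D)) = missing_bound p"
    by (rule extremal_card_missing[OF D(3) assms(1)])
  have "vertex_critical (parcs D) k (pverts D)"
    using extremal_vertex_critical[OF pair_digraph_facts(2,1)[OF D(1)] D(2) assms D(3)] .
  then show ?L using vertex_critical_imp_critical[OF D(1) _ D(2) max] D max by (simp add: CRI_def)
qed

lemma ex_extremal_nat:
  assumes "1 \<le> p" "p + 1 \<le> k"
  shows "\<exists>D :: nat pair_pre_digraph. pair_digraph D \<and> card (pverts D) = k + p \<and>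
    extremal p (parcs D) (pverts D)"
proof -
  define X Y\<^sub>2 where "X = {..<p - 1}" and "Y\<^sub>2 = {p..<2 * p - 1}"
  define B where "B = (if p = 1 then {(1, 0), (2, 1), (0, 2)} else blowup X {p - 1} Y\<^sub>2 (2 * p - 1) (2 * p))"
  define D where "D = \<lparr> pverts = {..<k + p}, parcs = {(u, v). u < k + p \<and> v < k + p \<and> u \<noteq> v \<and> (u, v) \<notin> B} \<rparr>"
  have "pair_digraph D" by (rule pair_digraphI) (auto simp: D_def irrefl_def)
  moreover have "card (pverts D) = k + p" by (simp add: D_def)
  moreover have "extremal p (parcs D) (pverts D)"
  proof (cases "p = 1")
    case True
    have "missing (parcs D) (pverts D) = {(1, 0), (2, 1), (0, 2)}"
      using assms by (auto simp: missing_def D_def B_def True)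
    moreover have "{0, 1, 2} \<subseteq> pverts D" using assms by (auto simp: D_def)
    ultimately show ?thesis unfolding extremal_def if_P[OF True]
      by (intro exI[of _ "0::nat"] exI[of _ "1::nat"] exI[of _ "2::nat"]) simp
  next
    case False
    then have p2: "2 \<le> p" using assms by simp
    have "0 \<in> X" using p2 by (simp add: X_def)
    then have "X \<noteq> {}" by blast
    then have "blowup_sets p X {p - 1} Y\<^sub>2 (2 * p - 1) (2 * p)"
      using p2 by (auto simp: blowup_sets_def X_def Y\<^sub>2_def)
    moreover have sub: "X \<union> {p - 1} \<union> Y\<^sub>2 \<union> {2 * p - 1, 2 * p} \<subseteq> pverts D"
      using p2 assms by (auto simp: X_def Y\<^sub>2_def D_def)
    moreover have "missing (parcs D) (pverts D) = blowup X {p - 1} Y\<^sub>2 (2 * p - 1) (2 * p)"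
    proof -
      have "B = blowup X {p - 1} Y\<^sub>2 (2 * p - 1) (2 * p)" using False by (simp add: B_def)
      moreover have "u < k + p \<and> v < k + p \<and> u \<noteq> v" if "(u, v) \<in> B" for u v
      proof -
        have "(u \<in> X \<union> {p - 1} \<union> Y\<^sub>2 \<union> {2 * p - 1, 2 * p} \<and> v \<in> X \<union> {p - 1} \<union> Y\<^sub>2 \<union> {2 * p - 1, 2 * p}) \<and> u \<noteq> v"
          using that False p2 by (auto simp: B_def blowup_def X_def Y\<^sub>2_def)
        then show ?thesis using sub by (auto simp: D_def)
      qed
      ultimately show ?thesis by (auto simp: missing_def D_def)
    qed
    ultimately show ?thesis using extremal_blowupI[OF _ False] by metis
  qed
  ultimately show ?thesis by blast
qed

lemma ext_add_missing_bound:
  assumes "1 \<le> p" "p + 1 \<le> k"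
  shows "ext k (k + p) + missing_bound p = 2 * ((k + p) choose 2)"
proof -
  obtain D :: "nat pair_pre_digraph" where D: "pair_digraph D" "card (pverts D) = k + p"
    "extremal p (parcs D) (pverts D)"
    using ex_extremal_nat[OF assms] by blast
  then have DC: "D \<in> CRI k (k + p)" and Dm: "card (missing (parcs D) (pverts D)) = missing_bound p"
    using CRI_extremal_iff[OF assms, of D] by auto
  have "card (parcs D) \<le> card (parcs D')" if "D' \<in> CRI k (k + p)" for D' :: "nat pair_pre_digraph"
  proof -
    have D': "pair_digraph D'" "critical k (with_proj D')" "card (pverts D') = k + p"
      using that by (auto simp: CRI_def)
    have "card (missing (parcs D') (pverts D')) \<le> missing_bound p"
      using card_missing_le_bound[OF pair_digraph_facts(2)[OF D'(1)] critical_imp_vertex_critical[OF D'(1,2)] D'(3)]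
      by blast
    then show ?thesis using card_arcs_add_missing[OF D'(1)] card_arcs_add_missing[OF D(1)] D(2) D'(3) Dm by simp
  qed
  then have "ext k (k + p) = card (parcs D)"
    unfolding ext_def using DC by (intro cInf_eq_minimum) auto
  then show ?thesis using card_arcs_add_missing[OF D(1)] D(2) Dm by simp
qed

lemma EXT_iff:
  fixes D :: "'a pair_pre_digraph"
  assumes "1 \<le> p" "p + 1 \<le> k"
  shows "D \<in> EXT k (k + p) \<longleftrightarrow>
    pair_digraph D \<and> card (pverts D) = k + p \<and> extremal p (parcs D) (pverts D)"
proof -
  have "card (parcs D) = ext k (k + p) \<longleftrightarrow> card (missing (parcs D) (pverts D)) = missing_bound p"
    if "D \<in> CRI k (k + p)"
    using card_arcs_add_missing[of D] ext_add_missing_bound[OF assms] that by (auto simp: CRI_def)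
  then show ?thesis using CRI_extremal_iff[OF assms, of D] by (auto simp: EXT_def)
qed

subsection \<open>Isomorphism with the Dirac joins\<close>

definition map_digraph :: "('a \<Rightarrow> 'b) \<Rightarrow> 'a pair_pre_digraph \<Rightarrow> 'b pair_pre_digraph" where
  "map_digraph g D = \<lparr> pverts = g ` pverts D, parcs = map_prod g g ` parcs D \<rparr>"

lemma digraph_iso_map_digraph:
  assumes "wf_digraph (with_proj D)" "inj_on g (pverts D)"
  shows "digraph_iso (with_proj D) (with_proj (map_digraph g D))"
proof -
  let ?h = "\<lparr> iso_verts = g, iso_arcs = map_prod g g, iso_head = snd, iso_tail = fst \<rparr>"
  have "parcs D \<subseteq> pverts D \<times> pverts D"
    using wf_digraph.head_in_verts[OF assms(1)] wf_digraph.tail_in_verts[OF assms(1)] by fastforce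
  then have "inj_on (map_prod g g) (parcs D)"
    using map_prod_inj_on[OF assms(2,2)] inj_on_subset by blast
  then have "pre_digraph.digraph_isomorphism (with_proj D) ?h"
    unfolding pre_digraph.digraph_isomorphism_def using assms by simp
  moreover have "with_proj (map_digraph g D) = app_iso ?h (with_proj D)"
    by (simp add: with_proj_def map_digraph_def app_iso_def)
  ultimately show ?thesis unfolding digraph_iso_def by blast
qed

lemma digraph_isoD:
  assumes "digraph_iso (with_proj D) (with_proj D')"
  obtains g where "wf_digraph (with_proj D)" "inj_on g (pverts D)" "D' = map_digraph g D"
proof -
  obtain h where h: "pre_digraph.digraph_isomorphism (with_proj D) h"
    and eq: "with_proj D' = app_iso h (with_proj D)"
    using assms unfolding digraph_iso_def by blast
  have "verts (with_proj D') = iso_verts h ` pverts D" "arcs (with_proj D') = iso_arcs h ` parcs D"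
    "tail (with_proj D') = iso_tail h" "head (with_proj D') = iso_head h"
    unfolding eq by simp_all
  then have D': "pverts D' = iso_verts h ` pverts D" "parcs D' = iso_arcs h ` parcs D"
    "iso_tail h = fst" "iso_head h = snd" by simp_all
  have wf: "wf_digraph (with_proj D)" and inj: "inj_on (iso_verts h) (pverts D)"
    and comm: "\<And>a. a \<in> parcs D \<Longrightarrow> iso_verts h (fst a) = fst (iso_arcs h a) \<and> iso_verts h (snd a) = snd (iso_arcs h a)"
    using h D'(3,4) unfolding pre_digraph.digraph_isomorphism_def by auto
  have "iso_arcs h a = map_prod (iso_verts h) (iso_verts h) a" if "a \<in> parcs D" for a
    using comm[OF that] by (simp add: map_prod_def split_beta prod_eq_iff)
  then have "parcs D' = map_prod (iso_verts h) (iso_verts h) ` parcs D"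
    unfolding D'(2) by (rule image_cong[OF refl])
  then have "D' = map_digraph (iso_verts h) D"
    using D'(1) by (simp add: map_digraph_def)
  then show ?thesis using that wf inj by blast
qed

lemma map_prod_image_Times: "map_prod g h ` (A \<times> B) = g ` A \<times> h ` B"
  by auto

lemma map_prod_image_converse: "map_prod g g ` (B\<inverse>) = (map_prod g g ` B)\<inverse>"
  by force

lemma blowup_image:
  "map_prod g g ` blowup X Y\<^sub>1 Y\<^sub>2 v\<^sub>1 v\<^sub>2 = blowup (g ` X) (g ` Y\<^sub>1) (g ` Y\<^sub>2) (g v\<^sub>1) (g v\<^sub>2)"
  unfolding blowup_def Let_def image_Un map_prod_image_converse map_prod_image_Times by simp

lemma blowup_sets_image:
  assumes "blowup_sets p X Y\<^sub>1 Y\<^sub>2 v\<^sub>1 v\<^sub>2" "inj_on g (X \<union> Y\<^sub>1 \<union> Y\<^sub>2 \<union> {v\<^sub>1, v\<^sub>2})"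
  shows "blowup_sets p (g ` X) (g ` Y\<^sub>1) (g ` Y\<^sub>2) (g v\<^sub>1) (g v\<^sub>2)"
proof -
  define V where "V = X \<union> Y\<^sub>1 \<union> Y\<^sub>2 \<union> {v\<^sub>1, v\<^sub>2}"
  have inj: "inj_on g V" using assms(2) by (simp add: V_def)
  have sub: "X \<subseteq> V" "Y\<^sub>1 \<subseteq> V" "Y\<^sub>2 \<subseteq> V" "v\<^sub>1 \<in> V" "v\<^sub>2 \<in> V" by (auto simp: V_def)
  have card: "card (g ` A) = card A" if "A \<subseteq> V" for A
    using card_image inj_on_subset[OF inj that] by blast
  have disj: "g ` A \<inter> g ` B = {}" if "A \<subseteq> V" "B \<subseteq> V" "A \<inter> B = {}" for A B
    using inj_on_image_Int[OF inj that(1,2)] that(3) by simp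
  have mem: "g v \<in> g ` A \<longleftrightarrow> v \<in> A" if "v \<in> V" "A \<subseteq> V" for v A
    using inj_on_image_mem_iff[OF inj that] .
  have neq: "g v\<^sub>1 \<noteq> g v\<^sub>2" if "v\<^sub>1 \<noteq> v\<^sub>2" using inj_onD[OF inj _ sub(4,5)] that by blast
  show ?thesis
    using assms(1) sub unfolding blowup_sets_def by (simp add: card disj mem neq)
qed

lemma blowup_sets_card:
  assumes "blowup_sets p X Y\<^sub>1 Y\<^sub>2 v\<^sub>1 v\<^sub>2"
  shows "card (X \<union> Y\<^sub>1 \<union> Y\<^sub>2 \<union> {v\<^sub>1, v\<^sub>2}) = 2 * p + 1"
proof -
  have "card (X \<union> Y\<^sub>1 \<union> Y\<^sub>2 \<union> {v\<^sub>1, v\<^sub>2}) = card X + card Y\<^sub>1 + card Y\<^sub>2 + 2"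
    using assms by (simp add: blowup_sets_def card_Un_disjoint Int_Un_distrib2)
  then show ?thesis using assms by (simp add: blowup_sets_def)
qed

lemma extremal_map:
  assumes "extremal p E V" "inj_on g V" "g ` V \<subseteq> V'" "missing E' V' = map_prod g g ` missing E V"
  shows "extremal p E' V'"
proof (cases "p = 1")
  case True
  then obtain a b c where abc: "{a, b, c} \<subseteq> V" "a \<noteq> b" "b \<noteq> c" "c \<noteq> a"
    "missing E V = {(b, a), (c, b), (a, c)}"
    using assms(1) by (auto simp: extremal_def)
  have "{g a, g b, g c} \<subseteq> V'" using abc(1) assms(3) by auto
  moreover have "g a \<noteq> g b" "g b \<noteq> g c" "g c \<noteq> g a" using abc inj_on_eq_iff[OF assms(2), of a b]
    inj_on_eq_iff[OF assms(2), of b c] inj_on_eq_iff[OF assms(2), of c a] by auto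
  moreover have "missing E' V' = {(g b, g a), (g c, g b), (g a, g c)}" using assms(4) abc(5) by simp
  ultimately show ?thesis unfolding extremal_def if_P[OF True] by blast
next
  case False
  obtain X Y\<^sub>1 Y\<^sub>2 v\<^sub>1 v\<^sub>2 where bs: "blowup_sets p X Y\<^sub>1 Y\<^sub>2 v\<^sub>1 v\<^sub>2"
    and sub: "X \<union> Y\<^sub>1 \<union> Y\<^sub>2 \<union> {v\<^sub>1, v\<^sub>2} \<subseteq> V" and miss: "missing E V = blowup X Y\<^sub>1 Y\<^sub>2 v\<^sub>1 v\<^sub>2"
    using extremal_blowup[OF assms(1) False] by metis
  show ?thesis
  proof (rule extremal_blowupI[OF _ False])
    show "blowup_sets p (g ` X) (g ` Y\<^sub>1) (g ` Y\<^sub>2) (g v\<^sub>1) (g v\<^sub>2)"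
      by (rule blowup_sets_image[OF bs inj_on_subset[OF assms(2) sub]])
    show "g ` X \<union> g ` Y\<^sub>1 \<union> g ` Y\<^sub>2 \<union> {g v\<^sub>1, g v\<^sub>2} \<subseteq> V'" using sub assms(3) by blast
    show "missing E' V' = blowup (g ` X) (g ` Y\<^sub>1) (g ` Y\<^sub>2) (g v\<^sub>1) (g v\<^sub>2)"
      unfolding assms(4) miss by (rule blowup_image)
  qed
qed

lemma missing_map:
  assumes "inj_on g V" "E \<subseteq> V \<times> V"
  shows "missing (map_prod g g ` E) (g ` V) = map_prod g g ` missing E V"
proof -
  have mem: "(g u, g v) \<in> map_prod g g ` E \<longleftrightarrow> (u, v) \<in> E" if "u \<in> V" "v \<in> V" for u v
    using inj_on_image_mem_iff[OF map_prod_inj_on[OF assms(1,1)], of "(u, v)" E] that assms(2) by simp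
  have neq: "g u = g v \<longleftrightarrow> u = v" if "u \<in> V" "v \<in> V" for u v
    using inj_on_eq_iff[OF assms(1) that] .
  show ?thesis
  proof (intro equalityI subrelI)
    fix a b assume "(a, b) \<in> missing (map_prod g g ` E) (g ` V)"
    then obtain u v where uv: "u \<in> V" "v \<in> V" "a = g u" "b = g v" "g u \<noteq> g v" "(g u, g v) \<notin> map_prod g g ` E"
      unfolding missing_def by blast
    then have "(u, v) \<in> missing E V" using mem[OF uv(1,2)] unfolding missing_def by blast
    then show "(a, b) \<in> map_prod g g ` missing E V" using uv by force
  next
    fix a b assume "(a, b) \<in> map_prod g g ` missing E V"
    then obtain u v where uv: "a = g u" "b = g v" "u \<in> V" "v \<in> V" "u \<noteq> v" "(u, v) \<notin> E"
      by (auto simp: missing_def)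
    then show "(a, b) \<in> missing (map_prod g g ` E) (g ` V)"
      using mem[OF uv(3,4)] neq[OF uv(3,4)] by (simp add: missing_def)
  qed
qed

lemma parcs_complete_graph: "parcs (bidirected (complete_graph m)) = {(u, v). u < m \<and> v < m \<and> u \<noteq> v}"
  by (auto simp: bidirected_def complete_graph_def card_insert_if)

lemma pverts_complete_graph: "pverts (bidirected (complete_graph m)) = {..<m}"
  by (simp add: bidirected_def complete_graph_def)

lemma missing_dirac_join_complete:
  "missing (parcs (bidirected (complete_graph m) \<boxplus> D)) (pverts (bidirected (complete_graph m) \<boxplus> D)) =
    map_prod Inr Inr ` missing (parcs D) (pverts D)"
proof -
  have mem: "(Inr x, Inr y) \<in> map_prod Inr Inr ` E \<longleftrightarrow> (x, y) \<in> E" for x y and E :: "'a rel"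
    by force
  have mem': "(Inl x, Inl y) \<in> map_prod Inl Inl ` E \<longleftrightarrow> (x, y) \<in> E" for x y and E :: "nat rel"
    by force
  let ?J = "bidirected (complete_graph m) \<boxplus> D"
  have "(a, b) \<in> missing (parcs ?J) (pverts ?J) \<longleftrightarrow> (a, b) \<in> map_prod Inr Inr ` missing (parcs D) (pverts D)" for a b
  proof (cases a; cases b)
    fix x y assume "a = Inr x" "b = Inr y"
    moreover have "(Inr x, Inr y) \<notin> map_prod Inl Inl ` E" for E :: "nat rel" by force
    ultimately show ?thesis
      by (simp add: mem) (auto simp: missing_def dirac_join_def mem)
  next
    fix x y assume ab: "a = Inl x" "b = Inl y"
    moreover have "(Inl x, Inl y) \<notin> map_prod Inr Inr ` E" for E :: "'a rel" by force
    ultimately show ?thesis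
      by (auto simp: missing_def dirac_join_def mem' pverts_complete_graph parcs_complete_graph)
  qed (auto simp: missing_def dirac_join_def)
  then show ?thesis by auto
qed

lemma digraph_DG_extremal:
  assumes "D \<in> digraph_DG (p + 1)" "1 \<le> p"
  shows "extremal p (parcs D) (pverts D)" "card (pverts D) = 2 * p + 1" "finite (pverts D)"
    "irrefl (parcs D)" "parcs D \<subseteq> pverts D \<times> pverts D"
proof -
  have "extremal p (parcs D) (pverts D) \<and> card (pverts D) = 2 * p + 1 \<and> finite (pverts D) \<and>
    irrefl (parcs D) \<and> parcs D \<subseteq> pverts D \<times> pverts D"
  proof (cases "p = 1")
    case True
    then have D: "D = directed_cycle 3" using assms(1) by (simp add: digraph_DG_def)
    have V: "pverts D = {0, 1, 2}" by (auto simp: D directed_cycle_def)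
    have "{..<3} = {0, 1, 2::nat}" by auto
    then have E: "parcs D = {(0, 1), (1, 2), (2, 0)}" by (simp add: D directed_cycle_def numeral_2_eq_2)
    have "missing (parcs D) (pverts D) = {(1, 0), (2, 1), (0, 2)}"
      unfolding V E by (auto simp: missing_def)
    then have "extremal p (parcs D) (pverts D)" unfolding extremal_def if_P[OF True] V
      by (intro exI[of _ "0::nat"] exI[of _ "1::nat"] exI[of _ "2::nat"]) simp
    then show ?thesis using True by (auto simp: V E irrefl_def)
  next
    case False
    then obtain G where G: "G \<in> DG (p + 1)" "D = bidirected G"
      using assms by (auto simp: digraph_DG_def)
    have simple: "simple_graph G" using G(1) by (simp add: DG_def)
    obtain X Y\<^sub>1 Y\<^sub>2 v\<^sub>1 v\<^sub>2 where *: "uverts G = X \<union> Y\<^sub>1 \<union> Y\<^sub>2 \<union> {v\<^sub>1, v\<^sub>2} \<and>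
        X \<noteq> {} \<and> Y\<^sub>1 \<noteq> {} \<and> Y\<^sub>2 \<noteq> {} \<and>
        X \<inter> Y\<^sub>1 = {} \<and> X \<inter> Y\<^sub>2 = {} \<and> Y\<^sub>1 \<inter> Y\<^sub>2 = {} \<and>
        v\<^sub>1 \<notin> X \<union> Y\<^sub>1 \<union> Y\<^sub>2 \<and> v\<^sub>2 \<notin> X \<union> Y\<^sub>1 \<union> Y\<^sub>2 \<and> v\<^sub>1 \<noteq> v\<^sub>2 \<and>
        card Y\<^sub>1 + card Y\<^sub>2 = card X + 1 \<and> card X + 1 = (p + 1) - 1 \<and>
        induces_complete G X \<and> induces_complete G (Y\<^sub>1 \<union> Y\<^sub>2) \<and>
        (\<forall>x\<in>X. \<forall>y\<in>Y\<^sub>1 \<union> Y\<^sub>2. {x, y} \<notin> uedges G) \<and>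
        neighborhood G v\<^sub>1 = X \<union> Y\<^sub>1 \<and> neighborhood G v\<^sub>2 = X \<union> Y\<^sub>2"
      using G(1) unfolding DG_def mem_Collect_eq by (elim conjE exE) (rule that, intro conjI)
    have V: "uverts G = X \<union> Y\<^sub>1 \<union> Y\<^sub>2 \<union> {v\<^sub>1, v\<^sub>2}"
      and ne: "X \<noteq> {}" "Y\<^sub>1 \<noteq> {}" "Y\<^sub>2 \<noteq> {}"
      and disj: "X \<inter> Y\<^sub>1 = {}" "X \<inter> Y\<^sub>2 = {}" "Y\<^sub>1 \<inter> Y\<^sub>2 = {}"
      and v: "v\<^sub>1 \<notin> X \<union> Y\<^sub>1 \<union> Y\<^sub>2" "v\<^sub>2 \<notin> X \<union> Y\<^sub>1 \<union> Y\<^sub>2" "v\<^sub>1 \<noteq> v\<^sub>2"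
      and c: "card Y\<^sub>1 + card Y\<^sub>2 = card X + 1" "card X + 1 = p"
      and cX: "induces_complete G X" and cY: "induces_complete G (Y\<^sub>1 \<union> Y\<^sub>2)"
      and XY: "\<forall>x\<in>X. \<forall>y\<in>Y\<^sub>1 \<union> Y\<^sub>2. {x, y} \<notin> uedges G"
      and N: "neighborhood G v\<^sub>1 = X \<union> Y\<^sub>1" "neighborhood G v\<^sub>2 = X \<union> Y\<^sub>2"
      using * by simp_all
    have fin: "finite (uverts G)" and edge: "\<And>e. e \<in> uedges G \<Longrightarrow> e \<subseteq> uverts G \<and> card e = 2"
      using simple by (auto simp: simple_graph_def)
    have bs: "blowup_sets p X Y\<^sub>1 Y\<^sub>2 v\<^sub>1 v\<^sub>2"
      using fin ne disj v c by (simp add: blowup_sets_def V)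
    have N1: "{v\<^sub>1, u} \<in> uedges G \<longleftrightarrow> u \<in> X \<union> Y\<^sub>1" and N2: "{v\<^sub>2, u} \<in> uedges G \<longleftrightarrow> u \<in> X \<union> Y\<^sub>2" for u
      using N by (auto simp: neighborhood_def)
    have DV: "pverts D = uverts G" and DE: "(u, v) \<in> parcs D \<longleftrightarrow> {u, v} \<in> uedges G" for u v
      by (simp_all add: G(2) bidirected_def)
    have eX: "{u, v} \<in> uedges G" if "u \<in> X" "v \<in> X" "u \<noteq> v" for u v
      using cX that by (auto simp: induces_complete_def)
    have eY: "{u, v} \<in> uedges G" if "u \<in> Y\<^sub>1 \<union> Y\<^sub>2" "v \<in> Y\<^sub>1 \<union> Y\<^sub>2" "u \<noteq> v" for u v
      using cY that by (auto simp: induces_complete_def)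
    have N1': "{u, v\<^sub>1} \<in> uedges G \<longleftrightarrow> u \<in> X \<union> Y\<^sub>1" and N2': "{u, v\<^sub>2} \<in> uedges G \<longleftrightarrow> u \<in> X \<union> Y\<^sub>2" for u
      using N1[of u] N2[of u] by (simp_all add: insert_commute)
    have XY': "{y, x} \<notin> uedges G" if "x \<in> X" "y \<in> Y\<^sub>1 \<union> Y\<^sub>2" for x y
      using XY that by (metis insert_commute)
    have miss: "missing (parcs D) (pverts D) = blowup X Y\<^sub>1 Y\<^sub>2 v\<^sub>1 v\<^sub>2"
    proof (intro equalityI subrelI)
      fix a b assume "(a, b) \<in> missing (parcs D) (pverts D)"
      then have ab: "a \<in> uverts G" "b \<in> uverts G" "a \<noteq> b" "{a, b} \<notin> uedges G"
        by (auto simp: missing_def DV DE)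
      have "a \<in> X \<or> a \<in> Y\<^sub>1 \<or> a \<in> Y\<^sub>2 \<or> a = v\<^sub>1 \<or> a = v\<^sub>2" "b \<in> X \<or> b \<in> Y\<^sub>1 \<or> b \<in> Y\<^sub>2 \<or> b = v\<^sub>1 \<or> b = v\<^sub>2"
        using ab(1,2) V by auto
      then show "(a, b) \<in> blowup X Y\<^sub>1 Y\<^sub>2 v\<^sub>1 v\<^sub>2"
        using ab(3,4) eX[of a b] eY[of a b] N1[of b] N2[of b] N1'[of a] N2'[of a]
        by (elim disjE) (simp_all add: blowup_def)
    next
      fix a b assume "(a, b) \<in> blowup X Y\<^sub>1 Y\<^sub>2 v\<^sub>1 v\<^sub>2"
      then consider "a \<in> X" "b \<in> Y\<^sub>1 \<union> Y\<^sub>2" | "a = v\<^sub>1" "b \<in> Y\<^sub>2" | "a = v\<^sub>2" "b \<in> Y\<^sub>1"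
        | "a = v\<^sub>1" "b = v\<^sub>2" | "b \<in> X" "a \<in> Y\<^sub>1 \<union> Y\<^sub>2" | "b = v\<^sub>1" "a \<in> Y\<^sub>2"
        | "b = v\<^sub>2" "a \<in> Y\<^sub>1" | "b = v\<^sub>1" "a = v\<^sub>2"
        by (auto simp: blowup_def)
      then have "a \<in> uverts G \<and> b \<in> uverts G \<and> a \<noteq> b \<and> {a, b} \<notin> uedges G"
      proof cases
        case 1 then show ?thesis using XY disj V by auto
      next
        case 2 then show ?thesis using N1[of b] disj v V by auto
      next
        case 3 then show ?thesis using N2[of b] disj v V by auto
      next
        case 4 then show ?thesis using N1[of b] v V by auto
      next
        case 5 then show ?thesis using XY'[of b a] disj V by auto
      next
        case 6 then show ?thesis using N1'[of a] disj v V by auto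
      next
        case 7 then show ?thesis using N2'[of a] disj v V by auto
      next
        case 8 then show ?thesis using N1'[of a] v V by auto
      qed
      then show "(a, b) \<in> missing (parcs D) (pverts D)" by (simp add: missing_def DV DE)
    qed
    have sub: "X \<union> Y\<^sub>1 \<union> Y\<^sub>2 \<union> {v\<^sub>1, v\<^sub>2} \<subseteq> pverts D" by (simp add: DV V)
    have "extremal p (parcs D) (pverts D)" by (rule extremal_blowupI[OF bs False sub miss])
    moreover have "card (pverts D) = 2 * p + 1"
      using blowup_sets_card[OF bs] by (simp add: DV V)
    moreover have "irrefl (parcs D)" using edge by (fastforce simp: irrefl_def DE)
    moreover have "parcs D \<subseteq> pverts D \<times> pverts D" using edge DE DV by fastforce
    ultimately show ?thesis using fin DV by simp
  qed
  then show "extremal p (parcs D) (pverts D)" "card (pverts D) = 2 * p + 1" "finite (pverts D)"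
    "irrefl (parcs D)" "parcs D \<subseteq> pverts D \<times> pverts D" by blast+
qed

lemma extremal_mem_digraph_DG:
  fixes E :: "nat rel"
  assumes "2 \<le> p" "extremal p E V" "finite V" "card V = 2 * p + 1" "irrefl E" "E \<subseteq> V \<times> V"
  shows "\<lparr> pverts = V, parcs = E \<rparr> \<in> digraph_DG (p + 1)"
proof -
  have p1: "p \<noteq> 1" using assms(1) by simp
  obtain X Y\<^sub>1 Y\<^sub>2 v\<^sub>1 v\<^sub>2 where bs: "blowup_sets p X Y\<^sub>1 Y\<^sub>2 v\<^sub>1 v\<^sub>2"
    and sub: "X \<union> Y\<^sub>1 \<union> Y\<^sub>2 \<union> {v\<^sub>1, v\<^sub>2} \<subseteq> V" and miss: "missing E V = blowup X Y\<^sub>1 Y\<^sub>2 v\<^sub>1 v\<^sub>2"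
    using extremal_blowup[OF assms(2) p1] by metis
  have V: "X \<union> Y\<^sub>1 \<union> Y\<^sub>2 \<union> {v\<^sub>1, v\<^sub>2} = V"
    using blowup_sets_card[OF bs] assms(4) by (intro card_subset_eq[OF assms(3) sub]) simp
  have E: "(u, v) \<in> E \<longleftrightarrow> u \<in> V \<and> v \<in> V \<and> u \<noteq> v \<and> (u, v) \<notin> blowup X Y\<^sub>1 Y\<^sub>2 v\<^sub>1 v\<^sub>2" for u v
    using assms(5,6) unfolding miss[symmetric] by (auto simp: missing_def irrefl_def)
  have sym: "(u, v) \<in> E \<longleftrightarrow> (v, u) \<in> E" for u v using E blowup_sym by metis
  define G where "G = \<lparr> uverts = V, uedges = {{u, v} | u v. (u, v) \<in> E} \<rparr>"
  have edge: "{u, v} \<in> uedges G \<longleftrightarrow> (u, v) \<in> E" for u v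
    using sym by (auto simp: G_def doubleton_eq_iff)
  have "bidirected G = \<lparr> pverts = V, parcs = E \<rparr>" by (simp add: bidirected_def edge) (simp add: G_def)
  moreover have "G \<in> DG (p + 1)"
  proof -
    have "card e = 2 \<and> e \<subseteq> V" if e: "e \<in> uedges G" for e
    proof -
      obtain u v where "e = {u, v}" "(u, v) \<in> E" using e by (auto simp: G_def)
      then show ?thesis using E[of u v] by simp
    qed
    then have "simple_graph G" using assms(3) by (simp add: simple_graph_def G_def)
    moreover have "uverts G = X \<union> Y\<^sub>1 \<union> Y\<^sub>2 \<union> {v\<^sub>1, v\<^sub>2}" unfolding V by (simp add: G_def)
    moreover have "induces_complete G X" "induces_complete G (Y\<^sub>1 \<union> Y\<^sub>2)"
      using bs unfolding induces_complete_def edge E V[symmetric] by (auto simp: blowup_def blowup_sets_def)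
    moreover have "\<forall>x\<in>X. \<forall>y\<in>Y\<^sub>1 \<union> Y\<^sub>2. {x, y} \<notin> uedges G"
      unfolding edge E by (auto simp: blowup_def)
    moreover have "neighborhood G v\<^sub>1 = X \<union> Y\<^sub>1" "neighborhood G v\<^sub>2 = X \<union> Y\<^sub>2"
      using bs unfolding neighborhood_def edge E V[symmetric] by (auto simp: blowup_def blowup_sets_def)
    ultimately show ?thesis
      using bs assms(1) unfolding DG_def blowup_sets_def
      by (intro CollectI conjI exI[of _ X] exI[of _ Y\<^sub>1] exI[of _ Y\<^sub>2] exI[of _ v\<^sub>1] exI[of _ v\<^sub>2]) simp_all
  qed
  ultimately show ?thesis using p1 by (auto simp: digraph_DG_def intro!: image_eqI[of _ _ G])
qed

lemma map_digraph_eq_dirac_join: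
  assumes "finite (pverts D)" "irrefl (parcs D)" "parcs D \<subseteq> pverts D \<times> pverts D"
    and "C \<subseteq> pverts D" "missing (parcs D) (pverts D) \<subseteq> C \<times> C" "card (pverts D - C) = m" "inj_on d C"
  shows "\<exists>g. inj_on g (pverts D) \<and> map_digraph g D =
    bidirected (complete_graph m) \<boxplus> \<lparr> pverts = d ` C, parcs = map_prod d d ` (parcs D \<inter> C \<times> C) \<rparr>"
proof -
  define W where "W = pverts D - C"
  have V: "pverts D = W \<union> C" "W \<inter> C = {}" using assms(4) by (auto simp: W_def)
  obtain e where e: "bij_betw e W {..<m}"
    using ex_bij_betw_finite_nat[of W] assms(1,6) by (auto simp: W_def lessThan_atLeast0)
  have eW: "e ` W = {..<m}" and e_inj: "inj_on e W" using e by (auto simp: bij_betw_def)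
  define g where "g v = (if v \<in> C then Inr (d v) else Inl (e v))" for v
  have gC: "g v = Inr (d v)" if "v \<in> C" for v using that by (simp add: g_def)
  have gW: "g v = Inl (e v)" if "v \<in> W" for v using that V(2) by (auto simp: g_def)
  have inj: "inj_on g (pverts D)"
  proof (rule inj_onI)
    fix x y assume "x \<in> pverts D" "y \<in> pverts D" "g x = g y"
    then show "x = y" using V inj_onD[OF e_inj, of x y] inj_onD[OF assms(7), of x y]
      by (auto simp: gC gW)
  qed
  have img: "g ` W = Inl ` {..<m}" "g ` C = Inr ` d ` C"
    unfolding eW[symmetric] image_image using gW gC by (auto intro!: image_cong)
  define K where "K = {(u, v). u \<in> W \<and> v \<in> W \<and> u \<noteq> v}"
  have E: "parcs D = K \<union> (parcs D \<inter> C \<times> C) \<union> W \<times> C \<union> C \<times> W"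
  proof
    show "parcs D \<subseteq> K \<union> (parcs D \<inter> C \<times> C) \<union> W \<times> C \<union> C \<times> W"
      using assms(2,3) V unfolding K_def irrefl_def by auto
    have "(u, v) \<in> parcs D" if "u \<in> pverts D" "v \<in> pverts D" "u \<noteq> v" "u \<notin> C \<or> v \<notin> C" for u v
      using assms(5) that by (auto simp: missing_def)
    then show "K \<union> (parcs D \<inter> C \<times> C) \<union> W \<times> C \<union> C \<times> W \<subseteq> parcs D"
      using V unfolding K_def by blast
  qed
  have prod: "map_prod g g ` (A \<times> B) = g ` A \<times> g ` B" for A B
    by (rule map_prod_image_Times)
  have mK: "map_prod g g ` K = map_prod Inl Inl ` {(u, v). u < m \<and> v < m \<and> u \<noteq> v}"
  proof (intro equalityI subrelI)
    fix a b assume "(a, b) \<in> map_prod g g ` K"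
    then obtain u v where uv: "u \<in> W" "v \<in> W" "u \<noteq> v" "a = Inl (e u)" "b = Inl (e v)"
      using gW by (auto simp: K_def)
    then have "e u < m" "e v < m" "e u \<noteq> e v" using eW inj_onD[OF e_inj, of u v] by auto
    then show "(a, b) \<in> map_prod Inl Inl ` {(u, v). u < m \<and> v < m \<and> u \<noteq> v}"
      using uv by force
  next
    fix a b :: "nat + 'b" assume "(a, b) \<in> map_prod Inl Inl ` {(u, v). u < m \<and> v < m \<and> u \<noteq> v}"
    then obtain i j where ij: "i < m" "j < m" "i \<noteq> j" "a = Inl i" "b = Inl j" by auto
    then have "i \<in> e ` W" "j \<in> e ` W" using eW by simp_all
    then obtain u v where uv: "u \<in> W" "i = e u" "v \<in> W" "j = e v" by blast
    then have "(u, v) \<in> K" using ij(3) by (auto simp: K_def)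
    moreover have "(a, b) = map_prod g g (u, v)" using uv ij gW by simp
    ultimately show "(a, b) \<in> map_prod g g ` K" by blast
  qed
  have mC: "map_prod g g ` (parcs D \<inter> C \<times> C) = map_prod Inr Inr ` map_prod d d ` (parcs D \<inter> C \<times> C)"
    unfolding image_image by (rule image_cong[OF refl]) (auto simp: gC)
  have "map_prod g g ` parcs D = map_prod g g ` K \<union> map_prod g g ` (parcs D \<inter> C \<times> C)
      \<union> g ` W \<times> g ` C \<union> g ` C \<times> g ` W"
    by (subst E) (simp only: image_Un prod)
  then have "map_digraph g D =
      bidirected (complete_graph m) \<boxplus> \<lparr> pverts = d ` C, parcs = map_prod d d ` (parcs D \<inter> C \<times> C) \<rparr>"
    unfolding map_digraph_def dirac_join_def pverts_complete_graph parcs_complete_graph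
    by (simp add: mK mC img V(1) image_Un)
  then show ?thesis using inj by blast
qed

lemma map_digraph_extremal:
  assumes "wf_digraph (with_proj D)" "inj_on g (pverts D)"
    and "extremal p (parcs (map_digraph g D)) (pverts (map_digraph g D))"
  shows "extremal p (parcs D) (pverts D)"
proof -
  have sub: "parcs D \<subseteq> pverts D \<times> pverts D"
    using wf_digraph.head_in_verts[OF assms(1)] wf_digraph.tail_in_verts[OF assms(1)] by fastforce
  let ?h = "the_inv_into (pverts D) g"
  have inv: "?h (g v) = v" if "v \<in> pverts D" for v using the_inv_into_f_f[OF assms(2) that] .
  show ?thesis
  proof (rule extremal_map[OF assms(3)])
    show "inj_on ?h (pverts (map_digraph g D))"
      using inj_on_the_inv_into[OF assms(2)] by (simp add: map_digraph_def)
    show "?h ` pverts (map_digraph g D) \<subseteq> pverts D" using inv by (auto simp: map_digraph_def)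
    have "map_prod ?h ?h ` map_prod g g ` missing (parcs D) (pverts D) = (\<lambda>x. x) ` missing (parcs D) (pverts D)"
      unfolding image_image by (rule image_cong[OF refl]) (auto simp: missing_def inv)
    then show "missing (parcs D) (pverts D) =
        map_prod ?h ?h ` missing (parcs (map_digraph g D)) (pverts (map_digraph g D))"
      using missing_map[OF assms(2) sub] by (simp add: map_digraph_def)
  qed
qed

lemma extremal_imp_mem_iso_closure:
  fixes D :: "'a pair_pre_digraph"
  assumes p: "1 \<le> p" "p + 1 \<le> k"
    and D: "pair_digraph D" "card (pverts D) = k + p" "extremal p (parcs D) (pverts D)"
  shows "D \<in> iso_closure ((\<lambda>D. bidirected (complete_graph (k - p - 1)) \<boxplus> D) ` digraph_DG (p + 1))"
proof -
  note facts = pair_digraph_facts[OF D(1)]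
  have "\<exists>C d. C \<subseteq> pverts D \<and> missing (parcs D) (pverts D) \<subseteq> C \<times> C \<and> card C = 2 * p + 1 \<and> inj_on d C \<and>
      \<lparr> pverts = d ` C, parcs = map_prod d d ` (parcs D \<inter> C \<times> C) \<rparr> \<in> digraph_DG (p + 1)"
  proof (cases "p = 1")
    case True
    then obtain a b c where abc: "{a, b, c} \<subseteq> pverts D" "a \<noteq> b" "b \<noteq> c" "c \<noteq> a"
      and miss: "missing (parcs D) (pverts D) = {(b, a), (c, b), (a, c)}"
      using D(3) by (auto simp: extremal_def)
    define d :: "'a \<Rightarrow> nat" where "d v = (if v = a then 0 else if v = b then 1 else 2)" for v
    have d: "d a = 0" "d b = 1" "d c = 2" using abc by (auto simp: d_def)
    have "(u, v) \<in> parcs D \<inter> {a, b, c} \<times> {a, b, c} \<longleftrightarrow> (u, v) \<in> {(a, b), (b, c), (c, a)}" for u v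
    proof -
      have "(u, v) \<in> parcs D \<longleftrightarrow> u \<noteq> v \<and> (u, v) \<notin> {(b, a), (c, b), (a, c)}"
        if "u \<in> {a, b, c}" "v \<in> {a, b, c}"
      proof -
        have "u \<in> pverts D" "v \<in> pverts D" using that abc(1) by auto
        then show ?thesis unfolding miss[symmetric] using facts(2) by (auto simp: missing_def irrefl_def)
      qed
      then show ?thesis using abc(2-4) by auto
    qed
    then have "parcs D \<inter> {a, b, c} \<times> {a, b, c} = {(a, b), (b, c), (c, a)}" by (intro equalityI subrelI) blast+
    then have "\<lparr> pverts = d ` {a, b, c}, parcs = map_prod d d ` (parcs D \<inter> {a, b, c} \<times> {a, b, c}) \<rparr>
        = \<lparr> pverts = {0, 1, 2}, parcs = {(0, 1), (1, 2), (2, 0)} \<rparr>"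
      using d by simp
    also have "\<dots> = directed_cycle 3"
    proof -
      have "{..<3} = {0, 1, 2::nat}" by auto
      then show ?thesis by (simp add: directed_cycle_def numeral_2_eq_2)
    qed
    finally have "\<lparr> pverts = d ` {a, b, c}, parcs = map_prod d d ` (parcs D \<inter> {a, b, c} \<times> {a, b, c}) \<rparr> \<in> digraph_DG (p + 1)"
      using True by (simp add: digraph_DG_def)
    moreover have "inj_on d {a, b, c}" using abc by (auto simp: d inj_on_def)
    moreover have "card {a, b, c} = 2 * p + 1" using abc True by auto
    moreover have "missing (parcs D) (pverts D) \<subseteq> {a, b, c} \<times> {a, b, c}" by (simp add: miss)
    ultimately show ?thesis using abc(1) by (intro exI[of _ "{a, b, c}"] exI[of _ d]) simp
  next
    case False
    obtain X Y\<^sub>1 Y\<^sub>2 v\<^sub>1 v\<^sub>2 where bs: "blowup_sets p X Y\<^sub>1 Y\<^sub>2 v\<^sub>1 v\<^sub>2"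
      and sub: "X \<union> Y\<^sub>1 \<union> Y\<^sub>2 \<union> {v\<^sub>1, v\<^sub>2} \<subseteq> pverts D"
      and miss: "missing (parcs D) (pverts D) = blowup X Y\<^sub>1 Y\<^sub>2 v\<^sub>1 v\<^sub>2"
      using extremal_blowup[OF D(3) False] by metis
    define C where "C = X \<union> Y\<^sub>1 \<union> Y\<^sub>2 \<union> {v\<^sub>1, v\<^sub>2}"
    have cC: "card C = 2 * p + 1" unfolding C_def by (rule blowup_sets_card[OF bs])
    have CV: "C \<subseteq> pverts D" using sub by (simp add: C_def)
    have finC: "finite C" using CV facts(1) finite_subset by blast
    have missC: "missing (parcs D) (pverts D) \<subseteq> C \<times> C"
      unfolding miss by (auto simp: blowup_def C_def)
    obtain d :: "'a \<Rightarrow> nat" where d: "inj_on d C"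
      using finite_imp_inj_to_nat_seg[OF finC] by auto
    have "missing (parcs D \<inter> C \<times> C) C = missing (parcs D) (pverts D)"
      using missC CV by (auto simp: missing_def)
    then have mC: "missing (parcs D \<inter> C \<times> C) C = blowup X Y\<^sub>1 Y\<^sub>2 v\<^sub>1 v\<^sub>2" unfolding miss .
    have "extremal p (parcs D \<inter> C \<times> C) C"
      by (rule extremal_blowupI[OF bs False _ mC]) (simp add: C_def)
    moreover have "missing (map_prod d d ` (parcs D \<inter> C \<times> C)) (d ` C) = map_prod d d ` missing (parcs D \<inter> C \<times> C) C"
      by (rule missing_map[OF d]) auto
    ultimately have "extremal p (map_prod d d ` (parcs D \<inter> C \<times> C)) (d ` C)"
      using extremal_map[OF _ d] by blast
    moreover have "irrefl (map_prod d d ` (parcs D \<inter> C \<times> C))"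
    proof (rule irreflI, rule notI)
      fix x assume "(x, x) \<in> map_prod d d ` (parcs D \<inter> C \<times> C)"
      then obtain u v where uv: "(u, v) \<in> parcs D" "u \<in> C" "v \<in> C" "x = d u" "x = d v" by auto
      then have "u = v" using inj_onD[OF d] by metis
      then show False using uv(1) facts(2) by (simp add: irrefl_def)
    qed
    moreover have "card (d ` C) = 2 * p + 1" using cC card_image[OF d] by simp
    moreover have "map_prod d d ` (parcs D \<inter> C \<times> C) \<subseteq> d ` C \<times> d ` C" by auto
    ultimately have "\<lparr> pverts = d ` C, parcs = map_prod d d ` (parcs D \<inter> C \<times> C) \<rparr> \<in> digraph_DG (p + 1)"
      using False p(1) finC by (intro extremal_mem_digraph_DG) auto
    then show ?thesis using CV missC cC d by blast
  qed
  then obtain C d where C: "C \<subseteq> pverts D" "missing (parcs D) (pverts D) \<subseteq> C \<times> C" "card C = 2 * p + 1"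
    and d: "inj_on d C"
    and DG: "\<lparr> pverts = d ` C, parcs = map_prod d d ` (parcs D \<inter> C \<times> C) \<rparr> \<in> digraph_DG (p + 1)" by blast
  have "finite C" using C(1) facts(1) finite_subset by blast
  then have "card (pverts D - C) = k - p - 1" using C(1,3) D(2) by (simp add: card_Diff_subset)
  from map_digraph_eq_dirac_join[OF facts(1-3) C(1,2) this d]
  obtain g where g: "inj_on g (pverts D)" "map_digraph g D = bidirected (complete_graph (k - p - 1)) \<boxplus>
      \<lparr> pverts = d ` C, parcs = map_prod d d ` (parcs D \<inter> C \<times> C) \<rparr>" by blast
  have "digraph_iso (with_proj D) (with_proj (map_digraph g D))"
    by (rule digraph_iso_map_digraph[OF facts(4) g(1)])
  then show ?thesis using DG unfolding g(2) iso_closure_def by blast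
qed

lemma mem_iso_closure_imp_extremal:
  fixes D :: "'a pair_pre_digraph"
  assumes p: "1 \<le> p" "p + 1 \<le> k"
    and "D \<in> iso_closure ((\<lambda>D. bidirected (complete_graph (k - p - 1)) \<boxplus> D) ` digraph_DG (p + 1))"
  shows "pair_digraph D \<and> card (pverts D) = k + p \<and> extremal p (parcs D) (pverts D)"
proof -
  define K where "K = bidirected (complete_graph (k - p - 1))"
  obtain D\<^sub>0 where D0: "D\<^sub>0 \<in> digraph_DG (p + 1)" and iso: "digraph_iso (with_proj D) (with_proj (K \<boxplus> D\<^sub>0))"
    using assms(3) unfolding iso_closure_def K_def by blast
  note D0 = digraph_DG_extremal[OF D0 p(1)]
  obtain g where wf: "wf_digraph (with_proj D)" and g: "inj_on g (pverts D)" and eq: "K \<boxplus> D\<^sub>0 = map_digraph g D"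
    using digraph_isoD[OF iso] by metis
  have V: "pverts (K \<boxplus> D\<^sub>0) = Inl ` {..<k - p - 1} \<union> Inr ` pverts D\<^sub>0"
    by (simp add: dirac_join_def K_def pverts_complete_graph)
  have gV: "g ` pverts D = pverts (K \<boxplus> D\<^sub>0)" unfolding eq by (simp add: map_digraph_def)
  have gE: "map_prod g g ` parcs D = parcs (K \<boxplus> D\<^sub>0)" unfolding eq by (simp add: map_digraph_def)
  have fin: "finite (pverts D)" using finite_imageD[OF _ g] D0(3) unfolding gV V by simp
  have "card (pverts D) = card (pverts (K \<boxplus> D\<^sub>0))" using card_image[OF g] gV by simp
  also have "\<dots> = card (Inl ` {..<k - p - 1} :: (nat + nat) set) + card (Inr ` pverts D\<^sub>0 :: (nat + nat) set)"
    unfolding V using D0(3) by (intro card_Un_disjoint) auto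
  also have "\<dots> = k + p" using D0(2) p(2) by (simp add: card_image)
  finally have card: "card (pverts D) = k + p" .
  have sub: "parcs D \<subseteq> pverts D \<times> pverts D"
    using wf_digraph.head_in_verts[OF wf] wf_digraph.tail_in_verts[OF wf] by fastforce
  have "(x, x) \<notin> parcs (K \<boxplus> D\<^sub>0)" for x
    using D0(4) by (auto simp: dirac_join_def K_def parcs_complete_graph irrefl_def)
  then have "irrefl (parcs D)" unfolding gE[symmetric] irrefl_def by force
  then have D: "pair_digraph D" using pair_digraphI fin sub by blast
  have "extremal p (parcs (K \<boxplus> D\<^sub>0)) (pverts (K \<boxplus> D\<^sub>0))"
  proof (rule extremal_map[OF D0(1)])
    show "Inr ` pverts D\<^sub>0 \<subseteq> pverts (K \<boxplus> D\<^sub>0)" unfolding V by blast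
    show "missing (parcs (K \<boxplus> D\<^sub>0)) (pverts (K \<boxplus> D\<^sub>0)) = map_prod Inr Inr ` missing (parcs D\<^sub>0) (pverts D\<^sub>0)"
      unfolding K_def by (rule missing_dirac_join_complete)
  qed simp
  then have "extremal p (parcs D) (pverts D)" using map_digraph_extremal[OF wf g] unfolding eq by blast
  then show ?thesis using D card by blast
qed

theorem theorem4p1:
  fixes p k n :: nat
  assumes "1 \<le> p" and "p \<le> k - 1" and "n = k + p"
  shows "(EXT k n :: 'a pair_pre_digraph set) =
           iso_closure ((\<lambda>D. bidirected (complete_graph (k - p - 1)) \<boxplus> D) ` digraph_DG (p + 1))
       \<and> int (ext k n) =
           (if p = 1 then 2 * int (n choose 2) - 3
            else 2 * (int (n choose 2) - (int p ^ 2 + 1)))"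
proof
  have k: "p + 1 \<le> k" using assms(1,2) by linarith
  show "(EXT k n :: 'a pair_pre_digraph set) =
      iso_closure ((\<lambda>D. bidirected (complete_graph (k - p - 1)) \<boxplus> D) ` digraph_DG (p + 1))"
  proof (rule set_eqI)
    fix D :: "'a pair_pre_digraph"
    show "D \<in> EXT k n \<longleftrightarrow>
        D \<in> iso_closure ((\<lambda>D. bidirected (complete_graph (k - p - 1)) \<boxplus> D) ` digraph_DG (p + 1))"
      unfolding assms(3) EXT_iff[OF assms(1) k]
      using extremal_imp_mem_iso_closure[OF assms(1) k] mem_iso_closure_imp_extremal[OF assms(1) k] by blast
  qed
  have "int (ext k n) + int (missing_bound p) = 2 * int (n choose 2)"
    using ext_add_missing_bound[OF assms(1) k] unfolding assms(3) by linarith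
  moreover have "int (missing_bound p) = (if p = 1 then 3 else 2 * (int p ^ 2 + 1))"
    using assms(1) by (simp add: missing_bound_def)
  ultimately show "int (ext k n) = (if p = 1 then 2 * int (n choose 2) - 3
      else 2 * (int (n choose 2) - (int p ^ 2 + 1)))"
    by (simp split: if_splits)
qed

end
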